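(* Let $d\ge 1$ be a positive integer and let $A,B\in\mathcal{M}_{d,d}(\mathbb{C})$ be two complex Hermitian matrices with positive eigenvalues, denoted $a=(a_1,\dots,a_d)$ and $b=(b_1,\dots,b_d)$ respectively. Let $U$ be a Haar-distributed random unitary $d\times d$ matrix. Let $1\le k\le l\le d$ be two integers such that $d\ge k+l$. Then $$\mathbb{E}\big[e_k(AUBU^{*})\,e_l(AUBU^{*})\big]=\frac{1}{l!\,k!}\sum_{y,m=0}^{k}\tilde M_m(a)\,\tilde M_y(b)\sum_{\substack{K_1,K_2\in D(k,l)\\ t(K_1)=(2^m,1^{k+l-2m})\\ t(K_2)=(2^y,1^{k+l-2y})}}2^{\mathsf{C}(K_1,K_2)}\sum_{h=0}^{(K_1,K_2)[k]}\tilde B\big((K_1,K_2)[k+l]-h,\,h\big)\,\frac{1}{(d+1)_{h+\tilde{\mathsf S}(K_1,K_2)}\,(d)_{k+l-h-\tilde{\mathsf S}(K_1,K_2)}},$$ with: (1) $$\tilde B\big((K_1,K_2)[k+l]-h,h\big)=\frac{B\big((K_1,K_2)[k+l]-h,h\big)}{\binom{(K_1,K_2)[k+l]}{(K_1,K_2)[k]}}=\frac{\binom{(K_1,K_2)[k+l]}{h}-\binom{(K_1,K_2)[k+l]}{h-1}}{\binom{(K_1,K_2)[k+l]}{(K_1,K_2)[k]}},$$ where $B(p,q)=\binom{p+q}{q}-\binom{p+q}{q-1}$, $p\ge q$, are the weak ballot numbers. The number $B(p,q)$ counts the lattice paths from $(0,0)$ to $(p+q,p-q)$ with steps $(1,1)$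 and $(1,-1)$ that never dip below the $x$-axis; when $p=q$ these are exactly Dyck paths, and $B(p,p)$ is the $p$-th Catalan number. (2) $\tilde M_r(a)=r!\,(k+l-2r)!\,M_r(a)$, where $M_r(a)$ is the monomial symmetric polynomial associated to the partition $(2^r,1^{k+l-2r})$ in the variables $a=(a_1,\dots,a_d)$ (and likewise for $b$). (3) $(d)_n=d(d-1)\cdots(d-n+1)$ is the falling factorial.
   Context: For a $d\times d$ matrix $W$, $e_k(W)$ denotes the $k$-th elementary symmetric polynomial in the eigenvalues of $W$. Write $[n]=\{1,\dots,n\}$. $D(k,l)$ is the set of partitions of the set $\{1,\dots,k+l\}$ all of whose blocks contain at most one element of $\{1,\dots,k\}$ and at most one element of $\{k+1,\dots,k+l\}$. Thus each block has size $1$ or $2$; write $t(K)=(2^y,1^{k+l-2y})$ if $K$ has exactly $y$ blocks of size $2$ and $k+l-2y$ singleton blocks. For $K_1,K_2\in D(k,l)$, let $K_1\vee K_2$ be their join (the finest partition coarser than both). A singleton of $K_i$ is an element $x$ with $\{x\}\in K_i$. - An alternating cycle is a block of $K_1\vee K_2$ of cardinality at least $2$ containing no singletons of either $K_1$ or $K_2$. $\mathsf C(K_1,K_2)$ is the number of alternating cycles of $K_1\vee K_2$. - An alternating segment is a block of $K_1\vee K_2$ containing exactly two elements which are singletons in $K_1$, or exactly two elements which are singletons in $K_2$. $\mathsf S(K_1,K_2)$ is the number of alternating segments of $K_1\vee K_2$. If $t(K_1)=(2^{y_1},1^{k+l-2y_1})$ and $t(K_2)=(2^{y_2},1^{k+l-2y_2})$,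 set $\tilde{\mathsf S}(K_1,K_2)=\tfrac12\big(y_1+y_2+\mathsf S(K_1,K_2)\big)$. The numbers of shared singletons of $K_1$ and $K_2$ are denoted $$(K_1,K_2)[k+l]=\big|\{x\in[k+l]:\{x\}\in K_1\cap K_2\}\big|=k+l-2\tilde{\mathsf S}(K_1,K_2),$$ $$(K_1,K_2)[k]=\big|\{x\in[k]:\{x\}\in K_1\cap K_2\}\big|=k-\tilde{\mathsf S}(K_1,K_2),$$ where the right-most equality in each line is asserted as a consequence of the definitions. The monomial symmetric polynomial of a partition $\lambda$ of length at most $d$ in $d$ variables is the sum of $x^\alpha=x_1^{\alpha_1}\cdots x_d^{\alpha_d}$ over all distinct permutations $\alpha$ of $\lambda$ padded with zeros to length $d$. Conventions: $\binom{n}{-1}=0$, and a falling factorial with index $0$ equals $1$.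
   Formalization: (K1,K2)[k+l] and (K1,K2)[k] are taken as k+l−2S̃ and k−S̃, not as the numbers of shared singletons: the asserted equality fails (k=1, l=2, K1={{1,2},{3}}, K2={{1,3},{2}}: 0 versus 1), and with the cardinalities the formula is false at k=l=2. *)

theory Defs
  imports
    "HOL-Probability.Probability"
    "HOL-Computational_Algebra.Fundamental_Theorem_Algebra"
    "HOL-Combinatorics.Permutations"
begin

definition conj_transpose :: "complex^'n^'m \<Rightarrow> complex^'m^'n" where
  "conj_transpose A = map_matrix cnj (transpose A)"

definition hermitian :: "complex^'n^'n \<Rightarrow> bool" where
  "hermitian A \<longleftrightarrow> conj_transpose A = A"

definition unitary :: "complex^'n^'n \<Rightarrow> bool" where
  "unitary U \<longleftrightarrow> U ** conj_transpose U = mat 1 \<and> conj_transpose U ** U = mat 1"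

definition char_poly :: "complex^'n^'n \<Rightarrow> complex poly" where
  "char_poly A = det (mat [:0, 1:] - map_matrix (\<lambda>c. [:c:]) A)"

text \<open>The family \<open>x\<close>, indexed by the coordinate type, lists the eigenvalues of \<open>A\<close> with
  algebraic multiplicity.\<close>

definition eigenvalue_family :: "complex^'n^'n \<Rightarrow> ('n \<Rightarrow> complex) \<Rightarrow> bool" where
  "eigenvalue_family A x \<longleftrightarrow> image_mset x (mset_set UNIV) = proots (char_poly A)"

definition elem_sym :: "nat \<Rightarrow> ('n::finite \<Rightarrow> 'a::comm_ring_1) \<Rightarrow> 'a" where
  "elem_sym k x = (\<Sum>I | card I = k. \<Prod>i\<in>I. x i)"

text \<open>A listing of the eigenvalues exists and its choice does not matter: see the lemmas
  \<open>eigenvalue_family_exists\<close> and \<open>elem_sym_eigenvalues_eq\<close> below.\<close>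

definition elem_sym_eigenvalues :: "nat \<Rightarrow> complex^'n^'n \<Rightarrow> complex" where
  "elem_sym_eigenvalues k A = elem_sym k (SOME x. eigenvalue_family A x)"

lemma degree_char_poly: "degree (char_poly (A :: complex^'n^'n)) = CARD('n)"
proof -
  define N where "N = (mat [:0, 1:] - map_matrix (\<lambda>c. [:c:]) A :: complex poly^'n^'n)"
  have N: "N $ i $ j = (if i = j then [:- (A $ i $ j), 1:] else [:- (A $ i $ j):])" for i j
    by (simp add: N_def mat_def)
  define t where "t p = (of_int (sign p) * (\<Prod>i\<in>UNIV. N $ i $ p i) :: complex poly)" for p
  have deg_off: "degree (t p) < CARD('n)" if p: "p permutes (UNIV :: 'n set)" "p \<noteq> id" for p
  proof -
    from p obtain i0 where i0: "p i0 \<noteq> i0" by (auto simp: fun_eq_iff)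
    have "degree (t p) \<le> degree (\<Prod>i\<in>UNIV. N $ i $ p i)"
      unfolding t_def by (cases "sign p = 1") (auto simp: sign_def)
    also have "\<dots> \<le> (\<Sum>i\<in>UNIV. degree (N $ i $ p i))"
      by (rule degree_prod_sum_le[unfolded o_def]) simp
    also have "\<dots> < (\<Sum>i\<in>(UNIV::'n set). 1)"
    proof (rule sum_strict_mono_ex1)
      show "\<forall>i\<in>UNIV. degree (N $ i $ p i) \<le> 1" by (auto simp: N)
      show "\<exists>i\<in>UNIV. degree (N $ i $ p i) < 1"
        by (intro bexI[of _ i0]) (use i0 in \<open>auto simp: N\<close>)
    qed simp
    finally show ?thesis by simp
  qed
  have t_id: "t id = (\<Prod>i\<in>UNIV. [:- (A $ i $ i), 1:])"
    by (simp add: t_def N)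
  have deg_id: "degree (t id) = CARD('n)"
    unfolding t_id by (subst degree_prod_sum_eq) auto
  let ?P = "{p. p permutes (UNIV :: 'n set)}"
  have fin: "finite ?P" by simp
  have "char_poly A = (\<Sum>p\<in>?P. t p)"
    by (simp add: char_poly_def det_def N_def t_def)
  also have "\<dots> = t id + (\<Sum>p\<in>?P - {id}. t p)"
    by (rule sum.remove) (auto simp: permutes_id)
  finally have eq: "char_poly A = t id + (\<Sum>p\<in>?P - {id}. t p)" .
  have "degree (\<Sum>p\<in>?P - {id}. t p) < CARD('n)"
    by (rule degree_sum_less) (use deg_off in auto)
  then show ?thesis
    unfolding eq using deg_id by (simp add: degree_add_eq_left)
qed

lemma eigenvalue_family_exists: "\<exists>x. eigenvalue_family (A :: complex^'n^'n) x"
proof -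
  obtain xs where xs: "mset xs = proots (char_poly A)" using ex_mset by blast
  have len: "length xs = CARD('n)"
    using size_proots_complex[of "char_poly A"] degree_char_poly[of A] xs by (metis size_mset)
  obtain h where h: "bij_betw h (UNIV :: 'n set) {..<length xs}"
    using ex_bij_betw_finite_nat[of "UNIV :: 'n set"] len by (auto simp: atLeast0LessThan)
  have "image_mset (\<lambda>i. xs ! h i) (mset_set UNIV) = image_mset ((!) xs) (image_mset h (mset_set UNIV))"
    by (simp add: multiset.map_comp o_def)
  also have "image_mset h (mset_set UNIV) = mset_set {..<length xs}"
    using h by (simp add: bij_betw_def image_mset_mset_set)
  also have "image_mset ((!) xs) (mset_set {..<length xs}) = mset xs"
    by (metis atLeast_upt map_nth mset_map mset_set_set distinct_upt)
  finally show ?thesis unfolding eigenvalue_family_def xs by blast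
qed

lemma elem_sym_eigenvalues_eq:
  fixes A :: "complex^'n^'n"
  assumes "eigenvalue_family A x"
  shows "elem_sym_eigenvalues k A = elem_sym k x"
proof -
  define x' where "x' = (SOME x. eigenvalue_family A x)"
  have "eigenvalue_family A x'"
    unfolding x'_def using someI[of "eigenvalue_family A" x] assms by blast
  then have "image_mset x' (mset_set UNIV) = image_mset x (mset_set UNIV)"
    using assms by (simp add: eigenvalue_family_def)
  then obtain p where p: "p permutes (UNIV :: 'n set)" "\<And>i. x' i = x (p i)"
    using image_mset_eq_implies_permutes[of "UNIV :: 'n set" x' x] by auto
  have bij: "bij p" using p(1) by (rule permutes_bij)
  have "elem_sym k x' = (\<Sum>I | card I = k. \<Prod>i\<in>p ` I. x i)"
    unfolding elem_sym_def p(2)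
    by (intro sum.cong refl) (metis (no_types, lifting) bij bij_is_inj inj_on_subset
        prod.reindex_cong subset_UNIV)
  also have "\<dots> = (\<Sum>I | card I = k. \<Prod>i\<in>I. x i)"
    by (rule sum.reindex_bij_witness[of _ "\<lambda>I. inv p ` I" "\<lambda>I. p ` I"])
       (use bij in \<open>auto simp: image_comp o_def bij_inv_eq_iff bij_is_inj bij_is_surj surj_f_inv_f
          intro!: card_image inj_on_subset[OF bij_is_inj] bij_imp_bij_inv\<close>)
  finally show ?thesis
    by (simp add: elem_sym_eigenvalues_def elem_sym_def x'_def)
qed

text \<open>Normalised Haar measure on the unitary group, regarded as a Borel measure on the space of
  all matrices that is concentrated on the unitary ones.\<close>

definition haar_unitary :: "(complex^'n^'n) measure \<Rightarrow> bool" where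
  "haar_unitary \<mu> \<longleftrightarrow>
     prob_space \<mu> \<and> sets \<mu> = sets borel \<and> (AE X in \<mu>. unitary X) \<and>
     (\<forall>V. unitary V \<longrightarrow> distr \<mu> borel (\<lambda>X. V ** X) = \<mu>)"

text \<open>Partitions are multisets of positive parts.  The sum ranges over the distinct rearrangements
  \<open>\<alpha>\<close> of \<open>\<nu>\<close> padded with zeros.\<close>

definition monomial_sym :: "nat multiset \<Rightarrow> ('n::finite \<Rightarrow> real) \<Rightarrow> real" where
  "monomial_sym \<nu> x =
     (\<Sum>\<alpha> | image_mset \<alpha> (mset_set UNIV) = \<nu> + replicate_mset (CARD('n) - size \<nu>) 0.
        \<Prod>i\<in>UNIV. x i ^ \<alpha> i)"

definition two_one_type :: "nat \<Rightarrow> nat \<Rightarrow> nat multiset" where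
  "two_one_type n r = replicate_mset r 2 + replicate_mset (n - 2 * r) 1"

definition scaled_monomial_sym :: "nat \<Rightarrow> nat \<Rightarrow> ('n::finite \<Rightarrow> real) \<Rightarrow> real" where
  "scaled_monomial_sym n r x = fact r * fact (n - 2 * r) * monomial_sym (two_one_type n r) x"

definition falling_fact :: "real \<Rightarrow> nat \<Rightarrow> real" where
  "falling_fact x n = (\<Prod>i<n. x - real i)"

definition weak_ballot :: "nat \<Rightarrow> nat \<Rightarrow> int" where
  "weak_ballot p q =
     int ((p + q) choose q) - (if q = 0 then 0 else int ((p + q) choose (q - 1)))"

text \<open>Lattice paths from \<open>(0,0)\<close> to \<open>(p+q,p-q)\<close> with steps \<open>(1,1)\<close> and \<open>(1,-1)\<close> staying weakly
  above the horizontal axis, encoded by their vertical increments.\<close>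

definition ballot_paths :: "nat \<Rightarrow> nat \<Rightarrow> int list set" where
  "ballot_paths p q =
     {w. set w \<subseteq> {1, -1} \<and> length w = p + q \<and> sum_list w = int p - int q \<and>
         (\<forall>i\<le>length w. 0 \<le> sum_list (take i w))}"

definition matchings :: "nat \<Rightarrow> nat \<Rightarrow> nat set set set" where
  "matchings k l =
     {K. partition_on {1..k+l} K \<and>
         (\<forall>X\<in>K. card (X \<inter> {1..k}) \<le> 1 \<and> card (X \<inter> {k+1..k+l}) \<le> 1)}"

definition block_type :: "'a set set \<Rightarrow> nat multiset" where
  "block_type K = image_mset card (mset_set K)"

definition partition_join :: "'a set \<Rightarrow> 'a set set \<Rightarrow> 'a set set \<Rightarrow> 'a set set" where
  "partition_join A K1 K2 =
     (THE P. refines A K1 P \<and> refines A K2 P \<and>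
        (\<forall>Q. refines A K1 Q \<and> refines A K2 Q \<longrightarrow> refines A P Q))"

lemma partition_join_exists1:
  assumes K1: "partition_on A K1" and K2: "partition_on A K2"
  shows "\<exists>!P. refines A K1 P \<and> refines A K2 P \<and>
           (\<forall>Q. refines A K1 Q \<and> refines A K2 Q \<longrightarrow> refines A P Q)"
proof (rule ex_ex1I)
  define R where "R = {(x, y). \<exists>X\<in>K1 \<union> K2. x \<in> X \<and> y \<in> X}"
  have sub: "X \<subseteq> A" "X \<noteq> {}" if "X \<in> K1 \<union> K2" for X
    using that K1 K2 by (auto simp: partition_on_def)
  have symR: "sym R" by (auto simp: R_def sym_def)
  have RA: "R \<subseteq> A \<times> A" using sub by (auto simp: R_def)
  have diagR: "(x, x) \<in> R" if "x \<in> A" for x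
    using that K1 by (auto simp: R_def partition_on_def)
  have eqv: "equiv A (R\<^sup>+)"
  proof (rule equivI)
    show "R\<^sup>+ \<subseteq> A \<times> A" using RA by (rule trancl_subset_Sigma)
    show "refl_on A (R\<^sup>+)" using diagR by (auto simp: refl_on_def)
    show "sym (R\<^sup>+)" using symR by (rule sym_trancl)
    show "trans (R\<^sup>+)" by (rule trans_trancl)
  qed
  define P where "P = A // R\<^sup>+"
  have P: "partition_on A P" unfolding P_def using eqv by (rule partition_on_quotient)
  have up: "\<exists>Y\<in>P. X \<subseteq> Y" if X: "X \<in> K1 \<union> K2" for X
  proof -
    from sub[OF X] obtain x where x: "x \<in> X" "x \<in> A" by auto
    have "X \<subseteq> R\<^sup>+ `` {x}" using x X by (auto simp: R_def intro!: r_into_trancl)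
    then show ?thesis using x unfolding P_def by (auto intro: quotientI)
  qed
  have least: "refines A P Q" if Q: "refines A K1 Q" "refines A K2 Q" for Q
  proof -
    have pQ: "partition_on A Q" using Q by (simp add: refines_def)
    have step: "y \<in> Z" if "(x, y) \<in> R" "x \<in> Z" "Z \<in> Q" for x y Z
    proof -
      from that obtain X where X: "X \<in> K1 \<union> K2" "x \<in> X" "y \<in> X" by (auto simp: R_def)
      then obtain Z' where Z': "Z' \<in> Q" "X \<subseteq> Z'" using Q by (auto simp: refines_def)
      have "Z' = Z"
        using pQ Z' that X by (auto simp: partition_on_def disjoint_def)
      then show ?thesis using X Z' by auto
    qed
    have steps: "y \<in> Z" if "(x, y) \<in> R\<^sup>+" "x \<in> Z" "Z \<in> Q" for x y Z
      using that by (induction rule: trancl_induct) (auto intro: step)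
    have "\<exists>Z\<in>Q. Y \<subseteq> Z" if "Y \<in> P" for Y
    proof -
      from that obtain x where x: "x \<in> A" "Y = R\<^sup>+ `` {x}"
        by (auto simp: P_def elim: quotientE)
      then obtain Z where "Z \<in> Q" "x \<in> Z" using pQ by (auto simp: partition_on_def)
      then show ?thesis using x steps by blast
    qed
    then show ?thesis using P pQ by (simp add: refines_def)
  qed
  show "\<exists>P. refines A K1 P \<and> refines A K2 P \<and>
           (\<forall>Q. refines A K1 Q \<and> refines A K2 Q \<longrightarrow> refines A P Q)"
  proof (intro exI[of _ P] conjI allI impI)
    show "refines A K1 P" unfolding refines_def using P up K1 by blast
    show "refines A K2 P" unfolding refines_def using P up K2 by blast
  qed (use least in blast)
next
  fix P P'
  assume "refines A K1 P \<and> refines A K2 P \<and>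
            (\<forall>Q. refines A K1 Q \<and> refines A K2 Q \<longrightarrow> refines A P Q)"
    and "refines A K1 P' \<and> refines A K2 P' \<and>
            (\<forall>Q. refines A K1 Q \<and> refines A K2 Q \<longrightarrow> refines A P' Q)"
  then show "P = P'" by (intro refines_asym[of A]) simp_all
qed

definition singletons :: "'a set set \<Rightarrow> 'a set" where
  "singletons K = {x. {x} \<in> K}"

definition num_alt_cycles :: "nat \<Rightarrow> nat \<Rightarrow> nat set set \<Rightarrow> nat set set \<Rightarrow> nat" where
  "num_alt_cycles k l K1 K2 =
     card {X \<in> partition_join {1..k+l} K1 K2.
             2 \<le> card X \<and> X \<inter> (singletons K1 \<union> singletons K2) = {}}"

definition num_alt_segments :: "nat \<Rightarrow> nat \<Rightarrow> nat set set \<Rightarrow> nat set set \<Rightarrow> nat" where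
  "num_alt_segments k l K1 K2 =
     card {X \<in> partition_join {1..k+l} K1 K2.
             card (X \<inter> singletons K1) = 2 \<or> card (X \<inter> singletons K2) = 2}"

definition num_pairs :: "'a set set \<Rightarrow> nat" where
  "num_pairs K = card {X \<in> K. card X = 2}"

text \<open>The division by two is exact: a block of the join is an alternating cycle with an even number
  of pairs, a path with an odd number of pairs (these are the alternating segments), or a path
  with an even number of pairs (possibly none), and no pair occurs in two blocks.\<close>

definition S_tilde :: "nat \<Rightarrow> nat \<Rightarrow> nat set set \<Rightarrow> nat set set \<Rightarrow> nat" where
  "S_tilde k l K1 K2 = (num_pairs K1 + num_pairs K2 + num_alt_segments k l K1 K2) div 2"

text \<open>
  The numbers of shared singletons in \<open>[k+l]\<close> and in \<open>[k]\<close>, given by their formulas in terms of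
  \<open>S_tilde\<close>.  They count the paths with an even number of pairs among the blocks of the join,
  respectively those having more elements in \<open>{1..k}\<close> than in \<open>{k+1..k+l}\<close>; so the
  subtractions do not truncate.  The cardinalities of \<open>{x. {x} \<in> K1 \<inter> K2}\<close> and of its
  intersection with \<open>{1..k}\<close> would be different numbers: for \<open>k = 1\<close>, \<open>l = 2\<close>,
  \<open>K1 = {{1,2},{3}}\<close> and \<open>K2 = {{1,3},{2}}\<close> there is no common singleton,
  while \<open>k + l - 2 * S_tilde k l K1 K2 = 1\<close>.  The expectation formula needs the numbers below;
  with the cardinalities it fails, for instance at \<open>k = l = 2\<close>.\<close>

definition shared_total :: "nat \<Rightarrow> nat \<Rightarrow> nat set set \<Rightarrow> nat set set \<Rightarrow> nat" where
  "shared_total k l K1 K2 = k + l - 2 * S_tilde k l K1 K2"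

definition shared_left :: "nat \<Rightarrow> nat \<Rightarrow> nat set set \<Rightarrow> nat set set \<Rightarrow> nat" where
  "shared_left k l K1 K2 = k - S_tilde k l K1 K2"

definition ballot_tilde :: "nat \<Rightarrow> nat \<Rightarrow> nat set set \<Rightarrow> nat set set \<Rightarrow> nat \<Rightarrow> real" where
  "ballot_tilde k l K1 K2 h =
     real_of_int (weak_ballot (shared_total k l K1 K2 - h) h) /
     real (shared_total k l K1 K2 choose shared_left k l K1 K2)"

end

theory Submission
  imports Defs
begin

text \<open>
  Put \<open>n = k + l\<close> and \<open>s(j) = e(n - j) e(j) - e(n - j + 1) e(j - 1)\<close>, the Schur function whose
  shape has two columns, of lengths \<open>n - j\<close> and \<open>j\<close>.  The formula holds because both of its sides
  are diagonal in the \<open>s(j)\<close>.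

  On the analytic side, \<open>e(k) e(l)\<close> telescopes into the sum of the \<open>s(j)\<close> with \<open>j \<le> k\<close>, and each \<open>s(j)\<close>
  satisfies the product formula \<open>E s(j)(A U B U\<^sup>*) = s(j)(A) s(j)(B) / s(j)(1)\<close>
  (\<open>integral_schur2_mat_product\<close>).  Expanding \<open>s(j)\<close> in monomial symmetric functions, with ballot
  numbers as coefficients (\<open>schur2_eq_two_one\<close>), turns the expectation into a bilinear form in the
  monomial symmetric functions of \<open>a\<close> and \<open>b\<close>.

  The product formula is proved without representation theory.  Let \<open>C\<close> be the identity plus the
  projection to one coordinate.  The operator that sends \<open>f\<close> to \<open>E f(A V C V\<^sup>*)\<close> multiplies every
  \<open>s(j)\<close> by a scalar, which can be read off from the fourth moments of one column of \<open>V\<close>, and these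
  scalars are pairwise distinct (\<open>integral_schur2_mat_probe\<close>, \<open>probe_eigenvalue_inj\<close>).  The function
  \<open>g(A) = E s(j)(A U B U\<^sup>*)\<close> is a combination of the \<open>s(i)\<close> with \<open>i \<le> j\<close>, because permutation matrices
  are unitary (\<open>schur_span_integral_schur2_mat\<close>).  As elementary symmetric functions of \<open>X Y\<close> and \<open>Y X\<close>
  agree, the two averages over \<open>U\<close> and \<open>V\<close> can be interchanged, so \<open>g\<close> is an eigenfunction with the
  eigenvalue of \<open>s(j)\<close>.  Hence \<open>g\<close> is a multiple of \<open>s(j)\<close>, and \<open>A = 1\<close> yields the factor.

  On the combinatorial side, fix \<open>K1\<close> with \<open>m\<close> pairs and sum \<open>2\<close> to the number of alternating cycles,
  times a function \<open>f\<close> of the half sum, over all \<open>K2\<close> with \<open>y\<close> pairs.  A pair \<open>{u, v}\<close> of \<open>K2\<close> can be absorbed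
  into \<open>K1\<close>: delete \<open>u\<close> and \<open>v\<close> and join the partners that they leave behind, as in a product of Brauer
  diagrams with loop value \<open>2\<close>.  This lowers the half sum by one and destroys a cycle exactly if \<open>{u, v}\<close>
  belongs to \<open>K1\<close> (\<open>join_stats\<close>, \<open>half_sum_insert\<close>).  The resulting recursion in \<open>y\<close> depends on \<open>K1\<close> only
  through \<open>m\<close>, and the normalized ballot numbers are eigenvectors of it (\<open>weighted_sum_eigen\<close>,
  \<open>ballot_ratio_recurrence\<close>).  The eigenvalues are exactly the coefficients on the analytic side.
\<close>

section \<open>Absorbing an edge into a partition\<close>

definition block_of :: "'a set set \<Rightarrow> 'a \<Rightarrow> 'a set" where
  "block_of K x = \<Union>{X \<in> K. x \<in> X}"

lemma block_of_eq:
  assumes "partition_on A K" "X \<in> K" "x \<in> X"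
  shows "block_of K x = X"
proof -
  have "{Y \<in> K. x \<in> Y} = {X}"
    using assms by (auto simp: partition_on_def disjoint_def)
  then show ?thesis by (simp add: block_of_def)
qed

lemma block_of_mem:
  assumes "partition_on A K" "x \<in> A"
  shows "block_of K x \<in> K" "x \<in> block_of K x"
proof -
  obtain X where "X \<in> K" "x \<in> X" using assms by (auto simp: partition_on_def)
  then show "block_of K x \<in> K" "x \<in> block_of K x" using block_of_eq[OF assms(1)] by auto
qed

text \<open>What remains of the blocks of \<open>u\<close> and \<open>v\<close> when an edge between \<open>u\<close> and \<open>v\<close> fuses them and both
  points are then deleted.  Contracting a partition removes the two blocks and keeps this remainder, if
  there is one, as a block.\<close>

definition residue :: "'a \<Rightarrow> 'a \<Rightarrow> 'a set set \<Rightarrow> 'a set" where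
  "residue u v K = (block_of K u \<union> block_of K v) - {u, v}"

definition contract :: "'a \<Rightarrow> 'a \<Rightarrow> 'a set set \<Rightarrow> 'a set set" where
  "contract u v K = (K - {block_of K u, block_of K v}) \<union> ({residue u v K} - {{}})"

lemma partition_disj: "partition_on A K \<Longrightarrow> X \<in> K \<Longrightarrow> Y \<in> K \<Longrightarrow> x \<in> X \<Longrightarrow> x \<in> Y \<Longrightarrow> X = Y"
  by (auto simp: partition_on_def disjoint_def)

lemma partition_on_contract:
  assumes K: "partition_on A K" and uv: "u \<in> A" "v \<in> A"
  shows "partition_on (A - {u, v}) (contract u v K)"
proof -
  note bu = block_of_mem[OF K uv(1)] and bv = block_of_mem[OF K uv(2)]
  have U: "\<Union>K = A" and ne: "{} \<notin> K" using K by (auto simp: partition_on_def)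
  have *: "X \<inter> residue u v K = {}" "X \<inter> {u, v} = {}" if "X \<in> K" "X \<noteq> block_of K u" "X \<noteq> block_of K v" for X
    using that bu bv partition_disj[OF K that(1)] unfolding residue_def by blast+
  show ?thesis
  proof (rule partition_onI)
    show "\<Union>(contract u v K) = A - {u, v}"
    proof
      show "\<Union>(contract u v K) \<subseteq> A - {u, v}"
        using * U bu bv unfolding contract_def residue_def by fast
      show "A - {u, v} \<subseteq> \<Union>(contract u v K)"
      proof
        fix x assume x: "x \<in> A - {u, v}"
        then obtain X where "X \<in> K" "x \<in> X" using U by auto
        then show "x \<in> \<Union>(contract u v K)" using x unfolding contract_def residue_def by (cases "X = block_of K u \<or> X = block_of K v") auto
      qed
    qed
    show "{} \<notin> contract u v K" using ne by (auto simp: contract_def)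
    show "disjnt p q" if pq: "p \<in> contract u v K" "q \<in> contract u v K" "p \<noteq> q" for p q
    proof -
      have d: "X \<inter> Y = {}" if "X \<in> K" "Y \<in> K" "X \<noteq> Y" for X Y
        using K that by (auto simp: partition_on_def disjoint_def)
      consider "p \<in> K" "q \<in> K" | "p = residue u v K" "q \<in> K" "q \<noteq> block_of K u" "q \<noteq> block_of K v"
        | "q = residue u v K" "p \<in> K" "p \<noteq> block_of K u" "p \<noteq> block_of K v"
        using pq by (auto simp: contract_def)
      then show ?thesis using d pq(3) * by cases (auto simp: disjnt_def)
    qed
  qed
qed

lemma partition_join_eqI:
  assumes "refines A K1 J" "refines A K2 J"
    "\<And>Q. refines A K1 Q \<Longrightarrow> refines A K2 Q \<Longrightarrow> refines A J Q"
  shows "partition_join A K1 K2 = J"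
  unfolding partition_join_def
  by (rule the_equality) (use assms in blast, metis assms refines_asym)

lemma partition_join_props:
  assumes "partition_on A K1" "partition_on A K2"
  shows "refines A K1 (partition_join A K1 K2)" "refines A K2 (partition_join A K1 K2)"
    "\<And>Q. refines A K1 Q \<Longrightarrow> refines A K2 Q \<Longrightarrow> refines A (partition_join A K1 K2) Q"
proof -
  have *: "refines A K1 (partition_join A K1 K2) \<and> refines A K2 (partition_join A K1 K2) \<and>
    (\<forall>Q. refines A K1 Q \<and> refines A K2 Q \<longrightarrow> refines A (partition_join A K1 K2) Q)"
    unfolding partition_join_def by (rule theI'[OF partition_join_exists1[OF assms]])
  show "refines A K1 (partition_join A K1 K2)" "refines A K2 (partition_join A K1 K2)"
    "\<And>Q. refines A K1 Q \<Longrightarrow> refines A K2 Q \<Longrightarrow> refines A (partition_join A K1 K2) Q"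
    using * by auto
qed

lemma refinesD: "refines A P Q \<Longrightarrow> X \<in> P \<Longrightarrow> \<exists>Y\<in>Q. X \<subseteq> Y"
  by (auto simp: refines_def)

text \<open>An edge \<open>{u, v}\<close> of the second partition forces the blocks of \<open>u\<close> and \<open>v\<close> in the first one together,
  which is all that it does.  So the join is that of the contracted partitions with \<open>u\<close> and \<open>v\<close> put back
  into the block \<open>R\<close> around the remainder.  The case of an empty remainder is covered by \<open>R = {}\<close>.\<close>

lemma partition_join_contract:
  assumes K1: "partition_on A K1" and K2: "partition_on (A - {u, v}) K2" and uv: "u \<in> A" "v \<in> A"
  defines "J \<equiv> partition_join (A - {u, v}) (contract u v K1) K2"
  obtains R where "residue u v K1 \<subseteq> R" "residue u v K1 = {} \<Longrightarrow> R = {}"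
    "residue u v K1 \<noteq> {} \<Longrightarrow> R \<in> J" "partition_on (A - {u, v}) J"
    "partition_join A K1 (insert {u, v} K2) = insert (R \<union> {u, v}) (J - {R})"
proof -
  define W where "W = residue u v K1"
  note bu = block_of_mem[OF K1 uv(1)] and bv = block_of_mem[OF K1 uv(2)]
  note Kc = partition_on_contract[OF K1 uv]
  note Jp = partition_join_props[OF Kc K2, folded J_def]
  have J: "partition_on (A - {u, v}) J" using Jp(1) by (simp add: refines_def)
  have J': "\<Union>J = A - {u,v}" "{} \<notin> J" using J by (auto simp: partition_on_def)
  have Wc: "W \<in> contract u v K1" if "W \<noteq> {}" using that by (auto simp: contract_def W_def)
  have uvW: "u \<notin> W" "v \<notin> W" by (auto simp: W_def residue_def)
  have bW: "block_of K1 u \<subseteq> W \<union> {u,v}" "block_of K1 v \<subseteq> W \<union> {u,v}" by (auto simp: W_def residue_def)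
  have "\<exists>R. W \<subseteq> R \<and> (W = {} \<longrightarrow> R = {}) \<and> (W \<noteq> {} \<longrightarrow> R \<in> J)"
  proof (cases "W = {}")
    case False
    from refinesD[OF Jp(1) Wc[OF False]] False show ?thesis by auto
  qed auto
  then obtain R where R: "W \<subseteq> R" "W = {} \<longrightarrow> R = {}" "W \<noteq> {} \<longrightarrow> R \<in> J" by auto
  have R': "R = {} \<or> R \<in> J" "R \<subseteq> A - {u,v}" using R J'(1) by auto
  define I where "I = insert (R \<union> {u, v}) (J - {R})"
  have UI: "\<Union>I = A" using J'(1) R' uv by (auto simp: I_def)
  have I: "partition_on A I"
  proof (rule partition_onI)
    show "\<Union>I = A" by fact
    show "{} \<notin> I" using J' by (auto simp: I_def)
    have "disjnt p (R \<union> {u,v})" if "p \<in> J - {R}" for p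
    proof -
      have "p \<inter> {u,v} = {}" using that J'(1) by auto
      moreover have "p \<inter> R = {}" using that R'(1) J by (auto simp: partition_on_def disjoint_def)
      ultimately show ?thesis by (auto simp: disjnt_def)
    qed
    then show "disjnt p q" if "p \<in> I" "q \<in> I" "p \<noteq> q" for p q
      using that J unfolding I_def partition_on_def disjoint_def disjnt_def by (metis DiffE inf_commute insertE)
  qed
  have K2': "partition_on A (insert {u, v} K2)"
    using K2 uv by (subst partition_on_insert) (auto simp: disjnt_def partition_on_def)
  have up: "\<exists>Y\<in>I. X \<subseteq> Y" if "\<exists>Y\<in>J. X \<subseteq> Y" for X using that by (auto simp: I_def)
  have r1: "refines A K1 I"
  proof (unfold refines_def, intro conjI ballI K1 I)
    fix X assume X: "X \<in> K1"
    show "\<exists>Y\<in>I. X \<subseteq> Y"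
    proof (cases "X = block_of K1 u \<or> X = block_of K1 v")
      case True
      then have "X \<subseteq> R \<union> {u,v}" using bW R(1) by blast
      then show ?thesis by (auto simp: I_def)
    next
      case False
      then have "X \<in> contract u v K1" using X by (auto simp: contract_def)
      then show ?thesis by (intro up refinesD[OF Jp(1)])
    qed
  qed
  have r2: "refines A (insert {u, v} K2) I"
  proof (unfold refines_def, intro conjI ballI K2' I)
    fix X assume X: "X \<in> insert {u, v} K2"
    show "\<exists>Y\<in>I. X \<subseteq> Y"
    proof (cases "X = {u,v}")
      case False
      then show ?thesis using X by (intro up refinesD[OF Jp(2)]) auto
    qed (auto simp: I_def)
  qed
  \<comment> \<open>A common coarsening on \<open>A\<close> restricts to one of the contracted partitions.  This restriction
    respects the remainder, as \<open>u\<close> and \<open>v\<close> lie in one block together with their blocks in \<open>K1\<close>.\<close>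
  have least: "refines A I Q" if Q: "refines A K1 Q" "refines A (insert {u, v} K2) Q" for Q
  proof -
    have pQ: "partition_on A Q" using Q by (simp add: refines_def)
    define Q' where "Q' = (\<inter>) (A - {u,v}) ` Q - {{}}"
    have pQ': "partition_on (A - {u,v}) Q'"
      using partition_on_restrict[OF pQ, of "A - {u,v}"] by (simp add: Q'_def Int_absorb2 Diff_subset)
    obtain Y where Y: "Y \<in> Q" "{u, v} \<subseteq> Y" using refinesD[OF Q(2), of "{u,v}"] by auto
    obtain Y1 where "Y1 \<in> Q" "block_of K1 u \<subseteq> Y1" using refinesD[OF Q(1) bu(1)] by auto
    then have Y1: "block_of K1 u \<subseteq> Y" using partition_disj[OF pQ] Y bu(2) by blast
    obtain Y2 where "Y2 \<in> Q" "block_of K1 v \<subseteq> Y2" using refinesD[OF Q(1) bv(1)] by auto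
    then have Y2: "block_of K1 v \<subseteq> Y" using partition_disj[OF pQ] Y bv(2) by blast
    have WY: "W \<subseteq> Y" using Y1 Y2 by (auto simp: W_def residue_def)
    have lift: "\<exists>Z\<in>Q'. X \<subseteq> Z" if "X \<subseteq> Z" "Z \<in> Q" "X \<subseteq> A - {u,v}" "X \<noteq> {}" for X Z
    proof -
      have "(A - {u,v}) \<inter> Z \<in> Q'" using that unfolding Q'_def by blast
      then show ?thesis using that by blast
    qed
    have q1: "refines (A - {u,v}) (contract u v K1) Q'"
    proof (unfold refines_def, intro conjI ballI Kc pQ')
      fix X assume X: "X \<in> contract u v K1"
      have X': "X \<subseteq> A - {u,v}" "X \<noteq> {}" using X Kc by (auto simp: partition_on_def)
      show "\<exists>Z\<in>Q'. X \<subseteq> Z"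
      proof (cases "X = W")
        case True then show ?thesis using lift[OF _ Y(1)] X' WY by blast
      next
        case False
        then have "X \<in> K1" using X by (auto simp: contract_def W_def)
        then show ?thesis using refinesD[OF Q(1)] lift X' by blast
      qed
    qed
    have q2: "refines (A - {u,v}) K2 Q'"
    proof (unfold refines_def, intro conjI ballI K2 pQ')
      fix X assume X: "X \<in> K2"
      have X': "X \<subseteq> A - {u,v}" "X \<noteq> {}" using X K2 by (auto simp: partition_on_def)
      show "\<exists>Z\<in>Q'. X \<subseteq> Z" using refinesD[OF Q(2), of X] X lift X' by blast
    qed
    note q = Jp(3)[OF q1 q2]
    have down: "\<exists>Z\<in>Q. X \<subseteq> Z" if "X \<in> J" for X using refinesD[OF q that] by (auto simp: Q'_def)
    show ?thesis
    proof (unfold refines_def, intro conjI ballI I pQ)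
      fix X assume X: "X \<in> I"
      show "\<exists>Y\<in>Q. X \<subseteq> Y"
      proof (cases "X = R \<union> {u,v}")
        case False then show ?thesis using X down by (auto simp: I_def)
      next
        case True
        show ?thesis
        proof (cases "W = {}")
          case False
          then obtain Z where Z: "Z \<in> Q" "R \<subseteq> Z" using down[of R] R by auto
          then have "Z = Y" using partition_disj[OF pQ] Y(1) WY R(1) False by blast
          then show ?thesis using Z Y True by auto
        qed (use True R Y in auto)
      qed
    qed
  qed
  have "partition_join A K1 (insert {u, v} K2) = I" by (rule partition_join_eqI[OF r1 r2 least])
  with R J show ?thesis by (intro that) (auto simp: I_def W_def)
qed

section \<open>Alternating cycles and segments under contraction\<close>

definition matching_on :: "'a set \<Rightarrow> 'a set \<Rightarrow> 'a set set \<Rightarrow> bool" where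
  "matching_on U V K \<longleftrightarrow> partition_on (U \<union> V) K \<and> (\<forall>X\<in>K. card (X \<inter> U) \<le> 1 \<and> card (X \<inter> V) \<le> 1)"

text \<open>Cycles and segments as sets of blocks over an arbitrary ground set, so that a pair of points can
  be removed from it.\<close>

definition alt_cycles :: "'a set \<Rightarrow> 'a set set \<Rightarrow> 'a set set \<Rightarrow> 'a set set" where
  "alt_cycles A K1 K2 =
     {X \<in> partition_join A K1 K2. 2 \<le> card X \<and> X \<inter> (singletons K1 \<union> singletons K2) = {}}"

definition alt_segments :: "'a set \<Rightarrow> 'a set set \<Rightarrow> 'a set set \<Rightarrow> 'a set set" where
  "alt_segments A K1 K2 =
     {X \<in> partition_join A K1 K2. card (X \<inter> singletons K1) = 2 \<or> card (X \<inter> singletons K2) = 2}"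

lemma matching_block_cases:
  assumes "matching_on U V K" "finite U" "finite V" "X \<in> K"
  obtains x where "x \<in> U \<union> V" "X = {x}" | u v where "u \<in> U" "v \<in> V" "X = {u, v}"
proof -
  have X: "X \<subseteq> U \<union> V" "X \<noteq> {}" "card (X \<inter> U) \<le> 1" "card (X \<inter> V) \<le> 1"
    using assms by (auto simp: matching_on_def partition_on_def)
  have eq: "X = (X \<inter> U) \<union> (X \<inter> V)" using X(1) by auto
  have c: "Y = {} \<or> (\<exists>y. Y = {y})" if "card Y \<le> 1" "finite Y" for Y :: "'a set"
    using that by (metis One_nat_def card_0_eq card_1_singletonE le_Suc_eq le_zero_eq)
  have "X \<inter> U = {} \<or> (\<exists>y. X \<inter> U = {y})" "X \<inter> V = {} \<or> (\<exists>y. X \<inter> V = {y})"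
    using c X assms(2,3) by auto
  then consider "X \<inter> U = {}" "X \<inter> V = {}" | y where "X \<inter> U = {}" "X \<inter> V = {y}" 
    | y where "X \<inter> U = {y}" "X \<inter> V = {}" | x y where "X \<inter> U = {x}" "X \<inter> V = {y}"
    by blast
  then show ?thesis
  proof cases
    case 1 then show ?thesis using eq X(2) by simp
  next
    case (2 y) then have "X = {y}" "y \<in> V" using eq by auto
    then show ?thesis using that(1) by auto
  next
    case (3 y) then have "X = {y}" "y \<in> U" using eq by auto
    then show ?thesis using that(1) by auto
  next
    case (4 x y)
    then have "X = {x} \<union> {y}" "x \<in> U" "y \<in> V" using eq by auto
    then show ?thesis using that(2)[of x y] by auto
  qed
qed

lemma matching_onI:
  assumes "partition_on (U \<union> V) K" "U \<inter> V = {}"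
    "\<And>X. X \<in> K \<Longrightarrow> (\<exists>x. X = {x}) \<or> (\<exists>u\<in>U. \<exists>v\<in>V. X = {u, v})"
  shows "matching_on U V K"
  unfolding matching_on_def
proof (intro conjI ballI)
  fix X assume "X \<in> K"
  from assms(3)[OF this] consider x where "X = {x}" | u v where "u \<in> U" "v \<in> V" "X = {u,v}" by blast
  then obtain x y where "X \<inter> U \<subseteq> {x}" "X \<inter> V \<subseteq> {y}"
  proof cases
    case (1 x)
    then show ?thesis by (intro that[of x x]) auto
  next
    case (2 u v)
    then show ?thesis using assms(2) by (intro that[of u v]) auto
  qed
  then show "card (X \<inter> U) \<le> 1" "card (X \<inter> V) \<le> 1"
    using card_mono[of "{x}" "X \<inter> U"] card_mono[of "{y}" "X \<inter> V"] by auto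
qed (fact assms(1))

text \<open>The possible positions of \<open>u\<close> and \<open>v\<close> in a matching.  Each of them may be single, and if neither
  is, they form an edge or have two different partners; in the last case the partners become an edge,
  which again joins the two sides.\<close>

lemma contract_cases:
  assumes K: "matching_on U V K" and fin: "finite U" "finite V" and disj: "U \<inter> V = {}"
    and u: "u \<in> U" and v: "v \<in> V"
  obtains
    (single) "{u} \<in> K" "{v} \<in> K" "residue u v K = {}" "contract u v K = K - {{u}, {v}}"
  | (pair) "{u, v} \<in> K" "residue u v K = {}" "contract u v K = K - {{u, v}}"
  | (left) u' where "u' \<in> U" "u' \<noteq> u" "{u} \<in> K" "{u', v} \<in> K" "residue u v K = {u'}"
      "contract u v K = insert {u'} (K - {{u}, {u', v}})"
  | (right) v' where "v' \<in> V" "v' \<noteq> v" "{v} \<in> K" "{u, v'} \<in> K" "residue u v K = {v'}"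
      "contract u v K = insert {v'} (K - {{v}, {u, v'}})"
  | (both) u' v' where "u' \<in> U" "u' \<noteq> u" "v' \<in> V" "v' \<noteq> v" "{u', v} \<in> K" "{u, v'} \<in> K"
      "residue u v K = {u', v'}" "contract u v K = insert {u', v'} (K - {{u', v}, {u, v'}})"
proof -
  have part: "partition_on (U \<union> V) K" using K by (simp add: matching_on_def)
  have uA: "u \<in> U \<union> V" and vA: "v \<in> U \<union> V" using u v by auto
  note bu = block_of_mem[OF part uA] and bv = block_of_mem[OF part vA]
  have Bu: "block_of K u = {u} \<or> (\<exists>v'\<in>V. block_of K u = {u, v'})"
    using matching_block_cases[OF K fin bu(1)] bu(2) u disj by (metis IntI empty_iff insertE singletonD)
  have Bv: "block_of K v = {v} \<or> (\<exists>u'\<in>U. block_of K v = {u', v})"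
    using matching_block_cases[OF K fin bv(1)] bv(2) v disj by (metis IntI empty_iff insertE singletonD)
  have ne: "x \<noteq> y" if "x \<in> U" "y \<in> V" for x y using that disj by auto
  note nuv = ne[OF u v]
  from Bu Bv consider (1) "block_of K u = {u}" "block_of K v = {v}"
    | (2) u' where "u' \<in> U" "block_of K u = {u}" "block_of K v = {u', v}"
    | (3) v' where "v' \<in> V" "block_of K u = {u, v'}" "block_of K v = {v}"
    | (4) u' v' where "u' \<in> U" "v' \<in> V" "block_of K u = {u, v'}" "block_of K v = {u', v}" by blast
  then show thesis
  proof cases
    case 1
    then show ?thesis using bu bv by (intro single) (auto simp: residue_def contract_def)
  next
    case (2 u')
    have "u' \<noteq> u" using block_of_eq[OF part, of "{u', v}" u] bv(1) 2 nuv by auto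
    then show ?thesis using 2 bu bv ne[OF 2(1) v] nuv
      by (intro left[of u']) (auto simp: residue_def contract_def)
  next
    case (3 v')
    have "v' \<noteq> v" using block_of_eq[OF part, of "{u, v'}" v] bu(1) 3 nuv by auto
    then show ?thesis using 3 bu bv ne[OF u 3(1)] nuv
      by (intro right[of v']) (auto simp: residue_def contract_def)
  next
    case (4 u' v')
    show ?thesis
    proof (cases "u' = u")
      case True
      have "{u,v} \<in> K" "block_of K u = {u,v}" "block_of K v = {u,v}"
        using 4 True bv(1) block_of_eq[OF part, of "{u,v}" u] by auto
      then show ?thesis by (intro pair) (auto simp: residue_def contract_def)
    next
      case False
      have "v' \<noteq> v"
      proof
        assume "v' = v"
        then have "{u, v} \<in> K" using 4 bu(1) by auto
        then have "block_of K v = {u, v}" using block_of_eq[OF part, of "{u,v}" v] by auto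
        then show False using 4 False nuv ne[OF 4(1) v] by (auto simp: doubleton_eq_iff)
      qed
      then show ?thesis using 4 False bu bv nuv ne[OF 4(1) 4(2)] ne[OF 4(1) v] ne[OF u 4(2)]
        by (intro both[of u' v']) (auto simp: residue_def contract_def)
    qed
  qed
qed

lemma singletons_disj:
  assumes "partition_on A K" "{x, y} \<in> K" "x \<noteq> y"
  shows "x \<notin> singletons K" "y \<notin> singletons K"
proof -
  show "x \<notin> singletons K" using partition_disj[OF assms(1), of "{x}" "{x,y}" x] assms by (auto simp: singletons_def)
  show "y \<notin> singletons K" using partition_disj[OF assms(1), of "{y}" "{x,y}" y] assms by (auto simp: singletons_def)
qed

lemma contract_stats:
  assumes K: "matching_on U V K" and fin: "finite U" "finite V" and disj: "U \<inter> V = {}"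
    and u: "u \<in> U" and v: "v \<in> V"
  shows "matching_on (U - {u}) (V - {v}) (contract u v K)"
    and "num_pairs K = num_pairs (contract u v K) + (if {u} \<in> K \<and> {v} \<in> K then 0 else 1)"
proof -
  have part: "partition_on (U \<union> V) K" using K by (simp add: matching_on_def)
  have uvA: "u \<in> U \<union> V" "v \<in> U \<union> V" using u v by auto
  have eqA: "U \<union> V - {u, v} = (U - {u}) \<union> (V - {v})" using u v disj by auto
  have P: "partition_on ((U - {u}) \<union> (V - {v})) (contract u v K)"
    using partition_on_contract[OF part uvA] eqA by simp
  have ne: "x \<noteq> y" if "x \<in> U" "y \<in> V" for x y using that disj by auto
  have dj: "(U - {u}) \<inter> (V - {v}) = {}" using disj by auto
  have finK: "finite K" using finite_elements[OF _ part] fin by simp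
  have old: "(\<exists>x. X = {x}) \<or> (\<exists>a\<in>U - {u}. \<exists>b\<in>V - {v}. X = {a, b})"
    if "X \<in> K" "X \<in> contract u v K" for X
  proof -
    have sub: "X \<subseteq> (U - {u}) \<union> (V - {v})" using P that(2) by (auto simp: partition_on_def)
    from matching_block_cases[OF K fin that(1)] show ?thesis
    proof cases
      case (2 a b)
      then have "a \<noteq> u" "b \<noteq> v" using sub ne by auto
      then show ?thesis using 2 by blast
    qed auto
  qed
  show "matching_on (U - {u}) (V - {v}) (contract u v K)"
  proof (rule matching_onI[OF P dj])
    fix X assume X: "X \<in> contract u v K"
    show "(\<exists>x. X = {x}) \<or> (\<exists>a\<in>U - {u}. \<exists>b\<in>V - {v}. X = {a, b})"
      
    proof (cases rule: contract_cases[OF K fin disj u v, case_names single pair left right both])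
      case (both u' v')
      then show ?thesis using X old[of X] by (cases "X = {u', v'}") auto
    qed (use X old[of X] in auto)
  qed
  let ?P = "{X \<in> K. card X = 2}"
  have rem: "card ?P = Suc (card (?P - {{a, b}}))" if "{a, b} \<in> K" "a \<noteq> b" for a b
    using card_Suc_Diff1[of ?P "{a, b}"] finK that by simp
  have filt: "{X \<in> insert S (K - {S', Y}). card X = 2} = ?P - {Y}" if "card S \<noteq> 2" "card S' \<noteq> 2" for S S' Y
    using that by blast
  show "num_pairs K = num_pairs (contract u v K) + (if {u} \<in> K \<and> {v} \<in> K then 0 else 1)"
    
  proof (cases rule: contract_cases[OF K fin disj u v, case_names single pair left right both])
    case single
    have "{X \<in> contract u v K. card X = 2} = ?P" unfolding single(4)
      by (rule Collect_cong, rename_tac X, case_tac "X = {u} \<or> X = {v}", auto)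
    then show ?thesis using single(1,2) by (simp add: num_pairs_def)
  next
    case pair
    have e: "{X \<in> contract u v K. card X = 2} = ?P - {{u, v}}" unfolding pair(3) by blast
    have "{u} \<notin> K" using singletons_disj[OF part pair(1) ne[OF u v]] by (auto simp: singletons_def)
    then show ?thesis using rem[OF pair(1) ne[OF u v]] by (simp add: num_pairs_def e)
  next
    case (left u')
    have e: "{X \<in> contract u v K. card X = 2} = ?P - {{u', v}}" unfolding left(6) by (rule filt) auto
    have "{v} \<notin> K" using singletons_disj[OF part left(4) ne[OF left(1) v]] by (auto simp: singletons_def)
    then show ?thesis using rem[OF left(4) ne[OF left(1) v]] by (simp add: num_pairs_def e)
  next
    case (right v')
    have e: "{X \<in> contract u v K. card X = 2} = ?P - {{u, v'}}" unfolding right(6) by (rule filt) auto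
    have "{u} \<notin> K" using singletons_disj[OF part right(4) ne[OF u right(1)]] by (auto simp: singletons_def)
    then show ?thesis using rem[OF right(4) ne[OF u right(1)]] by (simp add: num_pairs_def e)
  next
    case (both u' v')
    have n: "u' \<noteq> v" "u \<noteq> v'" "u' \<noteq> v'" using ne both(1,3) u v by blast+
    have nn: "{u', v'} \<notin> K" 
    proof
      assume "{u', v'} \<in> K"
      then have "{u', v'} = {u', v}" using partition_disj[OF part _ both(5), of "{u', v'}" u'] by blast
      then show False using both(4) n by (auto simp: doubleton_eq_iff)
    qed
    have d: "{u', v} \<noteq> {u, v'}" using both(2) n by (auto simp: doubleton_eq_iff)
    have e: "{X \<in> contract u v K. card X = 2} = insert {u', v'} (?P - {{u', v}} - {{u, v'}})"
    proof -
      have "card {u', v'} = 2" using n(3) by simp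
      then show ?thesis unfolding both(8) by blast
    qed
    have "card {X \<in> contract u v K. card X = 2} = Suc (card (?P - {{u', v}} - {{u, v'}}))"
      unfolding e using finK nn by (subst card_insert_disjoint) auto
    also have "\<dots> = card (?P - {{u', v}})"
      by (rule card_Suc_Diff1) (use finK both(6) n(2) d in auto)
    finally have "card {X \<in> contract u v K. card X = 2} = card (?P - {{u', v}})" .
    moreover have "{u} \<notin> K" using singletons_disj[OF part both(6) n(2)] by (auto simp: singletons_def)
    ultimately show ?thesis using rem[OF both(5) n(1)] by (simp add: num_pairs_def)
  qed
qed

text \<open>Counting blocks before and after the points \<open>u\<close> and \<open>v\<close> are put back: \<open>Z\<close> takes the place of \<open>R\<close>,
  or is a new block if \<open>R\<close> is empty.\<close>

lemma card_filter_merge: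
  assumes "finite J" "R = {} \<or> R \<in> J" "{} \<notin> J" "Z \<notin> J" "\<And>X. X \<in> J \<Longrightarrow> X \<noteq> R \<Longrightarrow> P X = P' X"
    "R \<in> J \<Longrightarrow> P Z = P' R"
  shows "card {X \<in> insert Z (J - {R}). P X} = card {X \<in> J. P' X} + (if R = {} \<and> P Z then 1 else 0)"
proof (cases "R = {}")
  case True
  then have "J - {R} = J" using assms(3) by auto
  then have "{X \<in> insert Z (J - {R}). P X} = {X \<in> J. P' X} \<union> (if P Z then {Z} else {})"
    using assms(3,5) True by auto
  then show ?thesis using assms(1,4) True by (simp add: card_insert_if)
next
  case False
  then have R: "R \<in> J" using assms(2) by auto
  let ?L = "{X \<in> J - {R}. P' X}"
  have "{X \<in> insert Z (J - {R}). P X} = ?L \<union> (if P Z then {Z} else {})" using assms(5) by auto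
  moreover have "{X \<in> J. P' X} = ?L \<union> (if P Z then {R} else {})" using assms(6) R by auto
  moreover have "finite ?L" using assms(1) by simp
  ultimately show ?thesis using assms(4) False by (simp add: card_insert_if)
qed

text \<open>The same cases seen by the singletons.  Either the remainder is empty, or one singleton moves from
  an endpoint of the edge to the former partner of the other endpoint, or no singleton is affected.\<close>

lemma contract_singletons:
  assumes K: "matching_on U V K" and fin: "finite U" "finite V" and disj: "U \<inter> V = {}"
    and u: "u \<in> U" and v: "v \<in> V"
  obtains
    (closed) "residue u v K = {}" "singletons (contract u v K) = singletons K - {u, v}"
      "{u, v} \<in> K \<and> u \<notin> singletons K \<and> v \<notin> singletons K \<or> {u, v} \<notin> K \<and> u \<in> singletons K \<and> v \<in> singletons K"
  | (moved) w x y where "residue u v K = {w}" "{u, v} = {x, y}" "x \<in> singletons K" "y \<notin> singletons K"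
      "w \<notin> singletons K" "singletons (contract u v K) = insert w (singletons K - {x})" "{u, v} \<notin> K"
  | (joined) w x where "residue u v K = {w, x}" "w \<noteq> x" "u \<notin> singletons K" "v \<notin> singletons K"
      "w \<notin> singletons K" "x \<notin> singletons K" "singletons (contract u v K) = singletons K" "{u, v} \<notin> K"
proof -
  have part: "partition_on (U \<union> V) K" using K by (simp add: matching_on_def)
  have ne: "x \<noteq> y" if "x \<in> U" "y \<in> V" for x y using that disj by auto
  note nuv = ne[OF u v]
  note sd = singletons_disj[OF part]
  show thesis
  proof (cases rule: contract_cases[OF K fin disj u v, case_names single pair left right both])
    case single
    have "{u, v} \<notin> K" using sd(1)[OF _ nuv] single(1) by (auto simp: singletons_def)
    then show ?thesis using single by (intro closed) (auto simp: singletons_def)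
  next
    case pair
    then show ?thesis using sd[OF pair(1) nuv] nuv by (intro closed) (auto simp: singletons_def)
  next
    case (left u')
    have m: "u' \<notin> singletons K" "v \<notin> singletons K" using sd[OF left(4) ne[OF left(1) v]] by auto
    have "{u, v} \<notin> K" using sd(1)[OF _ nuv] left(3) by (auto simp: singletons_def)
    moreover have "singletons (contract u v K) = insert u' (singletons K - {u})"
      using ne[OF left(1) v] unfolding left(6) singletons_def by auto
    ultimately show ?thesis using m left(3,5) by (intro moved[of u' u v]) (auto simp: singletons_def)
  next
    case (right v')
    have m: "u \<notin> singletons K" "v' \<notin> singletons K" using sd[OF right(4) ne[OF u right(1)]] by auto
    have "{u, v} \<notin> K" using sd(2)[OF _ nuv] right(3) by (auto simp: singletons_def)
    moreover have "singletons (contract u v K) = insert v' (singletons K - {v})"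
      using ne[OF u right(1)] unfolding right(6) singletons_def by auto
    ultimately show ?thesis using m right(3,5) by (intro moved[of v' v u]) (auto simp: singletons_def)
  next
    case (both u' v')
    note m = sd[OF both(5) ne[OF both(1) v]] sd[OF both(6) ne[OF u both(3)]]
    have n: "u' \<noteq> v'" "u' \<noteq> v" "u \<noteq> v'" using ne both(1,3) u v by auto
    have "{u, v} \<notin> K" using partition_disj[OF part _ both(6), of "{u, v}" u] both(4) by (auto simp: doubleton_eq_iff)
    moreover have "singletons (contract u v K) = singletons K"
      using n unfolding both(8) singletons_def by auto
    ultimately show ?thesis using m both(7) n(1) by (intro joined[of u' v']) auto
  qed
qed

text \<open>Putting back \<open>u\<close> and \<open>v\<close> prolongs the path or cycle through the remainder by two points and moves at
  most one of its ends, so it stays a cycle, or a segment, if it was one.  Only an empty remainder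
  creates a new block: \<open>{u, v}\<close> is a cycle if it is an edge of both matchings, and a segment if both
  points are single in \<open>K1\<close>.\<close>

lemma join_stats:
  assumes K1: "matching_on U V K1" and fin: "finite U" "finite V" and disj: "U \<inter> V = {}"
    and u: "u \<in> U" and v: "v \<in> V" and K2: "matching_on (U - {u}) (V - {v}) K2"
  shows "card (alt_cycles (U \<union> V) K1 (insert {u, v} K2)) =
      card (alt_cycles (U - {u} \<union> (V - {v})) (contract u v K1) K2) + (if {u, v} \<in> K1 then 1 else 0)"
    and "card (alt_segments (U \<union> V) K1 (insert {u, v} K2)) =
      card (alt_segments (U - {u} \<union> (V - {v})) (contract u v K1) K2) + (if {u} \<in> K1 \<and> {v} \<in> K1 then 1 else 0)"
proof -
  define A where "A = U \<union> V"
  have eqA: "U - {u} \<union> (V - {v}) = A - {u, v}" using u v disj by (auto simp: A_def)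
  have uA: "u \<in> A" and vA: "v \<in> A" using u v by (auto simp: A_def)
  have nuv: "u \<noteq> v" using u v disj by auto
  have P1: "partition_on A K1" using K1 by (simp add: matching_on_def A_def)
  have P2: "partition_on (A - {u, v}) K2" using K2 by (simp add: matching_on_def eqA)
  define W where "W = residue u v K1"
  define J where "J = partition_join (A - {u, v}) (contract u v K1) K2"
  define s1 s1c s2 where "s1 = singletons K1" and "s1c = singletons (contract u v K1)" and "s2 = singletons K2"
  obtain R where R: "W \<subseteq> R" "W = {} \<Longrightarrow> R = {}" "W \<noteq> {} \<Longrightarrow> R \<in> J" "partition_on (A - {u, v}) J"
    "partition_join A K1 (insert {u, v} K2) = insert (R \<union> {u, v}) (J - {R})"
    using partition_join_contract[OF P1 P2 uA vA] unfolding W_def J_def by metis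
  let ?Z = "R \<union> {u, v}"
  have s2': "singletons (insert {u, v} K2) = s2" using nuv by (auto simp: singletons_def s2_def)
  have s2A: "s2 \<subseteq> A - {u, v}" using P2 by (auto simp: singletons_def s2_def partition_on_def)
  have finJ: "finite J" using finite_elements[OF _ R(4)] fin by (simp add: A_def)
  have JA: "X \<subseteq> A - {u,v}" "X \<noteq> {}" if "X \<in> J" for X using R(4) that by (auto simp: partition_on_def)
  have finX: "finite X" if "X \<in> J" for X using JA(1)[OF that] fin by (intro finite_subset[of X A]) (auto simp: A_def)
  have R': "R = {} \<or> R \<in> J" using R(2,3) by auto
  have J0: "{} \<notin> J" using JA by auto
  have Z: "?Z \<notin> J" using JA by auto
  have away: "X \<inter> s1 = X \<inter> s1c" if X: "X \<in> J" "X \<noteq> R" for X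
  proof -
    have XW: "X \<inter> W = {}"
    proof (cases "W = {}")
      case False
      then show ?thesis using R(1,3,4) X unfolding partition_on_def disjoint_def by blast
    qed simp
    from contract_singletons[OF K1 fin disj u v] show ?thesis
      by cases (use XW JA(1)[OF X(1)] in \<open>auto simp: W_def s1_def s1c_def\<close>)
  qed
  have atR: "card (?Z \<inter> s1) = card (R \<inter> s1c) \<and> (?Z \<inter> s1 = {} \<longleftrightarrow> R \<inter> s1c = {})
     \<and> 2 \<le> card ?Z \<and> (R \<inter> s1c = {} \<longrightarrow> 2 \<le> card R)" if RJ: "R \<in> J"
  proof -
    have W0: "residue u v K1 \<noteq> {}" using R(2) RJ J0 unfolding W_def by auto
    have fR: "finite R" and uvR: "u \<notin> R" "v \<notin> R" using finX[OF RJ] JA(1)[OF RJ] by auto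
    have c2: "2 \<le> card ?Z" using card_mono[of ?Z "{u, v}"] fR nuv by auto
    show ?thesis
    proof (cases rule: contract_singletons[OF K1 fin disj u v, case_names closed moved joined])
      case (moved w x y)
      have w: "w \<in> R" using R(1) moved(1) by (simp add: W_def)
      have xy: "x \<notin> R" "y \<notin> R" using moved(2) uvR by (auto simp: doubleton_eq_iff)
      have "?Z \<inter> s1 = insert x (R \<inter> s1)" using moved(2,3,4) by (auto simp: s1_def doubleton_eq_iff)
      moreover have "R \<inter> s1c = insert w (R \<inter> s1)" using w xy unfolding s1c_def moved(6) by (auto simp: s1_def)
      moreover have "x \<notin> R \<inter> s1" "w \<notin> R \<inter> s1" using xy moved(5) by (auto simp: s1_def)
      ultimately show ?thesis using fR c2 by (simp add: card_insert_disjoint)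
    next
      case (joined w x)
      have "{w, x} \<subseteq> R" using R(1) joined(1) by (simp add: W_def)
      then have "2 \<le> card R" using card_mono[OF fR, of "{w,x}"] joined(2) by simp
      moreover have "?Z \<inter> s1 = R \<inter> s1c" unfolding s1c_def joined(7) using joined(3,4) by (auto simp: s1_def)
      ultimately show ?thesis using c2 by simp
    qed (use W0 in simp)
  qed
  have atR2: "?Z \<inter> s2 = R \<inter> s2" using s2A by auto
  have empt: "R = {} \<longleftrightarrow> W = {}" using R(1,2) by auto
  have clo: "W = {} \<and> {u, v} \<inter> (s1 \<union> s2) = {} \<longleftrightarrow> {u, v} \<in> K1"
    using contract_singletons[OF K1 fin disj u v] 
    by cases (use s2A in \<open>auto simp: W_def s1_def\<close>)
  have opn: "W = {} \<and> (card ({u, v} \<inter> s1) = 2 \<or> card ({u, v} \<inter> s2) = 2) \<longleftrightarrow> {u} \<in> K1 \<and> {v} \<in> K1"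
  proof -
    have e: "{u, v} \<inter> s2 = {}" using s2A by auto
    show ?thesis
    proof (cases rule: contract_singletons[OF K1 fin disj u v, case_names closed moved joined])
      case closed
      then have "{u, v} \<inter> s1 = {} \<and> \<not> ({u} \<in> K1 \<and> {v} \<in> K1) \<or> {u, v} \<inter> s1 = {u, v} \<and> {u} \<in> K1 \<and> {v} \<in> K1"
        by (auto simp: s1_def singletons_def)
      then show ?thesis using nuv e closed(1) by (auto simp: W_def)
    next
      case (moved w x y)
      then show ?thesis by (auto simp: W_def singletons_def doubleton_eq_iff)
    next
      case (joined w x)
      then show ?thesis by (auto simp: W_def singletons_def)
    qed
  qed
  have "card (alt_cycles A K1 (insert {u, v} K2)) =
      card (alt_cycles (A - {u, v}) (contract u v K1) K2)
      + (if R = {} \<and> 2 \<le> card ?Z \<and> ?Z \<inter> (s1 \<union> s2) = {} then 1 else 0)"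
    unfolding alt_cycles_def R(5) s2' J_def[symmetric] s1_def[symmetric] s1c_def[symmetric] s2_def[symmetric]
    by (rule card_filter_merge[OF finJ R' J0 Z])
       (use away atR atR2 in \<open>auto simp: Int_Un_distrib\<close>)
  then show "card (alt_cycles (U \<union> V) K1 (insert {u, v} K2)) =
      card (alt_cycles (U - {u} \<union> (V - {v})) (contract u v K1) K2) + (if {u, v} \<in> K1 then 1 else 0)"
    using clo empt nuv unfolding eqA A_def[symmetric] by (auto split: if_splits)
  have "card (alt_segments A K1 (insert {u, v} K2)) =
      card (alt_segments (A - {u, v}) (contract u v K1) K2)
      + (if R = {} \<and> (card (?Z \<inter> s1) = 2 \<or> card (?Z \<inter> s2) = 2) then 1 else 0)"
    unfolding alt_segments_def R(5) s2' J_def[symmetric] s1_def[symmetric] s1c_def[symmetric] s2_def[symmetric]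
    by (rule card_filter_merge[OF finJ R' J0 Z])
       (use away atR atR2 in auto)
  then show "card (alt_segments (U \<union> V) K1 (insert {u, v} K2)) =
      card (alt_segments (U - {u} \<union> (V - {v})) (contract u v K1) K2) + (if {u} \<in> K1 \<and> {v} \<in> K1 then 1 else 0)"
    using opn empt unfolding eqA A_def[symmetric] by (auto split: if_splits)
qed

section \<open>Weighted sums over matchings\<close>

definition matchings_of_size :: "'a set \<Rightarrow> 'a set \<Rightarrow> nat \<Rightarrow> 'a set set set" where
  "matchings_of_size U V y = {K. matching_on U V K \<and> num_pairs K = y}"

definition edges_of :: "'a set \<Rightarrow> 'a set \<Rightarrow> 'a set set \<Rightarrow> ('a \<times> 'a) set" where
  "edges_of U V K = {(u, v) \<in> U \<times> V. {u, v} \<in> K}"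

lemma finite_matchings_of_size: "finite U \<Longrightarrow> finite V \<Longrightarrow> finite (matchings_of_size U V y)"
  by (rule finite_subset[OF _ finitely_many_partition_on[of "U \<union> V"]])
     (auto simp: matchings_of_size_def matching_on_def)

lemma card_edges_of:
  assumes K: "matching_on U V K" and fin: "finite U" "finite V" and disj: "U \<inter> V = {}"
  shows "card (edges_of U V K) = num_pairs K"
proof -
  have "bij_betw (\<lambda>(u, v). {u, v}) (edges_of U V K) {X \<in> K. card X = 2}"
  proof (rule bij_betwI')
    fix e e' assume e: "e \<in> edges_of U V K" "e' \<in> edges_of U V K"
    then show "((case e of (u, v) \<Rightarrow> {u, v}) = (case e' of (u, v) \<Rightarrow> {u, v})) = (e = e')"
      using disj by (auto simp: edges_of_def doubleton_eq_iff)
  next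
    fix e assume "e \<in> edges_of U V K"
    then show "(case e of (u, v) \<Rightarrow> {u, v}) \<in> {X \<in> K. card X = 2}"
      using disj by (auto simp: edges_of_def card_insert_if)
  next
    fix X assume X: "X \<in> {X \<in> K. card X = 2}"
    have "X \<in> K" using X by simp
    from K fin this show "\<exists>e\<in>edges_of U V K. X = (case e of (u, v) \<Rightarrow> {u, v})"
    proof (cases rule: matching_block_cases)
      case (2 u v)
      then show ?thesis using X by (intro bexI[of _ "(u, v)"]) (auto simp: edges_of_def)
    qed (use X in auto)
  qed
  then show ?thesis unfolding num_pairs_def by (rule bij_betw_same_card)
qed

lemma matching_on_swap: "matching_on U V K \<longleftrightarrow> matching_on V U K"
  by (auto simp: matching_on_def Un_commute)

lemma card_singletons_left:
  assumes K: "matching_on U V K" and fin: "finite U" "finite V" and disj: "U \<inter> V = {}"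
  shows "card (U \<inter> singletons K) + num_pairs K = card U"
proof -
  have part: "partition_on (U \<union> V) K" using K by (simp add: matching_on_def)
  have ne: "x \<noteq> y" if "x \<in> U" "y \<in> V" for x y using that disj by auto
  have img: "fst ` edges_of U V K = U - singletons K"
  proof (intro equalityI subsetI)
    fix u assume "u \<in> fst ` edges_of U V K"
    then obtain v where "u \<in> U" "v \<in> V" "{u, v} \<in> K" by (auto simp: edges_of_def)
    then show "u \<in> U - singletons K" using singletons_disj(1)[OF part _ ne] by auto
  next
    fix u assume u: "u \<in> U - singletons K"
    then have b: "block_of K u \<in> K" "u \<in> block_of K u" using block_of_mem[OF part] by auto
    from K fin b(1) show "u \<in> fst ` edges_of U V K"
    proof (cases rule: matching_block_cases)
      case (1 x) then show ?thesis using b u by (auto simp: singletons_def)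
    next
      case (2 x y)
      then have "u = x" using b u ne by auto
      then show ?thesis using 2 b by (intro image_eqI[of _ _ "(x, y)"]) (auto simp: edges_of_def)
    qed
  qed
  have "{u, v} = {u, v'}" if "{u, v} \<in> K" "{u, v'} \<in> K" for u v v'
    using partition_disj[OF part that] by blast
  then have "inj_on fst (edges_of U V K)"
    using ne by (auto simp: inj_on_def edges_of_def doubleton_eq_iff)
  then have "card (U - singletons K) = num_pairs K"
    using card_image img card_edges_of[OF assms] by metis
  then show ?thesis using card_Int_Diff[OF fin(1), of "singletons K"] by simp
qed

lemma card_singletons:
  assumes K: "matching_on U V K" and fin: "finite U" "finite V" and disj: "U \<inter> V = {}"
  shows "card (U \<inter> singletons K) + num_pairs K = card U" "card (V \<inter> singletons K) + num_pairs K = card V"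
  using card_singletons_left[OF assms] card_singletons_left[OF K[unfolded matching_on_swap[of U]] fin(2,1)] disj
  by auto

lemma matching_insert:
  assumes "matching_on (U - {u}) (V - {v}) K" and fin: "finite U" "finite V" and disj: "U \<inter> V = {}" and "u \<in> U" "v \<in> V"
  shows "matching_on U V (insert {u, v} K)" "{u, v} \<notin> K" "num_pairs (insert {u, v} K) = Suc (num_pairs K)"
proof -
  have P: "partition_on (U - {u} \<union> (V - {v})) K" using assms by (simp add: matching_on_def)
  have f': "finite (U - {u})" "finite (V - {v})" using fin by auto
  have nuv: "u \<noteq> v" using assms by auto
  have UK: "\<Union>K = U - {u} \<union> (V - {v})" using P by (simp add: partition_on_def)
  show nin: "{u, v} \<notin> K" 
  proof
    assume "{u, v} \<in> K"
    then have "u \<in> \<Union>K" by blast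
    then show False using UK assms(4,5) by auto
  qed
  have finK: "finite K" using finite_elements[OF _ P] f' by auto
  have P': "partition_on (U \<union> V) (insert {u, v} K)"
  proof (subst partition_on_insert)
    show "disjnt {u, v} (\<Union>K)" unfolding UK using assms(4-6) by (auto simp: disjnt_def)
    have "U \<union> V - {u, v} = U - {u} \<union> (V - {v})" using assms(4-6) by blast
    then show "partition_on (U \<union> V - {u, v}) K \<and> {u, v} \<subseteq> U \<union> V \<and> {u, v} \<noteq> {}"
      using P assms(5,6) by simp
  qed
  show "matching_on U V (insert {u, v} K)"
  proof (rule matching_onI[OF P' disj])
    fix X assume X: "X \<in> insert {u, v} K"
    show "(\<exists>x. X = {x}) \<or> (\<exists>u\<in>U. \<exists>v\<in>V. X = {u, v})"
    proof (cases "X = {u, v}")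
      case False
      then have "X \<in> K" using X by auto
      with assms(1) f' show ?thesis by (cases rule: matching_block_cases) auto
    qed (use assms in auto)
  qed
  have "{X \<in> insert {u, v} K. card X = 2} = insert {u, v} {X \<in> K. card X = 2}" using nuv by auto
  then show "num_pairs (insert {u, v} K) = Suc (num_pairs K)" using finK nin by (simp add: num_pairs_def)
qed

lemma matching_remove:
  assumes K: "matching_on U V K" and fin: "finite U" "finite V" and disj: "U \<inter> V = {}" and "u \<in> U" "v \<in> V" "{u, v} \<in> K"
  shows "matching_on (U - {u}) (V - {v}) (K - {{u, v}})"
proof -
  have part: "partition_on (U \<union> V) K" using K by (simp add: matching_on_def)
  have b: "block_of K u = {u, v}" "block_of K v = {u, v}" using block_of_eq[OF part assms(7)] by auto
  have "contract u v K = K - {{u, v}}" by (auto simp: contract_def residue_def b)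
  then show ?thesis using contract_stats(1)[OF K fin disj assms(5,6)] by simp
qed

text \<open>Double counting of pairs consisting of a matching and one of its edges.\<close>

lemma sum_matchings_remove_edge:
  fixes F :: "'a set set \<Rightarrow> real"
  assumes fin: "finite U" "finite V" and disj: "U \<inter> V = {}"
  shows "real (Suc y) * (\<Sum>K\<in>matchings_of_size U V (Suc y). F K) =
    (\<Sum>(u, v)\<in>U \<times> V. \<Sum>K\<in>matchings_of_size (U - {u}) (V - {v}) y. F (insert {u, v} K))"
proof -
  let ?M = "matchings_of_size U V (Suc y)"
  have "real (Suc y) * (\<Sum>K\<in>?M. F K) = (\<Sum>K\<in>?M. \<Sum>e\<in>edges_of U V K. F K)"
    unfolding sum_distrib_left using card_edges_of[OF _ fin disj]
    by (intro sum.cong) (auto simp: matchings_of_size_def)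
  also have "\<dots> = (\<Sum>K\<in>?M. \<Sum>e\<in>{e \<in> U \<times> V. {fst e, snd e} \<in> K}. F K)"
    by (intro sum.cong) (auto simp: edges_of_def)
  also have "\<dots> = (\<Sum>e\<in>U \<times> V. \<Sum>K\<in>{K \<in> ?M. {fst e, snd e} \<in> K}. F K)"
    by (rule sum.swap_restrict) (use fin finite_matchings_of_size in auto)
  also have "\<dots> = (\<Sum>(u, v)\<in>U \<times> V. \<Sum>K\<in>matchings_of_size (U - {u}) (V - {v}) y. F (insert {u, v} K))"
  proof (rule sum.cong[OF refl], clarify)
    fix u v assume uv: "u \<in> U" "v \<in> V"
    show "(\<Sum>K\<in>{K \<in> ?M. {fst (u, v), snd (u, v)} \<in> K}. F K) =
       (\<Sum>K\<in>matchings_of_size (U - {u}) (V - {v}) y. F (insert {u, v} K))"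
    proof (rule sum.reindex_bij_witness[of _ "insert {u, v}" "\<lambda>K. K - {{u, v}}"])
      fix K assume K: "K \<in> {K \<in> ?M. {fst (u, v), snd (u, v)} \<in> K}"
      then have m: "matching_on U V K" "num_pairs K = Suc y" "{u, v} \<in> K" by (auto simp: matchings_of_size_def)
      note r = matching_remove[OF m(1) fin disj uv m(3)]
      show eq: "insert {u, v} (K - {{u, v}}) = K" using m by auto
      show "K - {{u, v}} \<in> matchings_of_size (U - {u}) (V - {v}) y"
        using matching_insert(3)[OF r fin disj uv] eq m r by (simp add: matchings_of_size_def)
      show "F (insert {u, v} (K - {{u, v}})) = F K" by (simp only: eq)
    next
      fix K assume "K \<in> matchings_of_size (U - {u}) (V - {v}) y"
      then have m: "matching_on (U - {u}) (V - {v}) K" "num_pairs K = y" by (auto simp: matchings_of_size_def)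
      note r = matching_insert[OF m(1) fin disj uv]
      show "insert {u, v} K - {{u, v}} = K" using r by auto
      show "insert {u, v} K \<in> {K \<in> ?M. {fst (u, v), snd (u, v)} \<in> K}" using r m by (auto simp: matchings_of_size_def)
    qed
  qed
  finally show ?thesis .
qed

text \<open>The number \<open>S_tilde\<close> over an arbitrary ground set.\<close>

definition half_sum :: "'a set \<Rightarrow> 'a set set \<Rightarrow> 'a set set \<Rightarrow> nat" where
  "half_sum A K1 K2 = (num_pairs K1 + num_pairs K2 + card (alt_segments A K1 K2)) div 2"

text \<open>An edge of \<open>K2\<close> contributes one to the number of pairs there; either a pair of \<open>K1\<close> or a segment
  disappears with it.  So the division by two stays exact.\<close>

lemma half_sum_insert:
  assumes K1: "matching_on U V K1" and fin: "finite U" "finite V" and disj: "U \<inter> V = {}"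
    and u: "u \<in> U" and v: "v \<in> V" and K2: "matching_on (U - {u}) (V - {v}) K2"
  shows "half_sum (U \<union> V) K1 (insert {u, v} K2) = Suc (half_sum (U - {u} \<union> (V - {v})) (contract u v K1) K2)"
  unfolding half_sum_def using join_stats(2)[OF assms] contract_stats(2)[OF K1 fin disj u v]
    matching_insert(3)[OF K2 fin disj u v] by (auto split: if_splits)

text \<open>A second matching without edges does not change the first one, all of whose pairs are then
  segments.\<close>

lemma no_pairs_stats:
  assumes K1: "matching_on U V K1" and fin: "finite U" "finite V" and disj: "U \<inter> V = {}"
    and K2: "matching_on U V K2" "num_pairs K2 = 0"
  shows "alt_cycles (U \<union> V) K1 K2 = {}" "half_sum (U \<union> V) K1 K2 = num_pairs K1"
proof -
  have P1: "partition_on (U \<union> V) K1" and P2: "partition_on (U \<union> V) K2" using K1 K2 by (auto simp: matching_on_def)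
  have s: "singletons K2 = U \<union> V"
    using card_singletons[OF K2(1) fin disj] K2(2) fin P2
      card_subset_eq[OF fin(1), of "U \<inter> singletons K2"] card_subset_eq[OF fin(2), of "V \<inter> singletons K2"] 
    by (auto simp: singletons_def partition_on_def)
  have K2e: "\<exists>Y\<in>K1. X \<subseteq> Y" if "X \<in> K2" for X
  proof -
    have "X \<noteq> {}" "X \<subseteq> U \<union> V" using that P2 by (auto simp: partition_on_def)
    then obtain x where x: "x \<in> X" "x \<in> U \<union> V" by blast
    then have "{x} \<in> K2" using s by (auto simp: singletons_def)
    then have "X = {x}" using partition_disj[OF P2 that _ x(1)] by auto
    then show ?thesis using block_of_mem[OF P1 x(2)] by auto
  qed
  have J: "partition_join (U \<union> V) K1 K2 = K1"
    by (rule partition_join_eqI) (use P1 P2 K2e in \<open>auto simp: refines_def\<close>)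
  have sub: "X \<subseteq> U \<union> V" "X \<noteq> {}" if "X \<in> K1" for X using that P1 by (auto simp: partition_on_def)
  show "alt_cycles (U \<union> V) K1 K2 = {}"
    unfolding alt_cycles_def J s using sub by blast
  have "card (X \<inter> singletons K1) \<noteq> 2" if "X \<in> K1" for X
  proof -
    have "X \<inter> singletons K1 \<subseteq> {x}" if "x \<in> X \<inter> singletons K1" for x
      using partition_disj[OF P1 \<open>X \<in> K1\<close>, of "{x}" x] that by (auto simp: singletons_def)
    then have "X \<inter> singletons K1 = {} \<or> (\<exists>x. X \<inter> singletons K1 = {x})" by blast
    then show ?thesis by auto
  qed
  moreover have "X \<inter> (U \<union> V) = X" if "X \<in> K1" for X using sub(1)[OF that] by auto
  ultimately have "alt_segments (U \<union> V) K1 K2 = {X \<in> K1. card X = 2}"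
    unfolding alt_segments_def J s by auto
  then show "half_sum (U \<union> V) K1 K2 = num_pairs K1" using K2(2) by (simp add: half_sum_def num_pairs_def)
qed

lemma half_sum_le:
  assumes "matching_on U V K1" "finite U" "finite V" "U \<inter> V = {}" "matching_on U V K2"
  shows "half_sum (U \<union> V) K1 K2 \<le> card U"
  using assms
proof (induction "num_pairs K2" arbitrary: U V K1 K2)
  case 0
  then show ?case using no_pairs_stats(2)[of U V K1 K2] card_singletons(1)[of U V K1] by simp
next
  case (Suc y)
  have "edges_of U V K2 \<noteq> {}" using card_edges_of[OF Suc.prems(5,2,3,4)] Suc.hyps(2) by auto
  then obtain u v where uv: "u \<in> U" "v \<in> V" "{u, v} \<in> K2" by (auto simp: edges_of_def)
  note r = matching_remove[OF Suc.prems(5,2,3,4) uv]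
  have eq: "insert {u, v} (K2 - {{u, v}}) = K2" using uv by auto
  have y: "y = num_pairs (K2 - {{u, v}})" using matching_insert(3)[OF r Suc.prems(2-4) uv(1,2)] eq Suc.hyps(2) by simp
  have "half_sum (U - {u} \<union> (V - {v})) (contract u v K1) (K2 - {{u, v}}) \<le> card (U - {u})"
    by (rule Suc.hyps(1)[OF y contract_stats(1)[OF Suc.prems(1-4) uv(1,2)] _ _ _ r]) (use Suc.prems in auto)
  then show ?case
    using half_sum_insert[OF Suc.prems(1-4) uv(1,2) r] eq uv(1) Suc.prems(2) card_Suc_Diff1[of U u] by simp
qed

definition weighted_sum :: "'a set \<Rightarrow> 'a set \<Rightarrow> 'a set set \<Rightarrow> nat \<Rightarrow> (nat \<Rightarrow> real) \<Rightarrow> real" where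
  "weighted_sum U V K1 y f =
    (\<Sum>K2\<in>matchings_of_size U V y. 2 ^ card (alt_cycles (U \<union> V) K1 K2) * f (half_sum (U \<union> V) K1 K2))"

lemma weighted_sum_Suc:
  assumes K1: "matching_on U V K1" and fin: "finite U" "finite V" and disj: "U \<inter> V = {}"
  shows "real (Suc y) * weighted_sum U V K1 (Suc y) f =
    (\<Sum>(u, v)\<in>U \<times> V. (if {u, v} \<in> K1 then 2 else 1) *
       weighted_sum (U - {u}) (V - {v}) (contract u v K1) y (\<lambda>s. f (Suc s)))"
  unfolding weighted_sum_def sum_matchings_remove_edge[OF fin disj]
proof (rule sum.cong[OF refl], clarify, unfold sum_distrib_left, rule sum.cong[OF refl])
  fix u v K assume uv: "u \<in> U" "v \<in> V" and K: "K \<in> matchings_of_size (U - {u}) (V - {v}) y"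
  then have "matching_on (U - {u}) (V - {v}) K" by (simp add: matchings_of_size_def)
  note this' = join_stats(1)[OF K1 fin disj uv this] half_sum_insert[OF K1 fin disj uv this]
  show "2 ^ card (alt_cycles (U \<union> V) K1 (insert {u, v} K)) * f (half_sum (U \<union> V) K1 (insert {u, v} K)) =
    (if {u, v} \<in> K1 then 2 else 1) * (2 ^ card (alt_cycles (U - {u} \<union> (V - {v})) (contract u v K1) K) *
       f (Suc (half_sum (U - {u} \<union> (V - {v})) (contract u v K1) K)))"
    unfolding this' by simp
qed

lemma matchings_of_size_0:
  assumes fin: "finite U" "finite V" and disj: "U \<inter> V = {}"
  shows "matchings_of_size U V 0 = {(\<lambda>x. {x}) ` (U \<union> V)}"
proof (intro equalityI subsetI)
  fix K assume "K \<in> matchings_of_size U V 0"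
  then have K: "matching_on U V K" "num_pairs K = 0" by (auto simp: matchings_of_size_def)
  have P: "partition_on (U \<union> V) K" using K by (simp add: matching_on_def)
  have n: "\<not> (X \<in> K \<and> card X = 2)" for X
    using K(2) finite_elements[OF _ P] fin by (auto simp: num_pairs_def)
  have s: "\<exists>x\<in>U \<union> V. X = {x}" if X: "X \<in> K" for X
    using K(1) fin X
  proof (cases rule: matching_block_cases)
    case (2 u v)
    then have "card X = 2" using disj by (auto simp: card_insert_if)
    then show ?thesis using n X by auto
  qed auto
  have "{x} \<in> K" if "x \<in> U \<union> V" for x
  proof -
    have "x \<in> \<Union>K" using P that by (simp add: partition_on_def)
    then obtain X where "X \<in> K" "x \<in> X" by blast
    then show ?thesis using s by fastforce
  qed
  then show "K \<in> {(\<lambda>x. {x}) ` (U \<union> V)}" using s by auto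
next
  fix K assume K: "K \<in> {(\<lambda>x. {x}) ` (U \<union> V)}"
  have P: "partition_on (U \<union> V) K" using K partition_on_singletons[of "U \<union> V"] by simp
  have "matching_on U V K" by (rule matching_onI[OF P disj]) (use K in auto)
  moreover have "card {X \<in> K. card X = 2} = 0" using K by (subst card_eq_0_iff) auto
  ultimately show "K \<in> matchings_of_size U V 0" by (simp only: matchings_of_size_def num_pairs_def) simp
qed

text \<open>The sum over \<open>K2\<close> acts on functions of the half sum.  After contraction the hypothesis on \<open>f\<close> holds
  again for the shifted function with \<open>k - 1\<close>, \<open>l - 1\<close> and \<open>j - 1\<close> in place of \<open>k\<close>, \<open>l\<close> and \<open>j\<close>, which makes
  the induction on \<open>y\<close> work.  The factor \<open>j (k + l + 1 - j)\<close> gained in a step arises as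
  \<open>(j - m) (k + l + 1 - j - m) + m (k + l + 1 - m)\<close>: the first summand belongs to the edges of \<open>K2\<close> between
  singletons of \<open>K1\<close>, the second to all others, those in \<open>K1\<close> being counted twice.\<close>

lemma weighted_sum_eigen:
  fixes j :: real and f :: "nat \<Rightarrow> real"
  assumes "matching_on U V K1" "finite U" "finite V" "U \<inter> V = {}"
    and "\<And>s. s \<le> card U \<Longrightarrow> (real (card U) - real s) * (real (card V) - real s) * f (Suc s) =
           (j - real s) * (real (card U + card V) + 1 - j - real s) * f s"
  shows "fact y * weighted_sum U V K1 y f =
     (\<Prod>i<y. (j - real i) * (real (card U + card V) + 1 - j - real i)) * f (num_pairs K1)"
  using assms
proof (induction y arbitrary: U V K1 f j)
  case 0
  have "matchings_of_size U V 0 = {(\<lambda>x. {x}) ` (U \<union> V)}" by (rule matchings_of_size_0[OF 0(2-4)])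
  then have m: "matchings_of_size U V 0 = {(\<lambda>x. {x}) ` (U \<union> V)}" and "(\<lambda>x. {x}) ` (U \<union> V) \<in> matchings_of_size U V 0" by auto
  then have "matching_on U V ((\<lambda>x. {x}) ` (U \<union> V))" "num_pairs ((\<lambda>x. {x}) ` (U \<union> V)) = 0"
    by (auto simp: matchings_of_size_def)
  then show ?case unfolding weighted_sum_def m using no_pairs_stats[OF 0(1-4)] by simp
next
  case (Suc y)
  define k l m where "k = card U" and "l = card V" and "m = num_pairs K1"
  define c where "c = (\<Prod>i<y. (j - 1 - real i) * (real (k + l) - 2 + 1 - (j - 1) - real i))"
  define S where "S = singletons K1"
  have part: "partition_on (U \<union> V) K1" using Suc.prems(1) by (simp add: matching_on_def)
  have cs: "card (U \<inter> S) + m = k" "card (V \<inter> S) + m = l"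
    using card_singletons[OF Suc.prems(1-4)] by (auto simp: k_def l_def m_def S_def)
  have step: "fact y * weighted_sum (U - {u}) (V - {v}) (contract u v K1) y (\<lambda>s. f (Suc s)) =
      c * (if u \<in> S \<and> v \<in> S then f (Suc m) else f m)" if uv: "u \<in> U" "v \<in> V" for u v
  proof -
    have cU: "card (U - {u}) = k - 1" "card (V - {v}) = l - 1" "k \<ge> 1" "l \<ge> 1"
      using uv Suc.prems(2,3) card_gt_0_iff[of U] card_gt_0_iff[of V] by (auto simp: k_def l_def Suc_le_eq)
    have rc: "real (card (U - {u})) = real k - 1" "real (card (V - {v})) = real l - 1"
      using cU by (auto simp: of_nat_diff)
    note cst = contract_stats[OF Suc.prems(1-4) uv]
    have "fact y * weighted_sum (U - {u}) (V - {v}) (contract u v K1) y (\<lambda>s. f (Suc s)) =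
      (\<Prod>i<y. (j - 1 - real i) * (real (card (U - {u}) + card (V - {v})) + 1 - (j - 1) - real i))
       * f (Suc (num_pairs (contract u v K1)))"
    proof (rule Suc.IH[OF cst(1)])
      fix s assume s: "s \<le> card (U - {u})"
      then have "Suc s \<le> card U" using cU by (simp add: k_def)
      from Suc.prems(5)[OF this]
      show "(real (card (U - {u})) - real s) * (real (card (V - {v})) - real s) * f (Suc (Suc s)) =
         (j - 1 - real s) * (real (card (U - {u}) + card (V - {v})) + 1 - (j - 1) - real s) * f (Suc s)"
        unfolding of_nat_add rc k_def l_def by (simp add: algebra_simps)
    qed (use Suc.prems in auto)
    moreover have "(\<Prod>i<y. (j - 1 - real i) * (real (card (U - {u}) + card (V - {v})) + 1 - (j - 1) - real i)) = c"
      unfolding c_def of_nat_add rc by (intro prod.cong) (auto simp: algebra_simps)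
    moreover have "f (Suc (num_pairs (contract u v K1))) = (if u \<in> S \<and> v \<in> S then f (Suc m) else f m)"
      using cst(2) by (auto simp: S_def singletons_def m_def)
    ultimately show ?thesis by simp
  qed
  have excl: "\<not> (u \<in> S \<and> v \<in> S)" if "{u, v} \<in> K1" "u \<in> U" "v \<in> V" for u v
    using singletons_disj(1)[OF part that(1)] that Suc.prems(4) by (auto simp: S_def)
  have "fact (Suc y) * weighted_sum U V K1 (Suc y) f = fact y * (real (Suc y) * weighted_sum U V K1 (Suc y) f)"
    by (simp add: algebra_simps)
  also have "\<dots> = (\<Sum>(u, v)\<in>U \<times> V. (if {u, v} \<in> K1 then 2 else 1) *
       (fact y * weighted_sum (U - {u}) (V - {v}) (contract u v K1) y (\<lambda>s. f (Suc s))))"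
    unfolding weighted_sum_Suc[OF Suc.prems(1-4)] sum_distrib_left by (intro sum.cong) (auto simp: mult_ac)
  also have "\<dots> = (\<Sum>(u, v)\<in>U \<times> V. (if {u, v} \<in> K1 then 2 else 1) * (c * (if u \<in> S \<and> v \<in> S then f (Suc m) else f m)))"
    by (intro sum.cong refl) (auto simp: step)
  also have "\<dots> = (\<Sum>e\<in>U \<times> V. c * f m + (if e \<in> S \<times> S then c * (f (Suc m) - f m) else 0) + (if e \<in> edges_of U V K1 then c * f m else 0))"
  proof (intro sum.cong refl, clarify)
    fix u v assume uv: "u \<in> U" "v \<in> V"
    show "(if {u, v} \<in> K1 then 2 else 1) * (c * (if u \<in> S \<and> v \<in> S then f (Suc m) else f m)) =
      c * f m + (if (u, v) \<in> S \<times> S then c * (f (Suc m) - f m) else 0) + (if (u, v) \<in> edges_of U V K1 then c * f m else 0)"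
      by (cases "{u, v} \<in> K1") (use excl[of u v] uv in \<open>auto simp: edges_of_def algebra_simps\<close>)
  qed
  also have "\<dots> = c * f m * real (k * l) + c * (f (Suc m) - f m) * real (card ((U \<times> V) \<inter> (S \<times> S)))
      + c * f m * real (card ((U \<times> V) \<inter> edges_of U V K1))"
    using Suc.prems(2,3)
    by (simp add: sum.distrib sum.inter_restrict[symmetric] card_cartesian_product k_def l_def mult_ac)
  also have "(U \<times> V) \<inter> edges_of U V K1 = edges_of U V K1" by (auto simp: edges_of_def)
  also have "card (edges_of U V K1) = m" using card_edges_of[OF Suc.prems(1-4)] by (simp add: m_def)
  also have "(U \<times> V) \<inter> (S \<times> S) = (U \<inter> S) \<times> (V \<inter> S)" by auto
  also have "real (card ((U \<inter> S) \<times> (V \<inter> S))) = (real k - real m) * (real l - real m)"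
    using cs by (auto simp: card_cartesian_product simp flip: of_nat_mult)
  also have "c * f m * real (k * l) + c * (f (Suc m) - f m) * ((real k - real m) * (real l - real m)) + c * f m * real m
     = c * ((real k - real m) * (real l - real m) * f (Suc m) + real m * (real k + real l - real m + 1) * f m)"
    by (simp add: algebra_simps)
  also have "(real k - real m) * (real l - real m) * f (Suc m) = (j - real m) * (real (k + l) + 1 - j - real m) * f m"
    using Suc.prems(5)[of m] cs by (simp add: k_def l_def)
  also have "c * ((j - real m) * (real (k + l) + 1 - j - real m) * f m + real m * (real k + real l - real m + 1) * f m)
     = j * (real (k + l) + 1 - j) * c * f m"
    by (simp add: algebra_simps)
  also have "j * (real (k + l) + 1 - j) * c = (\<Prod>i<Suc y. (j - real i) * (real (k + l) + 1 - j - real i))"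
    unfolding prod.lessThan_Suc_shift c_def by (simp add: algebra_simps)
  finally show ?case by (simp add: k_def l_def m_def)
qed

lemma card_matchings_of_size:
  assumes "finite U" "finite V" "U \<inter> V = {}" "y \<le> card U" "y \<le> card V"
  shows "real (card (matchings_of_size U V y)) = fact (card U) * fact (card V) / (fact y * fact (card U - y) * fact (card V - y))"
  using assms
proof (induction y arbitrary: U V)
  case 0
  have "matchings_of_size U V 0 = {(\<lambda>x. {x}) ` (U \<union> V)}" by (rule matchings_of_size_0) (use 0 in auto)
  then show ?case by simp
next
  case (Suc y)
  have "real (Suc y) * real (card (matchings_of_size U V (Suc y))) =
     (\<Sum>(u, v)\<in>U \<times> V. real (card (matchings_of_size (U - {u}) (V - {v}) y)))"
    using sum_matchings_remove_edge[OF Suc.prems(1-3), of y "\<lambda>_. 1"] by simp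
  also have "\<dots> = (\<Sum>(u, v)\<in>U \<times> V. fact (card U - 1) * fact (card V - 1) / (fact y * fact (card U - Suc y) * fact (card V - Suc y)))"
  proof (intro sum.cong refl, clarify)
    fix u v assume "u \<in> U" "v \<in> V"
    then have "card (U - {u}) = card U - 1" "card (V - {v}) = card V - 1" using Suc.prems by auto
    moreover have "(U - {u}) \<inter> (V - {v}) = {}" using Suc.prems(3) by blast
    ultimately show "real (card (matchings_of_size (U - {u}) (V - {v}) y)) =
       fact (card U - 1) * fact (card V - 1) / (fact y * fact (card U - Suc y) * fact (card V - Suc y))"
      using Suc.IH[of "U - {u}" "V - {v}"] Suc.prems by auto
  qed
  also have "\<dots> = fact (card U) * fact (card V) / (fact y * fact (card U - Suc y) * fact (card V - Suc y))"
    using Suc.prems fact_reduce[of "card U", where 'a = real] fact_reduce[of "card V", where 'a = real]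
    by (simp add: card_cartesian_product)
  finally have "real (Suc y) * real (card (matchings_of_size U V (Suc y))) =
    fact (card U) * fact (card V) / (fact y * fact (card U - Suc y) * fact (card V - Suc y))" .
  then have "real (card (matchings_of_size U V (Suc y))) =
    fact (card U) * fact (card V) / (fact y * fact (card U - Suc y) * fact (card V - Suc y)) / real (Suc y)"
    by (metis nonzero_mult_div_cancel_left of_nat_eq_0_iff nat.distinct(1))
  then show ?case by (simp add: mult_ac)
qed

section \<open>Principal minors and symmetric functions of eigenvalues\<close>

text \<open>A principal minor as a determinant of full size.  The rows outside of \<open>I\<close> are those of the
  identity, so that all minors of a matrix have the same type.\<close>

definition pminor :: "'n set \<Rightarrow> complex^'n^'n \<Rightarrow> complex" where
  "pminor I W = det (\<chi> i j. if i \<in> I then W $ i $ j else if i = j then 1 else 0)"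

definition esym_mat :: "nat \<Rightarrow> complex^'n^'n \<Rightarrow> complex" where
  "esym_mat k W = (\<Sum>I | card I = k. pminor I W)"

definition diagm :: "('n \<Rightarrow> complex) \<Rightarrow> complex^'n^'n" where
  "diagm a = (\<chi> i j. if i = j then a i else 0)"

lemma det_one_plus_expand:
  fixes W :: "complex^'n^'n"
  shows "det (\<chi> i j. (if i = j then 1 else 0) + t * W $ i $ j) = (\<Sum>I\<in>UNIV. t ^ card I * pminor I W)"
proof -
  let ?P = "{p. p permutes (UNIV :: 'n set)}"
  have "det (\<chi> i j. (if i = j then 1 else 0) + t * W $ i $ j) =
      (\<Sum>p\<in>?P. of_int (sign p) * (\<Prod>i\<in>UNIV. t * W $ i $ p i + (if i = p i then 1 else 0)))"
    by (simp add: det_def add.commute)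
  also have "\<dots> = (\<Sum>p\<in>?P. \<Sum>I\<in>UNIV. of_int (sign p) * ((\<Prod>i\<in>I. t * W $ i $ p i) * (\<Prod>i\<in>UNIV - I. if i = p i then 1 else 0)))"
    by (simp add: prod_add sum_distrib_left)
  also have "\<dots> = (\<Sum>I\<in>UNIV. \<Sum>p\<in>?P. of_int (sign p) * ((\<Prod>i\<in>I. t * W $ i $ p i) * (\<Prod>i\<in>UNIV - I. if i = p i then 1 else 0)))"
    by (rule sum.swap)
  also have "\<dots> = (\<Sum>I\<in>UNIV. t ^ card I * pminor I W)"
  proof (rule sum.cong[OF refl])
    fix I :: "'n set"
    have *: "(\<Prod>i\<in>UNIV. if i \<in> I then W $ i $ p i else if i = p i then 1 else 0) =
        (\<Prod>i\<in>I. W $ i $ p i) * (\<Prod>i\<in>UNIV - I. if i = p i then 1 else 0)" for p :: "'n \<Rightarrow> 'n"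
      by (subst prod.subset_diff[of I UNIV]) (auto intro!: arg_cong2[of _ _ _ _ "(*)"] prod.cong)
    show "(\<Sum>p\<in>?P. of_int (sign p) * ((\<Prod>i\<in>I. t * W $ i $ p i) * (\<Prod>i\<in>UNIV - I. if i = p i then 1 else 0))) =
       t ^ card I * pminor I W"
      unfolding pminor_def det_def sum_distrib_left vec_lambda_beta *
      by (intro sum.cong) (auto simp: prod.distrib)
  qed
  finally show ?thesis .
qed

lemma sum_by_card:
  fixes f :: "'n::finite set \<Rightarrow> complex"
  shows "(\<Sum>I\<in>UNIV. t ^ card I * f I) = (\<Sum>k\<le>CARD('n). (\<Sum>I | card I = k. f I) * t ^ k)"
proof -
  have "(\<Sum>k\<le>CARD('n). (\<Sum>I | card I = k. f I) * t ^ k) = (\<Sum>k\<le>CARD('n). \<Sum>I\<in>{I\<in>UNIV. card I = k}. t ^ card I * f I)"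
    by (intro sum.cong) (auto simp: sum_distrib_right intro!: sum.cong)
  also have "\<dots> = (\<Sum>I\<in>UNIV. t ^ card I * f I)"
    by (rule sum.group) (auto intro: card_mono)
  finally show ?thesis by simp
qed

lemma det_one_plus:
  fixes W :: "complex^'n^'n"
  shows "det (\<chi> i j. (if i = j then 1 else 0) + t * W $ i $ j) = (\<Sum>k\<le>CARD('n). esym_mat k W * t ^ k)"
  unfolding det_one_plus_expand sum_by_card esym_mat_def ..

lemma poly_det: "poly (det M) z = det (\<chi> i j. poly (M $ i $ j) z)" for M :: "complex poly^'n^'n"
  by (simp add: det_def poly_sum poly_prod)

lemma esym_mat_gt: "k > CARD('n) \<Longrightarrow> esym_mat k (W :: complex^'n^'n) = 0"
  "k > CARD('n) \<Longrightarrow> elem_sym k (x :: 'n::finite \<Rightarrow> complex) = 0"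
proof -
  assume "k > CARD('n)"
  then have "{I :: 'n set. card I = k} = {}"
    using card_mono[of "UNIV :: 'n set"] by (auto simp: not_less[symmetric])
  then show "esym_mat k W = 0" "elem_sym k x = 0" by (simp_all add: esym_mat_def elem_sym_def)
qed

lemma esym_mat_0 [simp]: "esym_mat 0 W = 1" and elem_sym_0 [simp]: "elem_sym 0 (x :: 'n::finite \<Rightarrow> complex) = 1"
proof -
  have e: "{I :: 'm::finite set. card I = 0} = {{}}" by auto
  have "pminor {} W = det (mat 1 :: complex^'m^'m)" for W :: "complex^'m^'m" unfolding pminor_def mat_def by simp
  then show "esym_mat 0 W = 1" by (simp add: esym_mat_def e)
  show "elem_sym 0 x = 1" by (simp add: elem_sym_def e)
qed

text \<open>The value at \<open>0\<close> is left out since the characteristic polynomial is substituted at \<open>-1 / t\<close>.\<close>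

lemma coeffs_eq_if_eq_off_zero:
  fixes c e :: "nat \<Rightarrow> complex"
  assumes "\<And>t. t \<noteq> 0 \<Longrightarrow> (\<Sum>k\<le>n. c k * t ^ k) = (\<Sum>k\<le>n. e k * t ^ k)" "k \<le> n"
  shows "c k = e k"
proof -
  have z: "(\<Sum>k\<le>n. (c k - e k) * t ^ k) = 0" if "t \<noteq> 0" for t
    using assms(1)[OF that] by (simp add: left_diff_distrib sum_subtractf)
  have "infinite {t. (\<Sum>k\<le>n. (c k - e k) * t ^ k) = 0}"
  proof
    assume "finite {t. (\<Sum>k\<le>n. (c k - e k) * t ^ k) = 0}"
    then have "finite (- {0 :: complex})" by (rule rev_finite_subset) (use z in auto)
    then show False using infinite_UNIV_char_0[where 'a=complex] by (simp add: finite_compl)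
  qed
  then have "c k - e k = 0" using Transcendental.polyfun_finite_roots[where n = n and c = "\<lambda>k. c k - e k"] assms(2) by blast
  then show ?thesis by simp
qed

text \<open>The determinant of \<open>1 + t W\<close> generates both sides: expanded by rows it yields the principal minors,
  and up to scaling it is the characteristic polynomial at \<open>-1 / t\<close>, hence a product over the
  eigenvalues.\<close>

lemma elem_sym_eigenvalues_eq_esym_mat:
  fixes W :: "complex^'n^'n"
  shows "elem_sym_eigenvalues k W = esym_mat k W"
proof -
  obtain x where x: "eigenvalue_family W x" using eigenvalue_family_exists by blast
  define lc where "lc = lead_coeff (char_poly W)"
  have fac: "poly (char_poly W) z = lc * (\<Prod>i\<in>UNIV. z - x i)" for z
  proof -
    have "char_poly W = smult lc (\<Prod>y\<in>#image_mset x (mset_set UNIV). [:-y, 1:])"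
      using complex_poly_decompose_multiset[of "char_poly W"] x by (simp add: eigenvalue_family_def lc_def)
    also have "(\<Prod>y\<in>#image_mset x (mset_set UNIV). [:-y, 1:]) = (\<Prod>i\<in>UNIV. [:- x i, 1:])"
      by (simp add: prod_unfold_prod_mset multiset.map_comp o_def)
    finally show ?thesis by (simp add: poly_prod)
  qed
  have "(\<Sum>k\<le>CARD('n). esym_mat k W * t ^ k) = (\<Sum>k\<le>CARD('n). lc * elem_sym k x * t ^ k)" if t: "t \<noteq> 0" for t
  proof -
    define z where "z = - 1 / t"
    have z: "z * t = -1" "z \<noteq> 0" using t by (auto simp: z_def)
    have "z ^ CARD('n) * det (\<chi> i j. (if i = j then 1 else 0) + t * W $ i $ j) =
        det (\<chi> i. z *s (\<chi> j. (if i = j then 1 else 0) + t * W $ i $ j))"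
      by (subst det_rows_mul) simp
    also have "(\<chi> i. z *s (\<chi> j. (if i = j then 1 else 0) + t * W $ i $ j)) = (\<chi> i j. poly ((mat [:0, 1:] - map_matrix (\<lambda>c. [:c:]) W) $ i $ j) z)"
    proof -
      have "z * (t * w) = - w" for w using z(1) by (simp flip: mult.assoc)
      then show ?thesis by (auto simp: vec_eq_iff mat_def vector_scalar_mult_def distrib_left)
    qed
    also have "det \<dots> = poly (char_poly W) z" unfolding char_poly_def poly_det ..
    also have "\<dots> = lc * (\<Prod>i\<in>UNIV. z * (1 + t * x i))"
    proof -
      have "z * (t * w) = - w" for w using z(1) by (simp flip: mult.assoc)
      then show ?thesis unfolding fac by (simp add: distrib_left)
    qed
    also have "\<dots> = z ^ CARD('n) * (lc * (\<Prod>i\<in>UNIV. 1 + t * x i))" by (simp add: prod.distrib)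
    finally have "(\<Sum>k\<le>CARD('n). esym_mat k W * t ^ k) = lc * (\<Prod>i\<in>UNIV. t * x i + 1)"
      using z det_one_plus[of t W] by (simp add: add.commute)
    also have "(\<Prod>i\<in>UNIV. t * x i + 1) = (\<Sum>I\<in>UNIV. t ^ card I * (\<Prod>i\<in>I. x i))"
      by (simp add: prod_add prod.distrib)
    finally show ?thesis unfolding sum_by_card by (simp add: elem_sym_def sum_distrib_left sum_distrib_right mult.assoc)
  qed
  note c = coeffs_eq_if_eq_off_zero[OF this]
  have "lc = 1" using c[of 0] by simp
  then have "esym_mat k W = elem_sym k x" using c[of k] esym_mat_gt(1)[of k W] esym_mat_gt(2)[of k x] by (cases "k \<le> CARD('n)") auto
  then show ?thesis using elem_sym_eigenvalues_eq[OF x] by simp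
qed

lemma matrix_mult_add_rdistrib: "(A + B) ** C = A ** C + B ** C"
  for A B :: "'a::semiring_1^'n^'m"
  by (simp add: matrix_matrix_mult_def vec_eq_iff distrib_right sum.distrib)

text \<open>If \<open>X\<close> is invertible, \<open>(1 + X Y) X = X (1 + Y X)\<close> implies the claim.  In general, \<open>X\<close> is replaced by
  \<open>X + x\<close> with an indeterminate \<open>x\<close>; its determinant is a characteristic polynomial and can be cancelled,
  and \<open>x = 0\<close> gives the result.\<close>

lemma det_one_plus_commute:
  fixes X Y :: "complex^'n^'n"
  shows "det (mat 1 + X ** Y) = det (mat 1 + Y ** X)"
proof -
  define X' where "X' = (mat [:0, 1:] - map_matrix (\<lambda>c. [:c:]) (- X) :: complex poly^'n^'n)"
  define Y' where "Y' = (map_matrix (\<lambda>c. [:c:]) Y :: complex poly^'n^'n)"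
  have "degree (det X') = CARD('n)" using degree_char_poly[of "- X"] by (simp add: char_poly_def X'_def)
  then have nz: "det X' \<noteq> 0" by auto
  have "(mat 1 + X' ** Y') ** X' = X' ** (mat 1 + Y' ** X')"
    by (simp add: matrix_add_ldistrib matrix_mul_assoc matrix_mult_add_rdistrib)
  then have "det (mat 1 + X' ** Y') * det X' = det X' * det (mat 1 + Y' ** X')" by (metis det_mul)
  then have "poly (det (mat 1 + X' ** Y')) 0 = poly (det (mat 1 + Y' ** X')) 0" using nz by simp
  moreover have "(\<chi> i j. poly ((mat 1 + X' ** Y') $ i $ j) 0) = mat 1 + X ** Y"
    by (auto simp: vec_eq_iff X'_def Y'_def mat_def matrix_matrix_mult_def poly_sum intro!: sum.cong)
  moreover have "(\<chi> i j. poly ((mat 1 + Y' ** X') $ i $ j) 0) = mat 1 + Y ** X"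
    by (auto simp: vec_eq_iff X'_def Y'_def mat_def matrix_matrix_mult_def poly_sum intro!: sum.cong)
  ultimately show ?thesis by (simp add: poly_det)
qed

lemma esym_mat_commute: "esym_mat k (X ** Y) = esym_mat k (Y ** X)" for X Y :: "complex^'n^'n"
proof -
  have "(\<Sum>k\<le>CARD('n). esym_mat k (X ** Y) * t ^ k) = (\<Sum>k\<le>CARD('n). esym_mat k (Y ** X) * t ^ k)" for t
  proof -
    define Z where "Z = (\<chi> i j. t * X $ i $ j)"
    have "(\<chi> i j. (if i = j then 1 else 0) + t * (X ** Y) $ i $ j) = mat 1 + Z ** Y"
      "(\<chi> i j. (if i = j then 1 else 0) + t * (Y ** X) $ i $ j) = mat 1 + Y ** Z"
      by (auto simp: vec_eq_iff mat_def matrix_matrix_mult_def Z_def sum_distrib_left mult_ac)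
    then show ?thesis unfolding det_one_plus[symmetric] using det_one_plus_commute[of Z Y] by simp
  qed
  then show ?thesis
    using coeffs_eq_if_eq_off_zero[where n = "CARD('n)" and c = "\<lambda>k. esym_mat k (X ** Y)" and e = "\<lambda>k. esym_mat k (Y ** X)"]
      esym_mat_gt(1)[of k "X ** Y"] esym_mat_gt(1)[of k "Y ** X"] by (cases "k \<le> CARD('n)") auto
qed

lemma pminor_diagm_mult: "pminor I (diagm a ** W) = (\<Prod>i\<in>I. a i) * pminor I W" for W :: "complex^'n^'n"
proof -
  have "(\<chi> i j. if i \<in> I then (diagm a ** W) $ i $ j else if i = j then 1 else 0) =
     (\<chi> i. (if i \<in> I then a i else 1) *s (\<chi> j. if i \<in> I then W $ i $ j else if i = j then 1 else 0))"
    by (auto simp: vec_eq_iff diagm_def matrix_matrix_mult_def if_distrib[of "\<lambda>x. x * _"] cong: if_cong)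
  then show ?thesis unfolding pminor_def by (simp add: det_rows_mul flip: prod.inter_restrict[of UNIV, simplified])
qed

lemma esym_mat_diagm_mult: "esym_mat k (diagm a ** W) = (\<Sum>I | card I = k. (\<Prod>i\<in>I. a i) * pminor I W)"
  by (simp add: esym_mat_def pminor_diagm_mult)

lemma pminor_one [simp]: "pminor I (mat 1 :: complex^'n^'n) = 1"
proof -
  have "(\<chi> i j. if i \<in> I then (mat 1 :: complex^'n^'n) $ i $ j else if i = j then 1 else 0) = mat 1"
    by (auto simp: vec_eq_iff mat_def)
  then show ?thesis by (simp add: pminor_def)
qed

lemma esym_mat_diagm: "esym_mat k (diagm a) = elem_sym k a"
  using esym_mat_diagm_mult[of k a "mat 1"] by (simp add: elem_sym_def)

lemma pminor_permute:
  fixes W :: "complex^'n^'n"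
  assumes p: "p permutes (UNIV :: 'n set)"
  shows "pminor I (\<chi> i j. W $ p i $ p j) = pminor (p ` I) W"
proof -
  have inj: "inj p" using p by (rule permutes_inj)
  let ?M = "\<chi> i j. if i \<in> p ` I then W $ i $ j else if i = j then 1 else 0"
  have "(\<chi> i j. if i \<in> I then (\<chi> i j. W $ p i $ p j) $ i $ j else if i = j then 1 else 0)
      = (\<chi> i j. (\<chi> i. ?M $ p i) $ i $ p j)"
    using inj by (auto simp: vec_eq_iff inj_image_mem_iff inj_eq)
  then show ?thesis unfolding pminor_def
    by (simp only: det_permute_columns[OF p] det_permute_rows[OF p]) (simp add: sign_def)
qed

text \<open>The matrix determinant lemma for \<open>1 + u w\<close>: in the expansion by rows, two rows taken from the
  rank one part are proportional and contribute nothing.\<close>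

lemma pminor_rank_one_update:
  fixes u w :: "'n::finite \<Rightarrow> complex"
  shows "pminor I (\<chi> i j. (if i = j then 1 else 0) + u i * w j) = 1 + (\<Sum>i\<in>I. u i * w i)"
proof -
  have fin: "finite I" by simp
  define e :: "'n \<Rightarrow> complex^'n" where "e i = (\<chi> j. if i = j then 1 else 0)" for i
  define wv :: "complex^'n" where "wv = (\<chi> j. w j)"
  have aux: "det (\<chi> i. if i = k then wv else if i \<in> I then e i + u i *s wv else e i) = w k" if "k \<notin> I" for k :: 'n and I :: "'n set"
    using finite[of I] that
  proof (induction I rule: finite_induct)
    case empty
    have "det ((\<chi> i. if i = k then sum (\<lambda>i. wv $ i *s row i (mat 1)) (UNIV::'n set) else row i (mat 1 :: complex^'n^'n))) = wv $ k * det (mat 1 :: complex^'n^'n)"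
      by (rule cramer_lemma_transpose)
    moreover have "sum (\<lambda>i. wv $ i *s row i (mat 1)) (UNIV::'n set) = wv"
      by (auto simp: vec_eq_iff row_def mat_def if_distrib[of "\<lambda>x. _ * x"] cong: if_cong)
    moreover have "row i (mat 1 :: complex^'n^'n) = e i" for i by (simp add: vec_eq_iff row_def mat_def e_def)
    ultimately have "det (\<chi> i. if i = k then wv else e i) = wv $ k * det (mat 1 :: complex^'n^'n)" by (simp only:)
    then show ?case by (simp add: wv_def cong: if_cong)
  next
    case (insert x F)
    let ?A = "\<chi> i. if i = k then wv else if i \<in> F then e i + u i *s wv else e i"
    have xk: "x \<noteq> k" using insert by auto
    have "det (\<chi> i. if i = x then row x ?A + u x *s row k ?A else row i ?A) = det ?A"
      by (rule det_row_operation[OF xk])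
    moreover have "(\<chi> i. if i = x then row x ?A + u x *s row k ?A else row i ?A) =
       (\<chi> i. if i = k then wv else if i \<in> insert x F then e i + u i *s wv else e i)"
      using xk insert.hyps by (auto simp: vec_eq_iff row_def)
    ultimately show ?case using insert by simp
  qed
  have "det (\<chi> i. if i \<in> I then e i + u i *s wv else e i) = 1 + (\<Sum>i\<in>I. u i * w i)"
    using fin
  proof (induction I rule: finite_induct)
    case empty
    have "(\<chi> i. e i) = (mat 1 :: complex^'n^'n)" by (auto simp: vec_eq_iff e_def mat_def)
    then show ?case by simp
  next
    case (insert k F)
    have "(\<chi> i. if i \<in> insert k F then e i + u i *s wv else e i) =
        (\<chi> i. if i = k then e i + u i *s wv else if i \<in> F then e i + u i *s wv else e i)" by (auto simp: vec_eq_iff)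
    then have "det (\<chi> i. if i \<in> insert k F then e i + u i *s wv else e i) =
        det (\<chi> i. if i = k then e i else if i \<in> F then e i + u i *s wv else e i) +
        det (\<chi> i. if i = k then u i *s wv else if i \<in> F then e i + u i *s wv else e i)"
      by (simp only: det_row_add)
    also have "(\<chi> i. if i = k then e i else if i \<in> F then e i + u i *s wv else e i) = (\<chi> i. if i \<in> F then e i + u i *s wv else e i)"
      using insert by (auto simp: vec_eq_iff)
    also have "(\<chi> i. if i = k then u i *s wv else if i \<in> F then e i + u i *s wv else e i) =
       (\<chi> i. if i = k then u k *s wv else if i \<in> F then e i + u i *s wv else e i)" by (auto simp: vec_eq_iff)
    also have "det \<dots> = u k * det (\<chi> i. if i = k then wv else if i \<in> F then e i + u i *s wv else e i)" by (rule det_row_mul)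
    finally show ?case using insert aux[of k F] by (simp add: algebra_simps)
  qed
  moreover have "(\<chi> i. if i \<in> I then e i + u i *s wv else e i) = (\<chi> i j. if i \<in> I then (\<chi> i j. (if i = j then 1 else 0) + u i * w j) $ i $ j else if i = j then 1 else 0)"
    by (auto simp: vec_eq_iff e_def wv_def)
  ultimately show ?thesis by (simp add: pminor_def)
qed

section \<open>Unitary matrices and Haar integrals\<close>

lemma conj_transpose_nth [simp]: "conj_transpose A $ i $ j = cnj (A $ j $ i)"
  by (simp add: conj_transpose_def map_matrix_def transpose_def)

lemma matrix_mult_nth: "(A ** B) $ i $ j = (\<Sum>k\<in>UNIV. A $ i $ k * B $ k $ j)"
  by (simp add: matrix_matrix_mult_def)

abbreviation conj_by :: "complex^'n^'n \<Rightarrow> complex^'n^'n \<Rightarrow> complex^'n^'n" where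
  "conj_by U X \<equiv> U ** X ** conj_transpose U"

lemma conj_transpose_mult: "conj_transpose (A ** B) = conj_transpose B ** conj_transpose A"
  by (simp add: vec_eq_iff matrix_mult_nth mult.commute)

lemma conj_transpose_conj_transpose [simp]: "conj_transpose (conj_transpose A) = A"
  by (simp add: vec_eq_iff)

lemma unitary_conj_transpose: "unitary U \<Longrightarrow> unitary (conj_transpose U)"
  by (simp add: unitary_def)

lemma unitaryI: "U ** conj_transpose U = mat 1 \<Longrightarrow> unitary U"
  by (simp add: unitary_def matrix_left_right_inverse)

lemma mult_cnj_cmod: "z * cnj z = complex_of_real ((cmod z)\<^sup>2)" "cnj z * z = complex_of_real ((cmod z)\<^sup>2)"
  by (simp_all only: complex_norm_square mult.commute)

lemma unitary_row_norm:
  assumes "unitary U"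
  shows "(\<Sum>j\<in>UNIV. (cmod (U $ i $ j))\<^sup>2) = 1" "(\<Sum>j\<in>UNIV. (cmod (U $ j $ i))\<^sup>2) = 1"
proof -
  have "(U ** conj_transpose U) $ i $ i = 1" "(conj_transpose U ** U) $ i $ i = 1"
    using assms by (auto simp: unitary_def mat_def)
  then have "complex_of_real (\<Sum>j\<in>UNIV. (cmod (U $ i $ j))\<^sup>2) = 1" "complex_of_real (\<Sum>j\<in>UNIV. (cmod (U $ j $ i))\<^sup>2) = 1"
    by (simp_all add: matrix_mult_nth mult_cnj_cmod)
  then show "(\<Sum>j\<in>UNIV. (cmod (U $ i $ j))\<^sup>2) = 1" "(\<Sum>j\<in>UNIV. (cmod (U $ j $ i))\<^sup>2) = 1"
    by (simp_all only: of_real_eq_1_iff)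
qed

lemma continuous_on_matrix_mult [continuous_intros]:
  fixes f g :: "'b::topological_space \<Rightarrow> complex^'n^'n"
  assumes "continuous_on S f" "continuous_on S g"
  shows "continuous_on S (\<lambda>x. f x ** g x)"
  unfolding matrix_matrix_mult_def by (intro continuous_intros assms)

lemma continuous_on_conj_transpose [continuous_intros]:
  fixes f :: "'b::topological_space \<Rightarrow> complex^'n^'n"
  assumes "continuous_on S f"
  shows "continuous_on S (\<lambda>x. conj_transpose (f x))"
proof -
  have "conj_transpose (f x) = (\<chi> i j. cnj (f x $ j $ i))" for x by (simp add: vec_eq_iff)
  then show ?thesis by (simp only:) (intro continuous_intros assms)
qed

lemma continuous_on_pminor [continuous_intros]:
  fixes f :: "'b::topological_space \<Rightarrow> complex^'n^'n"
  assumes "continuous_on S f"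
  shows "continuous_on S (\<lambda>x. pminor I (f x))"
proof -
  have "continuous_on S (\<lambda>x. if i \<in> I then f x $ i $ j else if i = j then 1 else 0)" for i j
    by (cases "i \<in> I") (auto intro!: continuous_intros assms)
  then show ?thesis unfolding pminor_def det_def by (auto intro!: continuous_intros)
qed

lemma continuous_on_esym_mat [continuous_intros]:
  fixes f :: "'b::topological_space \<Rightarrow> complex^'n^'n"
  assumes "continuous_on S f"
  shows "continuous_on S (\<lambda>x. esym_mat k (f x))"
  unfolding esym_mat_def by (intro continuous_intros assms)

lemma compact_unitary: "compact {U :: complex^'n^'n. unitary U}"
proof (rule compact_eq_bounded_closed[THEN iffD2], intro conjI)
  show "bounded {U :: complex^'n^'n. unitary U}"
  proof (rule boundedI)
    fix U :: "complex^'n^'n" assume "U \<in> {U. unitary U}"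
    then have "norm (U $ i) = 1" for i
      using unitary_row_norm(1)[of U i] by (simp add: norm_vec_def L2_set_def)
    then show "norm U \<le> real (CARD('n))"
      using L2_set_le_sum[of UNIV "\<lambda>i. norm (U $ i)"] by (simp add: norm_vec_def[of U])
  qed
  have "closed {U :: complex^'n^'n. U ** conj_transpose U = mat 1 \<and> conj_transpose U ** U = mat 1}"
    by (intro closed_Collect_conj closed_Collect_eq continuous_intros)
  then show "closed {U :: complex^'n^'n. unitary U}" by (simp add: unitary_def)
qed

lemma haarD:
  assumes "haar_unitary \<mu>"
  shows "prob_space \<mu>" "sets \<mu> = sets borel" "space \<mu> = UNIV" "AE X in \<mu>. unitary X"
  using assms sets_eq_imp_space_eq[of \<mu> borel] by (auto simp: haar_unitary_def)

text \<open>A continuous function is bounded on the compact unitary group, which carries the whole measure.\<close>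

lemma haar_integrable:
  fixes F :: "complex^'n^'n \<Rightarrow> 'b::{banach, second_countable_topology}"
  assumes h: "haar_unitary \<mu>" and F: "continuous_on UNIV F"
  shows "integrable \<mu> F"
proof -
  interpret prob_space \<mu> using haarD(1)[OF h] .
  have "compact (F ` {U. unitary U})" by (intro compact_continuous_image compact_unitary continuous_on_subset[OF F]) auto
  then obtain B where B: "\<And>U. unitary U \<Longrightarrow> norm (F U) \<le> B"
    using compact_imp_bounded by (force simp: bounded_iff)
  show ?thesis
  proof (rule integrable_const_bound)
    show "AE x in \<mu>. norm (F x) \<le> B" using haarD(4)[OF h] by eventually_elim (rule B)
    show "F \<in> borel_measurable \<mu>"
      using borel_measurable_continuous_onI[OF F] haarD(2)[OF h] by (simp cong: measurable_cong_sets)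
  qed
qed

text \<open>Measurability comes from continuity, so integrands only have to agree on unitary matrices.\<close>

lemma haar_cong:
  fixes F G :: "complex^'n^'n \<Rightarrow> 'b::{banach, second_countable_topology}"
  assumes h: "haar_unitary \<mu>" and "continuous_on UNIV F" "continuous_on UNIV G"
    and FG: "\<And>U. unitary U \<Longrightarrow> F U = G U"
  shows "(\<integral>U. F U \<partial>\<mu>) = (\<integral>U. G U \<partial>\<mu>)"
proof (rule integral_cong_AE)
  show "F \<in> borel_measurable \<mu>" "G \<in> borel_measurable \<mu>" 
    using haar_integrable[OF h] assms by (auto dest: borel_measurable_integrable)
  show "AE U in \<mu>. F U = G U" using haarD(4)[OF h] by eventually_elim (rule FG)
qed

lemma haar_translate:
  fixes F :: "complex^'n^'n \<Rightarrow> 'b::{banach, second_countable_topology}"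
  assumes h: "haar_unitary \<mu>" and F: "continuous_on UNIV F" and V: "unitary V"
  shows "(\<integral>U. F (V ** U) \<partial>\<mu>) = (\<integral>U. F U \<partial>\<mu>)"
proof -
  have inv: "distr \<mu> borel (\<lambda>X. V ** X) = \<mu>" using h V by (auto simp: haar_unitary_def)
  have "continuous_on UNIV (\<lambda>X :: complex^'n^'n. V ** X)"
    using continuous_on_matrix_mult[OF continuous_on_const[of UNIV V] continuous_on_id[of UNIV]] by simp
  then have "(\<lambda>X :: complex^'n^'n. V ** X) \<in> borel_measurable borel"
    by (rule borel_measurable_continuous_onI)
  then have m: "(\<lambda>X :: complex^'n^'n. V ** X) \<in> measurable \<mu> borel" using haarD(2)[OF h] by (simp cong: measurable_cong_sets)
  have "(\<integral>U. F U \<partial>distr \<mu> borel (\<lambda>X. V ** X)) = (\<integral>U. F (V ** U) \<partial>\<mu>)"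
    by (rule integral_distr[OF m borel_measurable_continuous_onI[OF F]])
  then show ?thesis unfolding inv by simp
qed

lemma haar_Fubini:
  fixes F :: "complex^'n^'n \<Rightarrow> complex^'n^'n \<Rightarrow> complex"
  assumes h: "haar_unitary \<mu>" and F: "continuous_on UNIV (\<lambda>(X, Y). F X Y)"
  shows "(\<integral>Y. \<integral>X. F X Y \<partial>\<mu> \<partial>\<mu>) = (\<integral>X. \<integral>Y. F X Y \<partial>\<mu> \<partial>\<mu>)"
proof -
  interpret p: prob_space \<mu> using haarD(1)[OF h] .
  interpret pp: pair_prob_space \<mu> \<mu> ..
  let ?K = "{U :: complex^'n^'n. unitary U}"
  have c: "compact (?K \<times> ?K)" by (intro compact_Times compact_unitary)
  have "compact ((\<lambda>(X, Y). F X Y) ` (?K \<times> ?K))"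
    by (intro compact_continuous_image c continuous_on_subset[OF F]) auto
  then obtain B where B: "\<And>U V. unitary U \<Longrightarrow> unitary V \<Longrightarrow> norm (F U V) \<le> B"
    using compact_imp_bounded by (force simp: bounded_iff)
  have s: "sets (\<mu> \<Otimes>\<^sub>M \<mu>) = sets (borel :: ((complex^'n^'n) \<times> (complex^'n^'n)) measure)"
    using sets_pair_measure_cong[OF haarD(2)[OF h] haarD(2)[OF h]] unfolding borel_prod .
  have "integrable (\<mu> \<Otimes>\<^sub>M \<mu>) (\<lambda>(X, Y). F X Y)"
  proof (rule pp.integrable_const_bound)
    have "?K \<times> ?K \<in> sets borel" using compact_imp_closed[OF c] by simp
    have "{z \<in> space (\<mu> \<Otimes>\<^sub>M \<mu>). unitary (fst z) \<and> unitary (snd z)} \<in> sets (\<mu> \<Otimes>\<^sub>M \<mu>)"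
    proof -
      have "{z \<in> space (\<mu> \<Otimes>\<^sub>M \<mu>). unitary (fst z) \<and> unitary (snd z)} = ?K \<times> ?K"
        using sets_eq_imp_space_eq[OF s] by auto
      then show ?thesis using \<open>?K \<times> ?K \<in> sets borel\<close> s by simp
    qed
    then have "AE z in \<mu> \<Otimes>\<^sub>M \<mu>. unitary (fst z) \<and> unitary (snd z)"
      by (rule pp.AE_pair_measure) (use haarD(4)[OF h] in \<open>auto elim!: eventually_mono\<close>)
    then show "AE z in \<mu> \<Otimes>\<^sub>M \<mu>. norm (case z of (X, Y) \<Rightarrow> F X Y) \<le> B"
      by eventually_elim (auto intro: B)
    show "(\<lambda>(X, Y). F X Y) \<in> borel_measurable (\<mu> \<Otimes>\<^sub>M \<mu>)"
      using borel_measurable_continuous_onI[OF F] s by (simp cong: measurable_cong_sets)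
  qed
  then show ?thesis by (rule pp.Fubini_integral)
qed

section \<open>Diagonalization of Hermitian matrices\<close>

text \<open>The Hermitian inner product.  Its real part is the inner product of the underlying real Euclidean
  space, so that compactness and dimension arguments for real subspaces apply.\<close>

definition cdot :: "complex^'n \<Rightarrow> complex^'n \<Rightarrow> complex" where
  "cdot x y = (\<Sum>i\<in>UNIV. cnj (x $ i) * y $ i)"

lemma Re_cdot: "Re (cdot x y) = x \<bullet> y"
  by (simp add: cdot_def inner_vec_def inner_complex_def)

lemma cdot_cnj: "cnj (cdot x y) = cdot y x"
  by (simp add: cdot_def mult.commute)

lemma cdot_self: "cdot x x = of_real ((norm x)\<^sup>2)"
  by (simp add: cdot_def norm_vec_def L2_set_def real_sqrt_pow2 sum_nonneg mult_cnj_cmod)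

lemma cdot_hermitian:
  assumes "hermitian H"
  shows "cdot (H *v x) y = cdot x (H *v y)"
proof -
  have H: "cnj (H $ i $ j) = H $ j $ i" for i j
    using assms unfolding hermitian_def by (metis conj_transpose_nth)
  have "cdot (H *v x) y = (\<Sum>i\<in>UNIV. \<Sum>j\<in>UNIV. cnj (x $ j) * H $ j $ i * y $ i)"
    by (simp add: cdot_def matrix_vector_mult_def H sum_distrib_right sum_distrib_left mult_ac)
  also have "\<dots> = (\<Sum>j\<in>UNIV. \<Sum>i\<in>UNIV. cnj (x $ j) * H $ j $ i * y $ i)" by (rule sum.swap)
  also have "\<dots> = cdot x (H *v y)"
    by (simp add: cdot_def matrix_vector_mult_def sum_distrib_left mult_ac)
  finally show ?thesis .
qed

lemma cdot_simps: "cdot x (y + z) = cdot x y + cdot x z" "cdot x (y - z) = cdot x y - cdot x z"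
  "cdot x (r *\<^sub>R y) = of_real r * cdot x y" "cdot (r *\<^sub>R x) y = of_real r * cdot x y" "cdot x (c *s y) = c * cdot x y"
  by (simp_all add: cdot_def distrib_left right_diff_distrib sum.distrib sum_subtractf sum_distrib_left mult_ac)
     (simp_all add: scaleR_conv_of_real mult_ac)

lemma matrix_vector_mult_scaleR_complex: "H *v (r *\<^sub>R y) = r *\<^sub>R (H *v y)" for H :: "complex^'n^'m"
  by (simp add: matrix_vector_mult_def vec_eq_iff scaleR_sum_right)

lemma quadratic_nonneg_imp_zero:
  fixes a b :: real
  assumes "\<And>t. 0 \<le> a * t + b * t\<^sup>2"
  shows "a = 0"
proof (rule ccontr)
  assume a: "a \<noteq> 0"
  have b: "b \<ge> 0" using assms[of 1] assms[of "-1"] by simp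
  define t where "t = - a / (b + 1)"
  have t: "(b + 1) * t = - a" using b by (simp add: t_def)
  have "(b + 1)\<^sup>2 * (a * t + b * t\<^sup>2) = (b + 1) * a * ((b + 1) * t) + b * ((b + 1) * t)\<^sup>2"
    by (simp add: algebra_simps power2_eq_square)
  also have "\<dots> = - (a\<^sup>2)" unfolding t by (simp add: algebra_simps power2_eq_square)
  also have "\<dots> < 0" using a by simp
  finally show False using assms[of t] by (simp add: mult_less_0_iff)
qed

text \<open>A maximizer of the Rayleigh quotient on the orthogonal complement \<open>S\<close> of the given eigenvectors is
  an eigenvector: since \<open>S\<close> is invariant, the first variation lies in \<open>S\<close> and is orthogonal to \<open>S\<close>.\<close>

lemma hermitian_eigenvector_in_complement:
  fixes H :: "complex^'n^'n"
  assumes H: "hermitian H" and F: "F \<noteq> (UNIV :: 'n set)"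
    and f: "\<And>i. i \<in> F \<Longrightarrow> H *v f i = l i *\<^sub>R f i"
  obtains x m where "norm x = 1" "\<And>i. i \<in> F \<Longrightarrow> cdot (f i) x = 0" "H *v x = m *\<^sub>R x"
proof -
  define S where "S = {x. \<forall>i\<in>F. cdot (f i) x = 0}"
  \<comment> \<open>Complex orthogonality to \<open>f i\<close> is real orthogonality to \<open>f i\<close> and to \<open>\<i> *s f i\<close>.\<close>
  define T where "T = f ` F \<union> (\<lambda>i. \<i> *s f i) ` F"
  have finF: "finite F" by simp
  have inv: "H *v x \<in> S" if "x \<in> S" for x
    using that f cdot_hermitian[OF H, symmetric] by (auto simp: S_def cdot_simps)
  have lin: "x + y \<in> S" "r *\<^sub>R x \<in> S" "x - y \<in> S" if "x \<in> S" "y \<in> S" for x y r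
    using that by (auto simp: S_def cdot_simps)
  have "card T \<le> card F + card F"
    unfolding T_def by (intro order_trans[OF card_Un_le] add_mono card_image_le finF)
  also have "\<dots> < DIM(complex^'n)" using psubset_card_mono[of UNIV F] F by (simp add: psubset_eq)
  finally have "dim T < DIM(complex^'n)" using dim_le_card[of T T] finF by (auto simp: T_def span_superset)
  then obtain x0 where x0: "x0 \<noteq> 0" "\<And>y. y \<in> span T \<Longrightarrow> orthogonal x0 y"
    by (rule orthogonal_to_subspace_exists[of T]) blast
  have "x0 \<in> S" unfolding S_def
  proof (intro CollectI ballI)
    fix i assume i: "i \<in> F"
    have "f i \<in> span T" "\<i> *s f i \<in> span T" using i by (auto simp: T_def intro!: span_base)
    then have "Re (cdot x0 (f i)) = 0" "Re (cdot x0 (\<i> *s f i)) = 0"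
      using x0(2) by (auto simp: Re_cdot orthogonal_def)
    then have "cdot x0 (f i) = 0" by (simp add: cdot_simps complex_eq_iff)
    then show "cdot (f i) x0 = 0" using cdot_cnj[of x0 "f i"] by simp
  qed
  define K where "K = S \<inter> sphere 0 1"
  have "S = (\<Inter>i\<in>F. {x. cdot (f i) x = 0})" by (auto simp: S_def)
  moreover have "closed {x. cdot (f i) x = 0}" for i
    unfolding cdot_def by (intro closed_Collect_eq continuous_intros)
  ultimately have "closed S" by (simp add: closed_INT)
  then have "compact K" unfolding K_def by (simp add: closed_Int_compact)
  moreover have "(1 / norm x0) *\<^sub>R x0 \<in> K" using x0(1) lin(2)[OF \<open>x0 \<in> S\<close> \<open>x0 \<in> S\<close>] by (simp add: K_def)
  moreover have "continuous_on K (\<lambda>x. x \<bullet> (H *v x))"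
    unfolding matrix_vector_mult_def by (intro continuous_intros)
  ultimately have "\<exists>x\<in>K. \<forall>y\<in>K. y \<bullet> (H *v y) \<le> x \<bullet> (H *v x)"
    by (intro continuous_attains_sup) auto
  then obtain x where x: "x \<in> K" "\<And>y. y \<in> K \<Longrightarrow> y \<bullet> (H *v y) \<le> x \<bullet> (H *v x)"
    by blast
  define m where "m = x \<bullet> (H *v x)"
  have xS: "x \<in> S" and nx: "norm x = 1" using x(1) by (auto simp: K_def)
  have max: "y \<bullet> (H *v y) \<le> m * (y \<bullet> y)" if "y \<in> S" for y
  proof (cases "y = 0")
    case False
    have "(1 / norm y) *\<^sub>R y \<in> K" using False lin(2)[OF that that] by (simp add: K_def)
    from x(2)[OF this] have "(y \<bullet> (H *v y)) / (norm y * norm y) \<le> m"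
      by (simp add: m_def matrix_vector_mult_scaleR_complex)
    then show ?thesis using False by (simp add: field_simps dot_square_norm power2_eq_square)
  qed (simp add: matrix_vector_mult_0_right)
  have sym: "(H *v y) \<bullet> z = y \<bullet> (H *v z)" for y z
    using cdot_hermitian[OF H, of y z] by (simp flip: Re_cdot)
  have orth: "(m *\<^sub>R x - H *v x) \<bullet> y = 0" if y: "y \<in> S" for y
  proof -
    have "0 \<le> (2 * ((m *\<^sub>R x - H *v x) \<bullet> y)) * t + (m * (y \<bullet> y) - y \<bullet> (H *v y)) * t\<^sup>2" for t
    proof -
      have "(x + t *\<^sub>R y) \<bullet> (H *v (x + t *\<^sub>R y)) \<le> m * ((x + t *\<^sub>R y) \<bullet> (x + t *\<^sub>R y))"
        by (intro max lin(1)[OF xS lin(2)[OF y y]])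
      moreover have "x \<bullet> x = 1" using nx by (simp add: dot_square_norm)
      moreover have "y \<bullet> (H *v x) = (H *v x) \<bullet> y" by (rule inner_commute)
      moreover have "x \<bullet> (H *v y) = (H *v x) \<bullet> y" by (simp add: sym)
      ultimately show ?thesis
        by (simp add: matrix_vector_right_distrib matrix_vector_mult_scaleR_complex inner_add_left inner_add_right inner_diff_left
            m_def[symmetric] algebra_simps power2_eq_square inner_commute[of y x])
    qed
    from quadratic_nonneg_imp_zero[OF this] show ?thesis by simp
  qed
  have "m *\<^sub>R x - H *v x \<in> S" by (intro lin(3)[OF lin(2)[OF xS xS] inv[OF xS]])
  from orth[OF this] have "H *v x = m *\<^sub>R x" by simp
  then show thesis using that[OF nx _] xS by (auto simp: S_def)
qed

theorem hermitian_diagonalizable: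
  fixes H :: "complex^'n^'n"
  assumes H: "hermitian H"
  obtains Q h where "unitary Q" "H = Q ** diagm (\<lambda>i. complex_of_real (h i)) ** conj_transpose Q"
proof -
  have "\<exists>f l. (\<forall>i\<in>F. H *v f i = l i *\<^sub>R f i \<and> norm (f i) = 1) \<and> (\<forall>i\<in>F. \<forall>j\<in>F. i \<noteq> j \<longrightarrow> cdot (f i) (f j) = 0)"
    for F :: "'n set"
    using finite[of F]
  proof (induction F rule: finite_induct)
    case (insert k F)
    from insert.IH obtain f :: "'n \<Rightarrow> complex^'n" and l where f: "\<forall>i\<in>F. H *v f i = l i *\<^sub>R f i \<and> norm (f i) = 1"
      "\<forall>i\<in>F. \<forall>j\<in>F. i \<noteq> j \<longrightarrow> cdot (f i) (f j) = 0" by (elim exE conjE)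
    have "F \<noteq> UNIV" using insert by auto
    then obtain x m where x: "norm x = 1" "\<And>i. i \<in> F \<Longrightarrow> cdot (f i) x = 0" "H *v x = m *\<^sub>R x"
      by (rule hermitian_eigenvector_in_complement[OF H, of F f l]) (use f(1) in blast)+
    have x': "cdot x (f i) = 0" if "i \<in> F" for i using x(2)[OF that] cdot_cnj[of "f i" x] by simp
    show ?case
    proof (rule exI[of _ "f(k := x)"], rule exI[of _ "l(k := m)"], intro conjI ballI impI)
      fix i assume "i \<in> insert k F"
      then show "H *v (f(k := x)) i = (l(k := m)) i *\<^sub>R (f(k := x)) i" "norm ((f(k := x)) i) = 1"
        using f(1) x(1,3) by (cases "i = k"; simp)+
    next
      fix i j assume "i \<in> insert k F" "j \<in> insert k F" "i \<noteq> j"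
      then show "cdot ((f(k := x)) i) ((f(k := x)) j) = 0"
        using f(2) x(2) x' by (cases "i = k"; cases "j = k"; simp)
    qed
  qed simp
  from this[of UNIV] obtain f :: "'n \<Rightarrow> complex^'n" and l
    where fl: "\<forall>i\<in>UNIV. H *v f i = l i *\<^sub>R f i \<and> norm (f i) = 1"
      "\<forall>i\<in>UNIV. \<forall>j\<in>UNIV. i \<noteq> j \<longrightarrow> cdot (f i) (f j) = 0" by (elim exE conjE)
  then have f: "H *v f i = l i *\<^sub>R f i" "norm (f i) = 1" "i \<noteq> j \<Longrightarrow> cdot (f i) (f j) = 0" for i j
    by blast+
  define Q :: "complex^'n^'n" where "Q = (\<chi> r c. f c $ r)"
  have "conj_transpose Q ** Q = mat 1"
  proof -
    have "(conj_transpose Q ** Q) $ i $ j = cdot (f i) (f j)" for i j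
      by (simp add: matrix_mult_nth Q_def cdot_def)
    then show ?thesis using f(2,3) by (auto simp: vec_eq_iff mat_def cdot_self)
  qed
  then have Q: "unitary Q" by (simp add: unitary_def matrix_left_right_inverse)
  have "H ** Q = Q ** diagm (\<lambda>i. complex_of_real (l i))"
  proof -
    have "(H ** Q) $ r $ c = (H *v f c) $ r" for r c
      by (simp add: matrix_mult_nth Q_def matrix_vector_mult_def)
    moreover have "(Q ** diagm (\<lambda>i. complex_of_real (l i))) $ r $ c = f c $ r * of_real (l c)" for r c
      by (simp add: matrix_mult_nth Q_def diagm_def if_distrib[of "\<lambda>x. _ * x"] cong: if_cong)
    moreover have "(H *v f c) $ r = f c $ r * of_real (l c)" for r c
      unfolding f(1) vector_scaleR_component by (simp add: scaleR_conv_of_real[of "l c" "f c $ r"] mult.commute)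
    ultimately show ?thesis by (simp add: vec_eq_iff)
  qed
  then have "H ** Q ** conj_transpose Q = Q ** diagm (\<lambda>i. complex_of_real (l i)) ** conj_transpose Q" by simp
  then have "H = Q ** diagm (\<lambda>i. complex_of_real (l i)) ** conj_transpose Q"
    using Q by (simp add: unitary_def flip: matrix_mul_assoc)
  with Q show thesis by (rule that)
qed

section \<open>Moments of a Haar column\<close>

definition perm_matrix :: "('n \<Rightarrow> 'n) \<Rightarrow> complex^'n^'n" where
  "perm_matrix p = (\<chi> i j. if j = p i then 1 else 0)"

lemma perm_matrix_mult_nth: "(perm_matrix p ** U) $ i $ j = U $ p i $ j"
  by (simp add: matrix_mult_nth perm_matrix_def if_distrib[of "\<lambda>x. x * _"] cong: if_cong)

lemma unitary_perm_matrix: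
  assumes "p permutes (UNIV :: 'n set)"
  shows "unitary (perm_matrix p :: complex^'n^'n)"
proof (rule unitaryI)
  have "inj p" using assms by (rule permutes_inj)
  then show "perm_matrix p ** conj_transpose (perm_matrix p) = (mat 1 :: complex^'n^'n)"
    unfolding vec_eq_iff perm_matrix_mult_nth by (auto simp: perm_matrix_def mat_def inj_eq)
qed

text \<open>A Hadamard matrix on the coordinates \<open>i\<close> and \<open>j\<close>, after a phase \<open>z\<close> on the second one.\<close>

definition rotation :: "'n \<Rightarrow> 'n \<Rightarrow> complex \<Rightarrow> complex^'n^'n" where
  "rotation i j z = (\<chi> r c.
     if r = i then (if c = i then 1 / complex_of_real (sqrt 2) else if c = j then z / complex_of_real (sqrt 2) else 0)
     else if r = j then (if c = i then 1 / complex_of_real (sqrt 2) else if c = j then - z / complex_of_real (sqrt 2) else 0)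
     else if r = c then 1 else 0)"

lemma sum_two_points:
  fixes f :: "'n::finite \<Rightarrow> complex"
  assumes "i \<noteq> j" "\<And>k. k \<noteq> i \<Longrightarrow> k \<noteq> j \<Longrightarrow> f k = 0"
  shows "(\<Sum>k\<in>UNIV. f k) = f i + f j"
proof -
  have "(\<Sum>k\<in>UNIV. f k) = (\<Sum>k\<in>{i, j}. f k)"
    by (rule sum.mono_neutral_right) (use assms in auto)
  then show ?thesis using assms(1) by simp
qed

lemma sum_one_point:
  fixes f :: "'n::finite \<Rightarrow> complex"
  assumes "\<And>k. k \<noteq> i \<Longrightarrow> f k = 0"
  shows "(\<Sum>k\<in>UNIV. f k) = f i"
proof -
  have "(\<Sum>k\<in>UNIV. f k) = (\<Sum>k\<in>{i}. f k)"
    by (rule sum.mono_neutral_right) (use assms in auto)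
  then show ?thesis by simp
qed

lemma unitary_rotation:
  fixes i j :: "'n::finite"
  assumes ij: "i \<noteq> j" and z: "cmod z = 1"
  shows "unitary (rotation i j z)"
proof (rule unitaryI)
  let ?R = "rotation i j z"
  have zz: "z * cnj z = 1" using z by (simp add: mult_cnj_cmod)
  have s2: "complex_of_real (sqrt 2) * complex_of_real (sqrt 2) = 2" by (simp flip: of_real_mult)
  have hh: "1 / (complex_of_real (sqrt 2) * complex_of_real (sqrt 2)) = 1/2" by (simp add: s2)
  have "(\<Sum>k\<in>UNIV. ?R $ r $ k * cnj (?R $ c $ k)) = (if r = c then 1 else 0)" for r c
  proof (cases "r = i \<or> r = j")
    case True
    then have "(\<Sum>k\<in>UNIV. ?R $ r $ k * cnj (?R $ c $ k)) = ?R $ r $ i * cnj (?R $ c $ i) + ?R $ r $ j * cnj (?R $ c $ j)"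
      by (intro sum_two_points ij) (auto simp: rotation_def)
    also have "\<dots> = (if r = c then 1 else 0)"
      using True ij zz s2 by (auto simp: rotation_def field_simps)
    finally show ?thesis .
  next
    case False
    then have "(\<Sum>k\<in>UNIV. ?R $ r $ k * cnj (?R $ c $ k)) = ?R $ r $ r * cnj (?R $ c $ r)"
      by (intro sum_one_point) (auto simp: rotation_def)
    also have "\<dots> = (if r = c then 1 else 0)" using False by (auto simp: rotation_def)
    finally show ?thesis .
  qed
  then show "?R ** conj_transpose ?R = mat 1"
    by (simp add: vec_eq_iff matrix_mult_nth mat_def)
qed

lemma rotation_mult_nth:
  fixes i j :: "'n::finite"
  assumes ij: "i \<noteq> j"
  shows "(rotation i j z ** U) $ i $ c = (U $ i $ c + z * U $ j $ c) / complex_of_real (sqrt 2)"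
proof -
  have "(rotation i j z ** U) $ i $ c = rotation i j z $ i $ i * U $ i $ c + rotation i j z $ i $ j * U $ j $ c"
    unfolding matrix_mult_nth by (intro sum_two_points ij) (auto simp: rotation_def)
  then show ?thesis using ij by (simp add: rotation_def add_divide_distrib)
qed

text \<open>Averaging over the four phases removes all mixed terms except the product of the squares.\<close>

lemma sum_fourth_roots:
  fixes x y :: complex
  shows "cmod (x + y) ^ 4 + cmod (x + \<i> * y) ^ 4 + cmod (x + (-1) * y) ^ 4 + cmod (x + (-\<i>) * y) ^ 4
    = 4 * (cmod x ^ 4 + cmod y ^ 4 + 4 * (cmod x)\<^sup>2 * (cmod y)\<^sup>2)"
proof -
  have *: "cmod w ^ 4 = ((Re w)\<^sup>2 + (Im w)\<^sup>2)\<^sup>2" for w :: complex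
    by (metis cmod_power2 power2_eq_square power4_eq_xxxx mult.assoc)
  show ?thesis unfolding * cmod_power2 by simp algebra
qed

definition col_sq :: "'n \<Rightarrow> complex^'n^'n \<Rightarrow> 'n \<Rightarrow> real" where
  "col_sq c U i = (cmod (U $ i $ c))\<^sup>2"

lemma continuous_on_col_sq [continuous_intros]: "continuous_on S (\<lambda>U. col_sq c U i)"
  unfolding col_sq_def by (intro continuous_intros)

text \<open>Permutations show that the moments depend only on whether \<open>i = j\<close>, rotations with four phases that
  the diagonal moment is twice the other one, and the column having norm one fixes the scale.\<close>

lemma col_sq_moments:
  fixes \<mu> :: "(complex^'n^'n) measure"
  assumes h: "haar_unitary \<mu>"
  defines "d \<equiv> real CARD('n)"
  shows "(\<integral>U. col_sq c U i \<partial>\<mu>) = 1 / d"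
    and "(\<integral>U. col_sq c U i * col_sq c U j \<partial>\<mu>) = (if i = j then 2 else 1) / (d * (d + 1))"
proof -
  interpret prob_space \<mu> using haarD(1)[OF h] .
  define m2 where "m2 i j = (\<integral>U. col_sq c U i * col_sq c U j \<partial>\<mu>)" for i j
  have perm: "m2 (p i) (p j) = m2 i j" if "p permutes UNIV" for p i j
  proof -
    have "(\<integral>U. col_sq c (perm_matrix p ** U) i * col_sq c (perm_matrix p ** U) j \<partial>\<mu>) = m2 i j"
      unfolding m2_def by (rule haar_translate[OF h _ unitary_perm_matrix[OF that]]) (intro continuous_intros)
    then show ?thesis by (simp add: m2_def col_sq_def perm_matrix_mult_nth)
  qed
  define \<alpha> where "\<alpha> = m2 c c"
  have diag: "m2 i i = \<alpha>" for i
    using perm[of "Transposition.transpose c i" c c] by (simp add: \<alpha>_def permutes_swap_id)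
  have int: "integrable \<mu> (\<lambda>U. col_sq c U i * col_sq c U j)" for i j
    by (intro haar_integrable[OF h] continuous_intros)
  have off: "m2 i j = \<alpha> / 2" if ij: "i \<noteq> j" for i j
  proof -
    define G where "G z U = (cmod (U $ i $ c + z * U $ j $ c)) ^ 4" for z and U :: "complex^'n^'n"
    have intG: "integrable \<mu> (G z)" for z
      unfolding G_def by (intro haar_integrable[OF h] continuous_intros)
    have eG: "(\<integral>U. G z U \<partial>\<mu>) = 4 * \<alpha>" if z: "cmod z = 1" for z
    proof -
      have "(\<integral>U. col_sq c (rotation i j z ** U) i * col_sq c (rotation i j z ** U) i \<partial>\<mu>) = m2 i i"
        unfolding m2_def by (rule haar_translate[OF h _ unitary_rotation[OF ij z]]) (intro continuous_intros)
      moreover have "col_sq c (rotation i j z ** U) i * col_sq c (rotation i j z ** U) i = G z U / 4" for U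
        by (simp add: col_sq_def rotation_mult_nth[OF ij] G_def norm_divide power_divide power4_eq_xxxx power2_eq_square)
      ultimately show ?thesis using diag by simp
    qed
    have "(\<integral>U. G 1 U + G \<i> U + G (-1) U + G (-\<i>) U \<partial>\<mu>) = 16 * \<alpha>"
      using intG eG[of 1] eG[of "\<i>"] eG[of "-1"] eG[of "-\<i>"] by simp
    also have "(\<lambda>U. G 1 U + G \<i> U + G (-1) U + G (-\<i>) U) =
        (\<lambda>U. 4 * (col_sq c U i * col_sq c U i + col_sq c U j * col_sq c U j + 4 * (col_sq c U i * col_sq c U j)))"
    proof
      fix U
      show "G 1 U + G \<i> U + G (-1) U + G (-\<i>) U =
        4 * (col_sq c U i * col_sq c U i + col_sq c U j * col_sq c U j + 4 * (col_sq c U i * col_sq c U j))"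
        using sum_fourth_roots[of "U $ i $ c" "U $ j $ c"]
        by (simp add: G_def col_sq_def power4_eq_xxxx power2_eq_square mult.assoc)
    qed
    also have "(\<integral>U. 4 * (col_sq c U i * col_sq c U i + col_sq c U j * col_sq c U j + 4 * (col_sq c U i * col_sq c U j)) \<partial>\<mu>)
       = 4 * (m2 i i + m2 j j + 4 * m2 i j)"
      using int by (simp add: m2_def)
    finally show ?thesis using diag by simp
  qed
  have one: "(\<integral>U. (\<Sum>j\<in>UNIV. F U * col_sq c U j) \<partial>\<mu>) = (\<integral>U. F U \<partial>\<mu>)"
    if "continuous_on UNIV F" for F :: "complex^'n^'n \<Rightarrow> real"
  proof (rule haar_cong[OF h _ that])
    show "continuous_on UNIV (\<lambda>U. \<Sum>j\<in>UNIV. F U * col_sq c U j)" by (intro continuous_intros that)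
    fix U :: "complex^'n^'n" assume "unitary U"
    then show "(\<Sum>j\<in>UNIV. F U * col_sq c U j) = F U"
      using unitary_row_norm(2)[of U c] by (simp add: col_sq_def flip: sum_distrib_left)
  qed
  have first: "(\<integral>U. col_sq c U i \<partial>\<mu>) = (d + 1) * \<alpha> / 2" for i
  proof -
    have "(\<integral>U. col_sq c U i \<partial>\<mu>) = (\<integral>U. (\<Sum>j\<in>UNIV. col_sq c U i * col_sq c U j) \<partial>\<mu>)"
      by (rule one[symmetric]) (intro continuous_intros)
    also have "\<dots> = (\<Sum>j\<in>UNIV. m2 i j)" unfolding m2_def by (rule Bochner_Integration.integral_sum) (rule int)
    also have "\<dots> = m2 i i + (\<Sum>j\<in>UNIV - {i}. m2 i j)" by (rule sum.remove) auto
    also have "(\<Sum>j\<in>UNIV - {i}. m2 i j) = (\<Sum>j\<in>UNIV - {i}. \<alpha> / 2)" by (rule sum.cong) (use off in \<open>auto simp: eq_commute[of i]\<close>)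
    also have "\<dots> = (d - 1) * (\<alpha> / 2)" by (simp add: card_Diff_singleton d_def of_nat_diff)
    finally show ?thesis unfolding diag by (simp add: field_simps)
  qed
  have d0: "d > 0" by (simp add: d_def)
  have "1 = (\<integral>U. (\<Sum>j\<in>UNIV. 1 * col_sq c U j) \<partial>\<mu>)" by (subst one) (auto simp: prob_space)
  also have "\<dots> = (\<Sum>j\<in>UNIV. (\<integral>U. col_sq c U j \<partial>\<mu>))"
    unfolding mult_1 by (intro Bochner_Integration.integral_sum haar_integrable[OF h] continuous_intros)
  also have "\<dots> = d * ((d + 1) * \<alpha> / 2)" by (simp add: first d_def)
  finally have "\<alpha> * (d * (d + 1)) = 2" by (simp add: algebra_simps)
  moreover have nz: "d * (d + 1) \<noteq> 0" using d0 by auto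
  ultimately have \<alpha>: "\<alpha> = 2 / (d * (d + 1))" by (simp only: nonzero_eq_divide_eq[OF nz])
  show "(\<integral>U. col_sq c U i \<partial>\<mu>) = 1 / d" using d0 nz unfolding first \<alpha> by (simp add: divide_simps)
  show "(\<integral>U. col_sq c U i * col_sq c U j \<partial>\<mu>) = (if i = j then 2 else 1) / (d * (d + 1))"
    using diag[of i] off[of i j] \<alpha> by (auto simp: m2_def)
qed

section \<open>The averaging operator of the probe matrix\<close>

text \<open>The Schur function of the shape with two columns of lengths \<open>p\<close> and \<open>q\<close>, in the form of the dual
  Jacobi--Trudi determinant.\<close>

definition schur2 :: "nat \<Rightarrow> nat \<Rightarrow> ('n::finite \<Rightarrow> complex) \<Rightarrow> complex" where
  "schur2 p q a = elem_sym p a * elem_sym q a - (if q = 0 then 0 else elem_sym (Suc p) a * elem_sym (q - 1) a)"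

definition schur2_mat :: "nat \<Rightarrow> nat \<Rightarrow> complex^'n^'n \<Rightarrow> complex" where
  "schur2_mat p q W = esym_mat p W * esym_mat q W - (if q = 0 then 0 else esym_mat (Suc p) W * esym_mat (q - 1) W)"

lemma schur2_mat_diagm [simp]: "schur2_mat p q (diagm a) = schur2 p q a"
  by (simp add: schur2_mat_def schur2_def esym_mat_diagm)

lemma schur2_mat_commute: "schur2_mat p q (X ** Y) = schur2_mat p q (Y ** X)" for X Y :: "complex^'n^'n"
  by (simp add: schur2_mat_def esym_mat_commute[of _ X Y])

lemma continuous_on_schur2_mat [continuous_intros]:
  fixes f :: "'b::topological_space \<Rightarrow> complex^'n^'n"
  assumes "continuous_on S f"
  shows "continuous_on S (\<lambda>x. schur2_mat p q (f x))"
  unfolding schur2_mat_def by (cases "q = 0") (auto intro!: continuous_intros assms)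

text \<open>The part of the elementary symmetric function that is divisible by \<open>a i\<close>.\<close>

definition elem_sym_at :: "'n \<Rightarrow> nat \<Rightarrow> ('n::finite \<Rightarrow> complex) \<Rightarrow> complex" where
  "elem_sym_at i p a = (\<Sum>I | card I = p \<and> i \<in> I. \<Prod>j\<in>I. a j)"

lemma elem_sym_at_Suc: "elem_sym_at i (Suc p) a = a i * (elem_sym p a - elem_sym_at i p a)"
proof -
  have "elem_sym p a = elem_sym_at i p a + (\<Sum>I | card I = p \<and> i \<notin> I. \<Prod>j\<in>I. a j)"
  proof -
    have "{I. card I = p} = {I. card I = p \<and> i \<in> I} \<union> {I. card I = p \<and> i \<notin> I}" by auto
    then show ?thesis unfolding elem_sym_def elem_sym_at_def by (simp add: sum.union_disjoint disjoint_iff)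
  qed
  moreover have "elem_sym_at i (Suc p) a = (\<Sum>I | card I = p \<and> i \<notin> I. a i * (\<Prod>j\<in>I. a j))"
    unfolding elem_sym_at_def
  proof (rule sum.reindex_bij_witness[of _ "insert i" "\<lambda>I. I - {i}"])
    fix I assume I: "I \<in> {I. card I = Suc p \<and> i \<in> I}"
    then show "insert i (I - {i}) = I" "I - {i} \<in> {I. card I = p \<and> i \<notin> I}" by auto
    show "a i * (\<Prod>j\<in>I - {i}. a j) = (\<Prod>j\<in>I. a j)" using I by (simp add: prod.remove[of I i])
  qed (auto simp: card_insert_if)
  ultimately show ?thesis by (simp add: sum_distrib_left)
qed

lemma elem_sym_at_0: "elem_sym_at i 0 a = 0"
  by (auto simp: elem_sym_at_def intro!: sum.neutral)

lemma sum_elem_sym_at: "(\<Sum>i\<in>UNIV. elem_sym_at i p a) = of_nat p * elem_sym p a"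
proof -
  have "(\<Sum>i\<in>UNIV. elem_sym_at i p a) = (\<Sum>i\<in>UNIV. \<Sum>I\<in>{I\<in>{I. card I = p}. i \<in> I}. \<Prod>j\<in>I. a j)"
    by (simp add: elem_sym_at_def)
  also have "\<dots> = (\<Sum>I\<in>{I. card I = p}. \<Sum>i\<in>{i\<in>UNIV. i \<in> I}. \<Prod>j\<in>I. a j)"
    by (rule sum.swap_restrict[symmetric]) auto
  also have "\<dots> = of_nat p * elem_sym p a" by (simp add: elem_sym_def sum_distrib_left)
  finally show ?thesis .
qed

definition overlap_sum :: "nat \<Rightarrow> nat \<Rightarrow> ('n::finite \<Rightarrow> complex) \<Rightarrow> complex" where
  "overlap_sum p q a = (\<Sum>I | card I = p. \<Sum>J | card J = q. (\<Prod>i\<in>I. a i) * (\<Prod>j\<in>J. a j) * of_nat (card (I \<inter> J)))"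

lemma overlap_sum_eq: "overlap_sum p q a = (\<Sum>i\<in>UNIV. elem_sym_at i p a * elem_sym_at i q a)"
proof -
  have "overlap_sum p q a = (\<Sum>I | card I = p. \<Sum>J | card J = q. \<Sum>i\<in>UNIV.
      (if i \<in> I then \<Prod>i\<in>I. a i else 0) * (if i \<in> J then \<Prod>j\<in>J. a j else 0))"
    unfolding overlap_sum_def
  proof (intro sum.cong refl)
    fix I J :: "'a set"
    have "(\<Sum>i\<in>UNIV. (if i \<in> I then \<Prod>i\<in>I. a i else 0) * (if i \<in> J then \<Prod>j\<in>J. a j else 0)) =
      (\<Sum>i\<in>UNIV. if i \<in> I \<inter> J then (\<Prod>i\<in>I. a i) * (\<Prod>j\<in>J. a j) else 0)" by (intro sum.cong) auto
    also have "\<dots> = (\<Sum>i\<in>I \<inter> J. (\<Prod>i\<in>I. a i) * (\<Prod>j\<in>J. a j))" by (subst sum.inter_restrict[symmetric]) auto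
    finally show "(\<Prod>i\<in>I. a i) * (\<Prod>j\<in>J. a j) * of_nat (card (I \<inter> J)) =
       (\<Sum>i\<in>UNIV. (if i \<in> I then \<Prod>i\<in>I. a i else 0) * (if i \<in> J then \<Prod>j\<in>J. a j else 0))" by (simp add: mult.commute)
  qed
  also have "\<dots> = (\<Sum>I | card I = p. \<Sum>i\<in>UNIV. \<Sum>J | card J = q.
      (if i \<in> I then \<Prod>i\<in>I. a i else 0) * (if i \<in> J then \<Prod>j\<in>J. a j else 0))"
    by (intro sum.cong refl sum.swap)
  also have "\<dots> = (\<Sum>i\<in>UNIV. \<Sum>I | card I = p. \<Sum>J | card J = q.
      (if i \<in> I then \<Prod>i\<in>I. a i else 0) * (if i \<in> J then \<Prod>j\<in>J. a j else 0))"
    by (rule sum.swap)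
  also have "\<dots> = (\<Sum>i\<in>UNIV. (\<Sum>I | card I = p. if i \<in> I then \<Prod>i\<in>I. a i else 0) * (\<Sum>J | card J = q. if i \<in> J then \<Prod>j\<in>J. a j else 0))"
    by (simp only: sum_product)
  also have "\<dots> = (\<Sum>i\<in>UNIV. elem_sym_at i p a * elem_sym_at i q a)"
  proof -
    have "elem_sym_at i p a = (\<Sum>I | card I = p. if i \<in> I then \<Prod>i\<in>I. a i else 0)" for i p
      unfolding elem_sym_at_def by (rule sum.mono_neutral_cong_left) auto
    then show ?thesis by (simp only:)
  qed
  finally show ?thesis .
qed

text \<open>This makes the Schur functions eigenfunctions below: the recursion for \<open>elem_sym_at\<close> lets all terms
  that are not products of elementary symmetric functions cancel in the difference.\<close>

lemma overlap_sum_diff: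
  assumes "q > 0"
  shows "overlap_sum p q a - overlap_sum (Suc p) (q - 1) a =
    of_nat q * (elem_sym p a * elem_sym q a) - of_nat (Suc p) * (elem_sym (Suc p) a * elem_sym (q - 1) a)"
proof -
  obtain r where r: "q = Suc r" using assms by (cases q) auto
  have "overlap_sum p q a - overlap_sum (Suc p) r a =
     (\<Sum>i\<in>UNIV. elem_sym_at i p a * elem_sym_at i (Suc r) a - elem_sym_at i (Suc p) a * elem_sym_at i r a)"
    by (simp add: overlap_sum_eq r sum_subtractf)
  also have "\<dots> = (\<Sum>i\<in>UNIV. elem_sym p a * elem_sym_at i (Suc r) a - elem_sym r a * elem_sym_at i (Suc p) a)"
    by (intro sum.cong refl) (simp add: elem_sym_at_Suc algebra_simps)
  also have "\<dots> = elem_sym p a * (\<Sum>i\<in>UNIV. elem_sym_at i (Suc r) a) - elem_sym r a * (\<Sum>i\<in>UNIV. elem_sym_at i (Suc p) a)"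
    by (simp add: sum_subtractf sum_distrib_left)
  finally show ?thesis unfolding sum_elem_sym_at by (simp add: r)
qed

text \<open>The identity plus the projection to a coordinate line.  Conjugated by a unitary matrix it becomes a
  rank one update of the identity by a column of this matrix, so averages only involve moments of a
  single column.\<close>

definition probe :: "'n \<Rightarrow> complex^'n^'n" where
  "probe c = diagm (\<lambda>i. if i = c then 2 else 1)"

lemma probe_conj:
  assumes V: "unitary V"
  shows "V ** probe c ** conj_transpose V = (\<chi> i j. (if i = j then 1 else 0) + V $ i $ c * cnj (V $ j $ c))"
proof -
  have "(conj_by V (probe c)) $ i $ j = (\<Sum>k\<in>UNIV. V $ i $ k * cnj (V $ j $ k) + (if k = c then V $ i $ k * cnj (V $ j $ k) else 0))" for i j
    unfolding matrix_mult_nth probe_def diagm_def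
    by (intro sum.cong refl) (simp add: if_distrib[of "\<lambda>x. _ * x"] algebra_simps cong: if_cong)
  moreover have "(\<Sum>k\<in>UNIV. V $ i $ k * cnj (V $ j $ k)) = (if i = j then 1 else 0)" for i j
  proof -
    have "(V ** conj_transpose V) $ i $ j = mat 1 $ i $ j" using V by (simp add: unitary_def)
    then show ?thesis by (simp add: matrix_mult_nth mat_def)
  qed
  ultimately show ?thesis by (simp add: vec_eq_iff sum.distrib)
qed

lemma esym_mat_probe:
  assumes V: "unitary V"
  shows "esym_mat p (diagm a ** (conj_by V (probe c))) =
    (\<Sum>I | card I = p. (\<Prod>i\<in>I. a i) * of_real (1 + (\<Sum>i\<in>I. col_sq c V i)))"
  unfolding esym_mat_diagm_mult probe_conj[OF V] pminor_rank_one_update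
  by (simp add: mult_cnj_cmod col_sq_def)

text \<open>For the minors indexed by \<open>I\<close> and \<open>J\<close>, the fourth moments give \<open>card I * card J\<close> plus a correction
  \<open>card (I \<inter> J)\<close> from the diagonal, up to the factor \<open>1 / (d (d + 1))\<close>.\<close>

lemma integral_esym_mat_probe:
  fixes \<mu> :: "(complex^'n^'n) measure"
  assumes h: "haar_unitary \<mu>"
  defines "d \<equiv> real CARD('n)"
  shows "(\<integral>V. esym_mat p (diagm a ** (conj_by V (probe c))) * esym_mat q (diagm a ** (conj_by V (probe c))) \<partial>\<mu>)
    = of_real (1 + (real p + real q) / d + real p * real q / (d * (d + 1))) * (elem_sym p a * elem_sym q a)
      + of_real (1 / (d * (d + 1))) * overlap_sum p q a"
proof -
  interpret prob_space \<mu> using haarD(1)[OF h] .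
  let ?X = "\<lambda>V I. 1 + (\<Sum>i\<in>I. col_sq c V i)"
  let ?b = "1 / (d * (d + 1))"
  have i1: "integrable \<mu> (\<lambda>V. col_sq c V i)" for i by (intro haar_integrable[OF h] continuous_intros)
  have i2: "integrable \<mu> (\<lambda>V. col_sq c V i * col_sq c V j)" for i j by (intro haar_integrable[OF h] continuous_intros)
  have mom: "(\<integral>V. ?X V I * ?X V J \<partial>\<mu>) = 1 + (real (card I) + real (card J)) / d + ?b * (real (card I) * real (card J) + real (card (I \<inter> J)))" for I J
  proof -
    have "(\<integral>V. ?X V I * ?X V J \<partial>\<mu>) = (\<integral>V. 1 + (\<Sum>i\<in>I. col_sq c V i) + (\<Sum>j\<in>J. col_sq c V j) + (\<Sum>i\<in>I. \<Sum>j\<in>J. col_sq c V i * col_sq c V j) \<partial>\<mu>)"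
      by (simp add: sum_product algebra_simps)
    also have "\<dots> = 1 + (\<Sum>i\<in>I. 1 / d) + (\<Sum>j\<in>J. 1 / d) + (\<Sum>i\<in>I. \<Sum>j\<in>J. (if i = j then 2 else 1) / (d * (d + 1)))"
      using i1 i2 by (simp add: col_sq_moments[OF h, folded d_def] prob_space)
    also have "(\<Sum>i\<in>I. \<Sum>j\<in>J. (if i = j then 2 else 1) / (d * (d + 1))) = (\<Sum>i\<in>I. \<Sum>j\<in>J. ?b + (if i = j then ?b else 0))"
      by (intro sum.cong refl) auto
    also have "\<dots> = (\<Sum>i\<in>I. real (card J) * ?b + (if i \<in> J then ?b else 0))"
      by (intro sum.cong refl) (simp add: sum.distrib)
    also have "\<dots> = real (card I) * (real (card J) * ?b) + real (card (I \<inter> J)) * ?b"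
      by (simp add: sum.distrib flip: sum.inter_restrict)
    finally show ?thesis by (simp add: add_divide_distrib algebra_simps)
  qed
  have "(\<integral>V. esym_mat p (diagm a ** (conj_by V (probe c))) * esym_mat q (diagm a ** (conj_by V (probe c))) \<partial>\<mu>)
    = (\<integral>V. (\<Sum>I | card I = p. \<Sum>J | card J = q. (\<Prod>i\<in>I. a i) * (\<Prod>j\<in>J. a j) * of_real (?X V I * ?X V J)) \<partial>\<mu>)"
  proof (rule haar_cong[OF h])
    fix V :: "complex^'n^'n" assume "unitary V"
    then show "esym_mat p (diagm a ** (conj_by V (probe c))) * esym_mat q (diagm a ** (conj_by V (probe c)))
      = (\<Sum>I | card I = p. \<Sum>J | card J = q. (\<Prod>i\<in>I. a i) * (\<Prod>j\<in>J. a j) * of_real (?X V I * ?X V J))"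
      unfolding esym_mat_probe[OF \<open>unitary V\<close>] sum_product by (intro sum.cong refl) (simp only: of_real_mult mult_ac)
  qed (intro continuous_intros)+
  also have "\<dots> = (\<Sum>I | card I = p. \<Sum>J | card J = q. (\<integral>V. (\<Prod>i\<in>I. a i) * (\<Prod>j\<in>J. a j) * of_real (?X V I * ?X V J) \<partial>\<mu>))"
    by (subst Bochner_Integration.integral_sum, intro haar_integrable[OF h] continuous_intros, rule sum.cong[OF refl],
        rule Bochner_Integration.integral_sum, intro haar_integrable[OF h] continuous_intros)
  also have "\<dots> = (\<Sum>I | card I = p. \<Sum>J | card J = q. (\<Prod>i\<in>I. a i) * (\<Prod>j\<in>J. a j) *
      of_real (1 + (real p + real q) / d + ?b * (real p * real q + real (card (I \<inter> J)))))"
    by (intro sum.cong refl) (simp only: Bochner_Integration.integral_mult_right_zero integral_complex_of_real mom mem_Collect_eq)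
  also have "\<dots> = (\<Sum>I | card I = p. \<Sum>J | card J = q. of_real (1 + (real p + real q) / d + real p * real q / (d * (d + 1))) * ((\<Prod>i\<in>I. a i) * (\<Prod>j\<in>J. a j))
      + of_real ?b * ((\<Prod>i\<in>I. a i) * (\<Prod>j\<in>J. a j) * of_nat (card (I \<inter> J))))"
    by (intro sum.cong refl) (simp add: distrib_left distrib_right mult_ac)
  also have "\<dots> = of_real (1 + (real p + real q) / d + real p * real q / (d * (d + 1))) * (elem_sym p a * elem_sym q a)
      + of_real ?b * overlap_sum p q a"
  proof -
    have ee: "elem_sym p a * elem_sym q a = (\<Sum>I | card I = p. \<Sum>J | card J = q. (\<Prod>i\<in>I. a i) * (\<Prod>j\<in>J. a j))"
      by (simp only: elem_sym_def sum_product)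
    show ?thesis by (simp only: ee overlap_sum_def sum.distrib sum_distrib_left)
  qed
  finally show ?thesis .
qed

definition probe_eigenvalue :: "nat \<Rightarrow> nat \<Rightarrow> real \<Rightarrow> real" where
  "probe_eigenvalue p q d = 1 + (real p + real q) / d + real q * (real p + 1) / (d * (d + 1))"

lemma integral_schur2_mat_probe_diagm:
  fixes \<mu> :: "(complex^'n^'n) measure"
  assumes h: "haar_unitary \<mu>"
  shows "(\<integral>V. schur2_mat p q (diagm a ** (conj_by V (probe c))) \<partial>\<mu>)
    = of_real (probe_eigenvalue p q (real CARD('n))) * schur2 p q a"
proof (cases "q = 0")
  case True
  have "overlap_sum p 0 a = 0" by (simp add: overlap_sum_eq elem_sym_at_0)
  then show ?thesis using integral_esym_mat_probe[OF h, of p a c 0] True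
    by (simp add: schur2_mat_def schur2_def probe_eigenvalue_def)
next
  case False
  define d where "d = real CARD('n)"
  define b where "b = 1 / (d * (d + 1))"
  have cont: "continuous_on UNIV (\<lambda>V. esym_mat p (diagm a ** (conj_by V (probe c))) * esym_mat q (diagm a ** (conj_by V (probe c))))" for p q
    by (intro continuous_intros)
  have "(\<integral>V. schur2_mat p q (diagm a ** (conj_by V (probe c))) \<partial>\<mu>) =
     (of_real (1 + (real p + real q) / d + real p * real q * b) * (elem_sym p a * elem_sym q a) + of_real b * overlap_sum p q a) -
     (of_real (1 + (real (Suc p) + real (q - 1)) / d + real (Suc p) * real (q - 1) * b) * (elem_sym (Suc p) a * elem_sym (q - 1) a) + of_real b * overlap_sum (Suc p) (q - 1) a)"
    using integral_esym_mat_probe[OF h, of p a c q, folded d_def] integral_esym_mat_probe[OF h, of "Suc p" a c "q - 1", folded d_def]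
      haar_integrable[OF h cont] False unfolding schur2_mat_def b_def
    by simp
  also have "\<dots> = of_real (1 + (real p + real q) / d) * schur2 p q a + of_real b * 
     (of_nat p * of_nat q * (elem_sym p a * elem_sym q a) - of_nat (Suc p) * of_nat (q - 1) * (elem_sym (Suc p) a * elem_sym (q - 1) a)
       + (overlap_sum p q a - overlap_sum (Suc p) (q - 1) a))"
    using False by (simp add: schur2_def algebra_simps of_nat_diff)
  also have "overlap_sum p q a - overlap_sum (Suc p) (q - 1) a =
    of_nat q * (elem_sym p a * elem_sym q a) - of_nat (Suc p) * (elem_sym (Suc p) a * elem_sym (q - 1) a)"
    by (rule overlap_sum_diff) (use False in simp)
  also have "of_real (1 + (real p + real q) / d) * schur2 p q a + of_real b * 
     (of_nat p * of_nat q * (elem_sym p a * elem_sym q a) - of_nat (Suc p) * of_nat (q - 1) * (elem_sym (Suc p) a * elem_sym (q - 1) a)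
       + (of_nat q * (elem_sym p a * elem_sym q a) - of_nat (Suc p) * (elem_sym (Suc p) a * elem_sym (q - 1) a)))
     = of_real (1 + (real p + real q) / d) * schur2 p q a + of_real b * (of_nat q * (of_nat p + 1) * schur2 p q a)"
    using False by (simp add: schur2_def algebra_simps of_nat_diff)
  also have "\<dots> = of_real (probe_eigenvalue p q d) * schur2 p q a"
    by (simp add: probe_eigenvalue_def b_def algebra_simps add_divide_distrib)
  finally show ?thesis by (simp add: d_def)
qed

section \<open>Spans of two-column Schur functions\<close>

text \<open>The monomial symmetric function of the partition with \<open>t\<close> parts \<open>2\<close> and \<open>n - 2 t\<close> parts \<open>1\<close>: \<open>T\<close> holds the variables of exponent two, \<open>S\<close>
  those of exponent one.\<close>

definition two_one_sum :: "nat \<Rightarrow> nat \<Rightarrow> ('n::finite \<Rightarrow> 'a::comm_ring_1) \<Rightarrow> 'a" where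
  "two_one_sum n t a = (\<Sum>(T, S)\<in>{(T, S). card T = t \<and> card S = n - 2 * t \<and> T \<inter> S = {}}.
     (\<Prod>i\<in>T. a i)\<^sup>2 * (\<Prod>i\<in>S. a i))"

text \<open>A pair \<open>(I, J)\<close> consists of its intersection, its symmetric difference \<open>S\<close>, and the choice of the
  part of \<open>S\<close> that lies in \<open>I\<close>.\<close>

lemma sum_overlap_class:
  fixes a :: "'n::finite \<Rightarrow> complex"
  assumes t: "t \<le> p" "t \<le> q"
  shows "(\<Sum>(I, J)\<in>{(I, J). card I = p \<and> card J = q \<and> card (I \<inter> J) = t}. (\<Prod>i\<in>I. a i) * (\<Prod>j\<in>J. a j)) =
    of_nat ((p + q - 2 * t) choose (p - t)) * two_one_sum (p + q) t a"
proof -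
  let ?C = "{(T :: 'n set, S :: 'n set). card T = t \<and> card S = p + q - 2 * t \<and> T \<inter> S = {}}"
  let ?D = "\<lambda>z. {L. L \<subseteq> snd z \<and> card L = p - t}"
  let ?w = "\<lambda>z. (\<Prod>i\<in>fst z. a i)\<^sup>2 * (\<Prod>i\<in>snd z. a i)"
  have "of_nat ((p + q - 2 * t) choose (p - t)) * two_one_sum (p + q) t a = (\<Sum>z\<in>?C. \<Sum>L\<in>?D z. ?w z)"
    unfolding two_one_sum_def sum_distrib_left
    by (intro sum.cong refl) (auto simp: n_subsets)
  also have "\<dots> = (\<Sum>(z, L)\<in>Sigma ?C ?D. ?w z)"
    by (rule sum.Sigma) auto
  also have "\<dots> = (\<Sum>(I, J)\<in>{(I, J). card I = p \<and> card J = q \<and> card (I \<inter> J) = t}. (\<Prod>i\<in>I. a i) * (\<Prod>j\<in>J. a j))"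
  proof (rule sum.reindex_bij_witness[of _ "\<lambda>(I, J). ((I \<inter> J, (I - J) \<union> (J - I)), I - J)"
        "\<lambda>((T, S), L). (T \<union> L, T \<union> (S - L))"])
    fix x assume x: "x \<in> Sigma ?C ?D"
    obtain T S L where e: "x = ((T, S), L)" by (metis surj_pair)
    have c: "card T = t" "card S = p + q - 2 * t" "T \<inter> S = {}" "L \<subseteq> S" "card L = p - t"
      using x by (auto simp: e)
    have d: "T \<inter> L = {}" "T \<inter> (S - L) = {}" "L \<inter> (S - L) = {}" using c by auto
    have "card (S - L) = q - t" using c t by (simp add: card_Diff_subset finite_subset[OF c(4)])
    then have "card (T \<union> L) = p" "card (T \<union> (S - L)) = q" using c d t by (auto simp: card_Un_disjoint)
    moreover have "(T \<union> L) \<inter> (T \<union> (S - L)) = T" using c by auto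
    ultimately show "(case x of (x, xa) \<Rightarrow> (case x of (T, S) \<Rightarrow> \<lambda>L. (T \<union> L, T \<union> (S - L))) xa) \<in> {(I, J). card I = p \<and> card J = q \<and> card (I \<inter> J) = t}"
      using c by (simp add: e)
    show "(case case x of (x, xa) \<Rightarrow> (case x of (T, S) \<Rightarrow> \<lambda>L. (T \<union> L, T \<union> (S - L))) xa of (I, J) \<Rightarrow> ((I \<inter> J, (I - J) \<union> (J - I)), I - J)) = x"
      using c by (auto simp: e)
    show "(case case x of (x, xa) \<Rightarrow> (case x of (T, S) \<Rightarrow> \<lambda>L. (T \<union> L, T \<union> (S - L))) xa of (I, J) \<Rightarrow> prod a I * prod a J) = (case x of (z, L) \<Rightarrow> ?w z)"
    proof -
      have "prod a S = prod a L * prod a (S - L)" using c(4) by (subst prod.subset_diff[of L S]) (auto simp: mult.commute)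
      then show ?thesis using d by (simp add: e prod.union_disjoint power2_eq_square mult_ac)
    qed
  next
    fix y assume y: "y \<in> {(I :: 'n set, J :: 'n set). card I = p \<and> card J = q \<and> card (I \<inter> J) = t}"
    obtain I J where e: "y = (I, J)" by (metis surj_pair)
    have c: "card I = p" "card J = q" "card (I \<inter> J) = t" using y by (auto simp: e)
    have "card (I - J) = p - t" "card (J - I) = q - t" 
      using c by (auto simp: card_Diff_subset_Int Int_commute)
    moreover from this have "card ((I - J) \<union> (J - I)) = p + q - 2 * t" using t by (subst card_Un_disjoint) auto
    ultimately show "(case y of (I, J) \<Rightarrow> ((I \<inter> J, (I - J) \<union> (J - I)), I - J)) \<in> Sigma ?C ?D"
      using c by (auto simp: e)
    show "(case case y of (I, J) \<Rightarrow> ((I \<inter> J, (I - J) \<union> (J - I)), I - J) of (x, xa) \<Rightarrow> (case x of (T, S) \<Rightarrow> \<lambda>L. (T \<union> L, T \<union> (S - L))) xa) = y"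
      by (auto simp: e)
  qed
  finally show ?thesis ..
qed

lemma sum_over_overlap:
  fixes a :: "'n::finite \<Rightarrow> complex"
  assumes "q \<le> p"
  shows "(\<Sum>I | card I = p. \<Sum>J | card J = q. (\<Prod>i\<in>I. a i) * (\<Prod>j\<in>J. a j) * c (card (I \<inter> J))) =
    (\<Sum>t\<le>q. c t * of_nat ((p + q - 2 * t) choose (p - t)) * two_one_sum (p + q) t a)"
proof -
  have "(\<Sum>I | card I = p. \<Sum>J | card J = q. (\<Prod>i\<in>I. a i) * (\<Prod>j\<in>J. a j) * c (card (I \<inter> J))) =
     (\<Sum>z\<in>{I. card I = p} \<times> {J. card J = q}. (\<Prod>i\<in>fst z. a i) * (\<Prod>j\<in>snd z. a j) * c (card (fst z \<inter> snd z)))"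
    by (simp add: sum.cartesian_product case_prod_beta)
  also have "\<dots> = (\<Sum>t\<le>q. \<Sum>z\<in>{z \<in> {I. card I = p} \<times> {J. card J = q}. card (fst z \<inter> snd z) = t}.
      (\<Prod>i\<in>fst z. a i) * (\<Prod>j\<in>snd z. a j) * c (card (fst z \<inter> snd z)))"
    by (rule sum.group[symmetric]) (auto intro: card_mono)
  also have "\<dots> = (\<Sum>t\<le>q. c t * (\<Sum>(I, J)\<in>{(I, J). card I = p \<and> card J = q \<and> card (I \<inter> J) = t}. (\<Prod>i\<in>I. a i) * (\<Prod>j\<in>J. a j)))"
  proof (rule sum.cong[OF refl])
    fix t
    show "(\<Sum>z\<in>{z \<in> {I. card I = p} \<times> {J. card J = q}. card (fst z \<inter> snd z) = t}.
      (\<Prod>i\<in>fst z. a i) * (\<Prod>j\<in>snd z. a j) * c (card (fst z \<inter> snd z))) =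
      c t * (\<Sum>(I, J)\<in>{(I, J). card I = p \<and> card J = q \<and> card (I \<inter> J) = t}. (\<Prod>i\<in>I. a i) * (\<Prod>j\<in>J. a j))"
      unfolding sum_distrib_left by (rule sum.cong) auto
  qed
  also have "\<dots> = (\<Sum>t\<le>q. c t * of_nat ((p + q - 2 * t) choose (p - t)) * two_one_sum (p + q) t a)"
    by (intro sum.cong refl) (subst sum_overlap_class; use assms in simp)
  finally show ?thesis .
qed

lemma elem_sym_mult_eq_two_one:
  fixes a :: "'n::finite \<Rightarrow> complex"
  assumes "q \<le> p"
  shows "elem_sym p a * elem_sym q a = (\<Sum>t\<le>q. of_nat ((p + q - 2 * t) choose (p - t)) * two_one_sum (p + q) t a)"
  using sum_over_overlap[OF assms, of a "\<lambda>_. 1"] by (simp add: elem_sym_def sum_product)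

lemma schur2_eq_two_one:
  fixes a :: "'n::finite \<Rightarrow> complex"
  assumes j: "2 * j \<le> n"
  shows "schur2 (n - j) j a = (\<Sum>m\<le>j. of_int (weak_ballot (n - m - j) (j - m)) * two_one_sum n m a)"
proof -
  have sym: "((n - 2 * m) choose (n - j - m)) = ((n - 2 * m) choose (j - m))" if "m \<le> j" for m
    using binomial_symmetric[of "j - m" "n - 2 * m"] that j by (simp add: algebra_simps)
  have sym': "((n - 2 * m) choose (Suc (n - j) - m)) = ((n - 2 * m) choose (j - m - 1))" if "m < j" for m
    using binomial_symmetric[of "j - m - 1" "n - 2 * m"] that j by (simp add: Suc_diff_le algebra_simps)
  have wb: "weak_ballot (n - m - j) (j - m) = int ((n - 2 * m) choose (j - m)) - (if m = j then 0 else int ((n - 2 * m) choose (j - m - 1)))"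
    if "m \<le> j" for m
  proof -
    have "n - m - j + (j - m) = n - 2 * m" using that j by simp
    then show ?thesis unfolding weak_ballot_def using that by (simp only:) auto
  qed
  have e1: "elem_sym (n - j) a * elem_sym j a = (\<Sum>m\<le>j. of_nat ((n - 2 * m) choose (j - m)) * two_one_sum n m a)"
    using elem_sym_mult_eq_two_one[of j "n - j" a] j sym by simp
  show ?thesis
  proof (cases "j = 0")
    case True then show ?thesis using e1 wb by (simp add: schur2_def)
  next
    case False
    then have "elem_sym (Suc (n - j)) a * elem_sym (j - 1) a = (\<Sum>m\<le>j - 1. of_nat ((n - 2 * m) choose (j - m - 1)) * two_one_sum n m a)"
      using elem_sym_mult_eq_two_one[of "j - 1" "Suc (n - j)" a] j sym' by simp
    also have "\<dots> = (\<Sum>m\<le>j. (if m = j then 0 else of_nat ((n - 2 * m) choose (j - m - 1))) * two_one_sum n m a)"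
      by (rule sum.mono_neutral_cong_left) (use False in auto)
    finally show ?thesis unfolding schur2_def e1 using False wb
      by (auto simp flip: sum_subtractf simp: left_diff_distrib intro!: sum.cong)
  qed
qed

definition schur_span :: "nat \<Rightarrow> nat \<Rightarrow> (('n::finite \<Rightarrow> complex) \<Rightarrow> complex) \<Rightarrow> bool" where
  "schur_span n q f \<longleftrightarrow> (\<exists>\<gamma>. \<forall>a. f a = (\<Sum>i\<le>q. \<gamma> i * schur2 (n - i) i a))"

lemma schur_span_schur2: "i \<le> q \<Longrightarrow> schur_span n q (schur2 (n - i) i)"
  unfolding schur_span_def by (rule exI[of _ "\<lambda>j. if j = i then 1 else 0"]) (simp add: if_distrib[of "\<lambda>x. x * _"] cong: if_cong)

lemma schur_span_add:
  assumes "schur_span n q f" "schur_span n q g"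
  shows "schur_span n q (\<lambda>a. f a + g a)"
proof -
  obtain \<gamma> \<delta> where "\<forall>a. f a = (\<Sum>i\<le>q. \<gamma> i * schur2 (n - i) i a)" "\<forall>a. g a = (\<Sum>i\<le>q. \<delta> i * schur2 (n - i) i a)"
    using assms unfolding schur_span_def by auto
  then show ?thesis unfolding schur_span_def
    by (intro exI[of _ "\<lambda>i. \<gamma> i + \<delta> i"]) (simp add: distrib_right sum.distrib)
qed

lemma schur_span_cmult:
  assumes "schur_span n q f"
  shows "schur_span n q (\<lambda>a. c * f a)"
proof -
  obtain \<gamma> where "\<forall>a. f a = (\<Sum>i\<le>q. \<gamma> i * schur2 (n - i) i a)"
    using assms unfolding schur_span_def by auto
  then show ?thesis unfolding schur_span_def
    by (intro exI[of _ "\<lambda>i. c * \<gamma> i"]) (simp add: sum_distrib_left mult.assoc)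
qed

lemma schur_span_sum:
  assumes "\<And>x. x \<in> X \<Longrightarrow> schur_span n q (f x)"
  shows "schur_span n q (\<lambda>a. \<Sum>x\<in>X. f x a)"
  using assms
proof (induction X rule: infinite_finite_induct)
  case (insert x F)
  then show ?case using schur_span_add[of n q "f x" "\<lambda>a. \<Sum>x\<in>F. f x a"] by simp
qed (auto simp: schur_span_def intro!: exI[of _ "\<lambda>_. 0"])

lemma schur_span_mono:
  assumes "schur_span n q f" "q \<le> q'"
  shows "schur_span n q' f"
proof -
  obtain \<gamma> where g: "f = (\<lambda>a. \<Sum>i\<le>q. \<gamma> i * schur2 (n - i) i a)"
    using assms unfolding schur_span_def by auto
  show ?thesis unfolding g using assms(2) by (intro schur_span_sum schur_span_cmult schur_span_schur2) auto
qed

text \<open>The expansion of the Schur functions is unitriangular, as \<open>weak_ballot\<close> is \<open>1\<close> at \<open>q = 0\<close>.\<close>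

lemma schur_span_two_one:
  assumes "2 * t \<le> n"
  shows "schur_span n t (two_one_sum n t :: ('n::finite \<Rightarrow> complex) \<Rightarrow> complex)"
  using assms
proof (induction t rule: less_induct)
  case (less t)
  have eq: "two_one_sum n t = (\<lambda>a :: 'n \<Rightarrow> complex. schur2 (n - t) t a + (\<Sum>m<t. - of_int (weak_ballot (n - m - t) (t - m)) * two_one_sum n m a))"
  proof
    fix a :: "'n \<Rightarrow> complex"
    have "schur2 (n - t) t a = two_one_sum n t a + (\<Sum>m<t. of_int (weak_ballot (n - m - t) (t - m)) * two_one_sum n m a)"
      unfolding schur2_eq_two_one[OF less.prems] lessThan_Suc_atMost[symmetric] by (simp add: weak_ballot_def)
    then show "two_one_sum n t a = schur2 (n - t) t a + (\<Sum>m<t. - of_int (weak_ballot (n - m - t) (t - m)) * two_one_sum n m a)"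
      by (simp add: sum_negf)
  qed
  show ?case
  proof (subst eq, intro schur_span_add schur_span_schur2 schur_span_sum schur_span_cmult order_refl)
    fix m assume "m \<in> {..<t}"
    then show "schur_span n t (two_one_sum n m :: ('n \<Rightarrow> complex) \<Rightarrow> complex)"
      using less by (intro schur_span_mono[OF less.IH]) auto
  qed
qed

lemma elem_sym_indicator:
  fixes R :: "'n::finite set"
  shows "elem_sym p (\<lambda>i. if i \<in> R then 1 else 0 :: complex) = of_nat (card R choose p)"
proof -
  have "elem_sym p (\<lambda>i. if i \<in> R then 1 else 0 :: complex) = (\<Sum>I | card I = p. if I \<subseteq> R then 1 else 0)"
    unfolding elem_sym_def
  proof (intro sum.cong refl)
    fix I :: "'n set"
    show "(\<Prod>i\<in>I. if i \<in> R then 1 else 0 :: complex) = (if I \<subseteq> R then 1 else 0)"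
    proof (cases "I \<subseteq> R")
      case True
      then show ?thesis by (auto intro!: prod.neutral)
    next
      case False
      then obtain x where "x \<in> I" "x \<notin> R" by auto
      then show ?thesis using False by (auto intro!: prod_zero bexI[of _ x])
    qed
  qed
  also have "\<dots> = (\<Sum>I | I \<subseteq> R \<and> card I = p. 1)"
    by (rule sum.mono_neutral_cong_right) auto
  also have "\<dots> = of_nat (card R choose p)" by (simp add: n_subsets)
  finally show ?thesis .
qed

text \<open>On indicator vectors of a set with \<open>n - k\<close> elements, all Schur functions with \<open>i < k\<close> vanish, as their
  first column is too long, while that with \<open>i = k\<close> does not.  Test the largest \<open>k\<close> with a nonzero
  coefficient.\<close>

lemma schur2_independent:
  fixes \<delta> :: "nat \<Rightarrow> complex"
  assumes n: "n \<le> CARD('n::finite)" and q: "2 * q \<le> n"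
    and zero: "\<And>R :: 'n set. (\<Sum>i\<le>q. \<delta> i * schur2 (n - i) i (\<lambda>j. if j \<in> R then 1 else 0)) = 0"
    and i: "i \<le> q"
  shows "\<delta> i = 0"
proof (rule ccontr)
  assume "\<delta> i \<noteq> 0"
  define k where "k = Max {i. i \<le> q \<and> \<delta> i \<noteq> 0}"
  have fin: "finite {i. i \<le> q \<and> \<delta> i \<noteq> 0}" by simp
  have "k \<in> {i. i \<le> q \<and> \<delta> i \<noteq> 0}" unfolding k_def using \<open>\<delta> i \<noteq> 0\<close> i by (intro Max_in) auto
  then have k: "k \<le> q" "\<delta> k \<noteq> 0" by auto
  have above: "\<delta> j = 0" if "j \<le> q" "k < j" for j
    using Max_ge[OF fin, of j] that unfolding k_def[symmetric] by auto
  obtain R :: "'n set" where R: "card R = n - k"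
    by (rule obtain_subset_with_card_n[of "n - k" "UNIV :: 'n set"]) (use n in auto)
  let ?a = "\<lambda>j :: 'n. if j \<in> R then 1 else 0 :: complex"
  have "(\<Sum>i\<le>q. \<delta> i * schur2 (n - i) i ?a) = \<delta> k * schur2 (n - k) k ?a"
  proof (subst sum.remove[of _ k], goal_cases)
    case 3
    have "\<delta> j * schur2 (n - j) j ?a = 0" if "j \<in> {..q} - {k}" for j
    proof (cases "j < k")
      case True
      then have "n - j > n - k" using k(1) q by auto
      then have "((n - k) choose (n - j)) = 0" "((n - k) choose Suc (n - j)) = 0"
        by (auto simp: binomial_eq_0)
      then show ?thesis by (simp only: schur2_def elem_sym_indicator R) simp
    qed (use that above[of j] in auto)
    then have "(\<Sum>j\<in>{..q} - {k}. \<delta> j * schur2 (n - j) j ?a) = 0" by (intro sum.neutral) blast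
    then show ?case by simp
  qed (use k in auto)
  also have "schur2 (n - k) k ?a = of_nat ((n - k) choose k)" using R by (simp add: schur2_def elem_sym_indicator)
  finally have "((n - k) choose k) = 0" using zero[of R] k(2) by simp
  then show False using k(1) q by simp
qed

text \<open>The three cardinalities determine those of all four regions of the Venn diagram.\<close>

lemma ex_permutation_two_sets:
  fixes I J I' J' :: "'n::finite set"
  assumes "card I = card I'" "card J = card J'" "card (I \<inter> J) = card (I' \<inter> J')"
  obtains p where "p permutes UNIV" "p ` I = I'" "p ` J = J'"
proof -
  define f where "f x = (x \<in> I, x \<in> J)" for x
  define f' where "f' x = (x \<in> I', x \<in> J')" for x
  have D: "card (I - J) = card (I' - J')" "card (J - I) = card (J' - I')"
    using assms by (simp_all add: card_Diff_subset_Int Int_commute)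
  have "card (I \<union> J) = card (I' \<union> J')"
    using card_Un_Int[of I J] card_Un_Int[of I' J'] assms by simp
  then have C: "card (- (I \<union> J)) = card (- (I' \<union> J'))" by (simp add: Compl_eq_Diff_UNIV card_Diff_subset)
  have "image_mset f (mset_set UNIV) = image_mset f' (mset_set UNIV)"
  proof (rule multiset_eqI)
    fix z :: "bool \<times> bool"
    have sets: "f -` {(True, True)} = I \<inter> J" "f -` {(True, False)} = I - J" "f -` {(False, True)} = J - I" "f -` {(False, False)} = - (I \<union> J)"
       "f' -` {(True, True)} = I' \<inter> J'" "f' -` {(True, False)} = I' - J'" "f' -` {(False, True)} = J' - I'" "f' -` {(False, False)} = - (I' \<union> J')"
      by (auto simp: f_def f'_def)
    obtain b1 b2 where z: "z = (b1, b2)" by (cases z)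
    have "card (f -` {z}) = card (f' -` {z})" using D C assms(3) unfolding z by (cases b1; cases b2) (simp_all only: sets)
    then show "count (image_mset f (mset_set UNIV)) z = count (image_mset f' (mset_set UNIV)) z"
      by (simp add: count_image_mset)
  qed
  then obtain p where p: "p permutes (UNIV :: 'n set)" "\<And>x. f x = f' (p x)"
    using image_mset_eq_implies_permutes[of "UNIV :: 'n set" f f'] by auto
  have m: "x \<in> I \<longleftrightarrow> p x \<in> I'" "x \<in> J \<longleftrightarrow> p x \<in> J'" for x using p(2)[of x] by (auto simp: f_def f'_def)
  have "surj p" using permutes_bij[OF p(1)] by (rule bij_is_surj)
  then have img: "p ` X = X'" if "\<And>x. x \<in> X \<longleftrightarrow> p x \<in> X'" for X X'
    using that by (metis image_subsetI surjD image_eqI subsetI subset_antisym)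
  have "p ` I = I'" "p ` J = J'" by (rule img, rule m)+
  with p(1) show thesis by (rule that)
qed

context
  fixes \<mu> :: "(complex^'n^'n) measure"
  assumes h: "haar_unitary \<mu>"
begin

text \<open>Permutation matrices are unitary, so the moment is invariant under simultaneous permutations of
  \<open>I\<close> and \<open>J\<close>.\<close>

lemma pminor_moment_overlap:
  fixes B :: "complex^'n^'n"
  shows "\<exists>\<omega>. \<forall>I J. card I = p \<and> card J = q \<longrightarrow>
    (\<integral>U. pminor I (conj_by U B) * pminor J (conj_by U B) \<partial>\<mu>) = \<omega> (card (I \<inter> J))"
proof -
  define w where "w I J = (\<integral>U. pminor I (conj_by U B) * pminor J (conj_by U B) \<partial>\<mu>)" for I J
  have inv: "w (\<sigma> ` I) (\<sigma> ` J) = w I J" if \<sigma>: "\<sigma> permutes UNIV" for \<sigma> I J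
  proof -
    have "(conj_by (perm_matrix \<sigma> ** U) B) = (\<chi> i j. (conj_by U B) $ \<sigma> i $ \<sigma> j)" for U
      by (simp add: vec_eq_iff matrix_mult_nth[of "_ ** B"] matrix_mult_nth[of _ B] perm_matrix_mult_nth)
    then have "w (\<sigma> ` I) (\<sigma> ` J) = (\<integral>U. pminor I (conj_by (perm_matrix \<sigma> ** U) B) * pminor J (conj_by (perm_matrix \<sigma> ** U) B) \<partial>\<mu>)"
      by (simp add: w_def pminor_permute[OF \<sigma>])
    also have "\<dots> = w I J" unfolding w_def
      by (rule haar_translate[OF h _ unitary_perm_matrix[OF \<sigma>]]) (intro continuous_intros)
    finally show ?thesis .
  qed
  define \<omega> where "\<omega> t = (SOME x. \<exists>I J. card I = p \<and> card J = q \<and> card (I \<inter> J) = t \<and> x = w I J)" for t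
  have "w I J = \<omega> (card (I \<inter> J))" if IJ: "card I = p" "card J = q" for I J
  proof -
    have "\<exists>I' J'. card I' = p \<and> card J' = q \<and> card (I' \<inter> J') = card (I \<inter> J) \<and> \<omega> (card (I \<inter> J)) = w I' J'"
      unfolding \<omega>_def by (rule someI[of _ "w I J"]) (use IJ in blast)
    then obtain I' J' where IJ': "card I' = p" "card J' = q" "card (I' \<inter> J') = card (I \<inter> J)" "\<omega> (card (I \<inter> J)) = w I' J'"
      by (elim exE conjE)
    obtain \<sigma> where "\<sigma> permutes UNIV" "\<sigma> ` I = I'" "\<sigma> ` J = J'"
      by (rule ex_permutation_two_sets[of I I' J J']) (use IJ IJ' in simp_all)
    then show ?thesis using inv[of \<sigma> I J] IJ'(4) by simp
  qed
  then show ?thesis unfolding w_def by blast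
qed

lemma schur_span_integral_esym:
  fixes B :: "complex^'n^'n"
  assumes "q \<le> p"
  shows "schur_span (p + q) q (\<lambda>a. \<integral>U. esym_mat p (diagm a ** (conj_by U B)) * esym_mat q (diagm a ** (conj_by U B)) \<partial>\<mu>)"
proof -
  obtain \<omega> where \<omega>: "\<And>I J. card I = p \<Longrightarrow> card J = q \<Longrightarrow>
    (\<integral>U. pminor I (conj_by U B) * pminor J (conj_by U B) \<partial>\<mu>) = \<omega> (card (I \<inter> J))"
    using pminor_moment_overlap[of p q B] by blast
  have "(\<integral>U. esym_mat p (diagm a ** (conj_by U B)) * esym_mat q (diagm a ** (conj_by U B)) \<partial>\<mu>) =
      (\<Sum>t\<le>q. \<omega> t * of_nat ((p + q - 2 * t) choose (p - t)) * two_one_sum (p + q) t a)" for a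
  proof -
    have "(\<integral>U. esym_mat p (diagm a ** (conj_by U B)) * esym_mat q (diagm a ** (conj_by U B)) \<partial>\<mu>) =
       (\<integral>U. (\<Sum>I | card I = p. \<Sum>J | card J = q. (\<Prod>i\<in>I. a i) * (\<Prod>j\<in>J. a j) * (pminor I (conj_by U B) * pminor J (conj_by U B))) \<partial>\<mu>)"
      by (simp add: esym_mat_diagm_mult sum_product mult_ac)
    also have "\<dots> = (\<Sum>I | card I = p. \<Sum>J | card J = q. (\<integral>U. (\<Prod>i\<in>I. a i) * (\<Prod>j\<in>J. a j) * (pminor I (conj_by U B) * pminor J (conj_by U B)) \<partial>\<mu>))"
      by (subst Bochner_Integration.integral_sum, intro haar_integrable[OF h] continuous_intros, rule sum.cong[OF refl],
        rule Bochner_Integration.integral_sum, intro haar_integrable[OF h] continuous_intros)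
    also have "\<dots> = (\<Sum>I | card I = p. \<Sum>J | card J = q. (\<Prod>i\<in>I. a i) * (\<Prod>j\<in>J. a j) * \<omega> (card (I \<inter> J)))"
      by (intro sum.cong refl) (simp only: Bochner_Integration.integral_mult_right_zero \<omega> mem_Collect_eq)
    finally show ?thesis unfolding sum_over_overlap[OF assms] .
  qed
  moreover have "schur_span (p + q) q (two_one_sum (p + q) t :: ('n \<Rightarrow> complex) \<Rightarrow> complex)" if "t \<le> q" for t
    by (rule schur_span_mono[OF schur_span_two_one]) (use that assms in auto)
  ultimately show ?thesis by (simp only:) (intro schur_span_sum schur_span_cmult, simp)
qed

lemma schur_span_integral_schur2_mat:
  fixes B :: "complex^'n^'n"
  assumes "q \<le> p"
  shows "schur_span (p + q) q (\<lambda>a. \<integral>U. schur2_mat p q (diagm a ** (conj_by U B)) \<partial>\<mu>)"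
proof (cases "q = 0")
  case True
  then show ?thesis using schur_span_integral_esym[OF assms, of B] by (simp add: schur2_mat_def)
next
  case False
  define F where "F p q a = (\<integral>U. esym_mat p (diagm a ** (conj_by U B)) * esym_mat q (diagm a ** (conj_by U B)) \<partial>\<mu>)" for p q a
  have int: "integrable \<mu> (\<lambda>U. esym_mat p (diagm a ** (conj_by U B)) * esym_mat q (diagm a ** (conj_by U B)))" for p q a
    by (intro haar_integrable[OF h] continuous_intros)
  have "(\<lambda>a. \<integral>U. schur2_mat p q (diagm a ** (conj_by U B)) \<partial>\<mu>) = (\<lambda>a. F p q a + (-1) * F (Suc p) (q - 1) a)"
    using False int by (simp add: schur2_mat_def F_def)
  moreover have "schur_span (p + q) q (F p q)" unfolding F_def by (rule schur_span_integral_esym[OF assms])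
  moreover have "schur_span (p + q) q (F (Suc p) (q - 1))"
  proof (rule schur_span_mono)
    have e: "Suc p + (q - 1) = p + q" "q - 1 \<le> Suc p" using False assms by auto
    show "schur_span (p + q) (q - 1) (F (Suc p) (q - 1))"
      using schur_span_integral_esym[OF e(2), of B] unfolding F_def e(1) .
  qed simp
  ultimately show ?thesis by (simp only:) (intro schur_span_add schur_span_cmult)
qed

text \<open>A Hermitian matrix may be taken diagonal, because the unitary factors are absorbed into \<open>V\<close>.\<close>

lemma integral_schur2_mat_probe:
  assumes H: "hermitian H"
  shows "(\<integral>V. schur2_mat p q (H ** (conj_by V (probe c))) \<partial>\<mu>) = of_real (probe_eigenvalue p q (real CARD('n))) * schur2_mat p q H"
proof -
  obtain Q l where Q: "unitary Q" "H = Q ** diagm (\<lambda>i. complex_of_real (l i)) ** conj_transpose Q"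
    using hermitian_diagonalizable[OF H] .
  let ?D = "diagm (\<lambda>i. complex_of_real (l i))"
  have "schur2_mat p q (H ** (conj_by V (probe c))) =
     schur2_mat p q (?D ** (conj_by (conj_transpose Q ** V) (probe c)))" for V
    unfolding Q(2) using schur2_mat_commute[of p q Q "?D ** conj_transpose Q ** (conj_by V (probe c))"]
    by (simp add: matrix_mul_assoc conj_transpose_mult)
  then have "(\<integral>V. schur2_mat p q (H ** (conj_by V (probe c))) \<partial>\<mu>) = (\<integral>V. schur2_mat p q (?D ** (conj_by V (probe c))) \<partial>\<mu>)"
    using haar_translate[OF h _ unitary_conj_transpose[OF Q(1)], of "\<lambda>V. schur2_mat p q (?D ** (conj_by V (probe c)))"]
    by (simp add: continuous_intros)
  also have "\<dots> = of_real (probe_eigenvalue p q (real CARD('n))) * schur2 p q (\<lambda>i. complex_of_real (l i))"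
    by (rule integral_schur2_mat_probe_diagm[OF h])
  also have "schur2 p q (\<lambda>i. complex_of_real (l i)) = schur2_mat p q H"
    using Q schur2_mat_commute[of p q Q "?D ** conj_transpose Q"]
    by (simp add: unitary_def flip: matrix_mul_assoc)
  finally show ?thesis .
qed

end

section \<open>The product formula\<close>

lemma diagm_mult: "diagm a ** diagm b = diagm (\<lambda>i. a i * b i)"
  by (simp add: vec_eq_iff matrix_mult_nth diagm_def if_distrib[of "\<lambda>x. x * _"] if_distrib[of "\<lambda>x. _ * x"] cong: if_cong)

lemma diagm_one: "diagm (\<lambda>_. 1) = mat 1"
  by (simp add: vec_eq_iff diagm_def mat_def)

lemma hermitian_diagm: "hermitian (diagm (\<lambda>i. complex_of_real (l i)))"
  by (auto simp: hermitian_def vec_eq_iff diagm_def)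

lemma hermitian_congruence: "hermitian B \<Longrightarrow> hermitian (conj_by X B)"
  unfolding hermitian_def conj_transpose_mult by (simp add: matrix_mul_assoc)

lemma probe_eigenvalue_inj:
  assumes "2 * i \<le> n" "2 * j \<le> n" "d > 0"
    and eq: "probe_eigenvalue (n - i) i d = probe_eigenvalue (n - j) j d"
  shows "i = j"
proof -
  have nz: "d * (d + 1) \<noteq> 0" using assms(3) by auto
  have "real i * (real (n - i) + 1) / (d * (d + 1)) = real j * (real (n - j) + 1) / (d * (d + 1))"
    using eq assms(1,2) by (simp add: probe_eigenvalue_def of_nat_diff)
  then have "real i * (real (n - i) + 1) = real j * (real (n - j) + 1)" using nz by (simp add: divide_eq_eq)
  then have "(real i - real j) * (real n + 1 - real i - real j) = 0"
    using assms(1,2) by (simp add: of_nat_diff algebra_simps)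
  moreover have "real n + 1 - real i - real j > 0" using assms(1,2) by linarith
  ultimately show ?thesis by simp
qed

text \<open>Spectral argument: the average over \<open>U\<close> commutes with the probe operator, whose eigenvalues on the
  Schur functions are distinct.  The operator is evaluated at \<open>R W R\<close> instead of \<open>A W\<close> with \<open>A = R\<^sup>2\<close>, since
  the expansion of \<open>g\<close> in Schur functions is only known for Hermitian arguments.\<close>

theorem integral_schur2_mat_product:
  fixes \<mu> :: "(complex^'n^'n) measure" and A B :: "complex^'n^'n"
  assumes h: "haar_unitary \<mu>" and A: "hermitian A" and B: "hermitian B"
    and pq: "q \<le> p" "p + q \<le> CARD('n)"
  shows "(\<integral>U. schur2_mat p q (A ** U ** B ** conj_transpose U) \<partial>\<mu>) * schur2 p q (\<lambda>_ :: 'n. 1) = schur2_mat p q A * schur2_mat p q B"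
proof -
  interpret prob_space \<mu> using haarD(1)[OF h] .
  define n where "n = p + q"
  define d where "d = real CARD('n)"
  have q: "2 * q \<le> n" and p: "p = n - q" using pq by (auto simp: n_def)
  define g where "g X = (\<integral>U. schur2_mat p q (X ** (conj_by U B)) \<partial>\<mu>)" for X
  define \<theta> where "\<theta> i = complex_of_real (probe_eigenvalue (n - i) i d)" for i
  have \<theta>q: "\<theta> q = complex_of_real (probe_eigenvalue p q (real CARD('n)))"
    by (simp add: \<theta>_def n_def d_def)
  fix c :: 'n
  define W :: "complex^'n^'n \<Rightarrow> complex^'n^'n" where "W V = V ** probe c ** conj_transpose V" for V
  have g_conj: "g (conj_by Q X) = g X" if Q: "unitary Q" for Q X
  proof -
    have "schur2_mat p q (Q ** X ** conj_transpose Q ** (conj_by U B)) =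
       schur2_mat p q (X ** (conj_by (conj_transpose Q ** U) B))" for U
      using schur2_mat_commute[of p q Q "X ** conj_transpose Q ** (conj_by U B)"]
      by (simp add: matrix_mul_assoc conj_transpose_mult)
    then show ?thesis unfolding g_def
      using haar_translate[OF h _ unitary_conj_transpose[OF Q], of "\<lambda>U. schur2_mat p q (X ** (conj_by U B))"]
      by (simp add: continuous_intros)
  qed
  have "schur_span n q (\<lambda>a. g (diagm a))"
    using schur_span_integral_schur2_mat[OF h pq(1), of B] by (simp add: g_def n_def)
  then obtain \<gamma> where \<gamma>: "\<And>a. g (diagm a) = (\<Sum>i\<le>q. \<gamma> i * schur2 (n - i) i a)"
    unfolding schur_span_def by blast
  have g_herm: "g H = (\<Sum>i\<le>q. \<gamma> i * schur2_mat (n - i) i H)" if H: "hermitian H" for H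
  proof -
    obtain Q l where Q: "unitary Q" "H = Q ** diagm (\<lambda>i. complex_of_real (l i)) ** conj_transpose Q"
      using hermitian_diagonalizable[OF H] .
    have "schur2_mat (n - i) i H = schur2 (n - i) i (\<lambda>i. complex_of_real (l i))" for i
      using Q schur2_mat_commute[of "n - i" i Q "diagm (\<lambda>i. complex_of_real (l i)) ** conj_transpose Q"]
      by (simp add: unitary_def flip: matrix_mul_assoc)
    then show ?thesis unfolding Q(2) g_conj[OF Q(1)] \<gamma> by simp
  qed
  have hW: "hermitian (R ** W V ** R)" if "hermitian R" for R V
  proof -
    have hp: "hermitian (probe c)"
      using hermitian_diagm[of "\<lambda>i. if i = c then 2 else 1"] by (simp add: probe_def if_distrib[of complex_of_real] cong: if_cong)
    have "hermitian (R ** W V ** conj_transpose R)"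
      unfolding W_def by (intro hermitian_congruence hp)
    then show ?thesis using that by (simp add: hermitian_def)
  qed
  \<comment> \<open>The average of \<open>g (R W R)\<close> is computed twice, from the expansion of \<open>g\<close> and by interchanging the
    two integrals.  For indicator vectors \<open>R\<^sup>2 = R\<close>, and these suffice for linear independence.\<close>
  have key: "(\<Sum>i\<le>q. \<gamma> i * (\<theta> i - \<theta> q) * schur2 (n - i) i (\<lambda>j. if j \<in> S then 1 else 0)) = 0" for S :: "'n set"
  proof -
    define r where "r j = (if j \<in> S then 1 else 0 :: complex)" for j
    define R where "R = diagm r"
    have "R = diagm (\<lambda>j. complex_of_real (if j \<in> S then 1 else 0))"
      by (simp add: R_def diagm_def vec_eq_iff r_def)
    then have hR: "hermitian R" by (simp only: hermitian_diagm)
    have RR: "R ** R = R" unfolding R_def diagm_mult by (rule arg_cong[of _ _ diagm]) (auto simp: r_def)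
    have cW: "continuous_on UNIV (\<lambda>(V, U). schur2_mat p q (R ** W V ** R ** (conj_by U B)))"
      unfolding W_def case_prod_beta by (intro continuous_intros)
    have "(\<integral>V. g (R ** W V ** R) \<partial>\<mu>) = (\<integral>V. (\<Sum>i\<le>q. \<gamma> i * schur2_mat (n - i) i (R ** W V)) \<partial>\<mu>)"
    proof (rule arg_cong[of _ _ "\<lambda>f. integral\<^sup>L \<mu> f"], rule ext)
      fix V :: "complex^'n^'n"
      have "schur2_mat (n - i) i (R ** W V ** R) = schur2_mat (n - i) i (R ** W V)" for i
        using schur2_mat_commute[of "n - i" i "R ** W V" R] RR by (simp add: matrix_mul_assoc)
      then show "g (R ** W V ** R) = (\<Sum>i\<le>q. \<gamma> i * schur2_mat (n - i) i (R ** W V))"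
        by (simp add: g_herm[OF hW[OF hR]])
    qed
    also have "\<dots> = (\<Sum>i\<le>q. \<gamma> i * (\<integral>V. schur2_mat (n - i) i (R ** W V) \<partial>\<mu>))"
      unfolding W_def
      by (subst Bochner_Integration.integral_sum, intro haar_integrable[OF h] continuous_intros) simp
    also have "\<dots> = (\<Sum>i\<le>q. \<gamma> i * (\<theta> i * schur2 (n - i) i r))"
      unfolding W_def \<theta>_def d_def R_def integral_schur2_mat_probe_diagm[OF h] ..
    finally have way1: "(\<integral>V. g (R ** W V ** R) \<partial>\<mu>) = (\<Sum>i\<le>q. \<gamma> i * (\<theta> i * schur2 (n - i) i r))" .
    have "(\<integral>V. g (R ** W V ** R) \<partial>\<mu>) = (\<integral>U. \<integral>V. schur2_mat p q (R ** W V ** R ** (conj_by U B)) \<partial>\<mu> \<partial>\<mu>)"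
      unfolding g_def using haar_Fubini[OF h cW] by simp
    also have "\<dots> = (\<integral>U. \<theta> q * schur2_mat p q (R ** (conj_by U B)) \<partial>\<mu>)"
    proof (rule arg_cong[of _ _ "\<lambda>f. integral\<^sup>L \<mu> f"], rule ext)
      fix U :: "complex^'n^'n"
      define Z where "Z = U ** B ** conj_transpose U"
      have hZ: "hermitian (R ** Z ** R)"
        using hermitian_congruence[OF hermitian_congruence[OF B], of R U] hR by (simp add: Z_def hermitian_def)
      have "schur2_mat p q (R ** W V ** R ** Z) = schur2_mat p q (R ** Z ** R ** W V)" for V
        using schur2_mat_commute[of p q "R ** W V" "R ** Z"] by (simp add: matrix_mul_assoc)
      then have "(\<integral>V. schur2_mat p q (R ** W V ** R ** Z) \<partial>\<mu>) = \<theta> q * schur2_mat p q (R ** Z ** R)"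
        using integral_schur2_mat_probe[OF h hZ, of p q c] by (simp add: W_def \<theta>q)
      also have "schur2_mat p q (R ** Z ** R) = schur2_mat p q (R ** Z)"
        using schur2_mat_commute[of p q "R ** Z" R] RR by (simp add: matrix_mul_assoc)
      finally show "(\<integral>V. schur2_mat p q (R ** W V ** R ** (conj_by U B)) \<partial>\<mu>) = \<theta> q * schur2_mat p q (R ** (conj_by U B))"
        by (simp add: Z_def)
    qed
    also have "\<dots> = \<theta> q * g R" by (simp add: g_def)
    also have "\<dots> = (\<Sum>i\<le>q. \<gamma> i * (\<theta> q * schur2 (n - i) i r))"
      by (simp add: R_def \<gamma> sum_distrib_left mult_ac)
    finally have "(\<Sum>i\<le>q. \<gamma> i * (\<theta> i * schur2 (n - i) i r)) = (\<Sum>i\<le>q. \<gamma> i * (\<theta> q * schur2 (n - i) i r))"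
      using way1 by simp
    then show ?thesis by (simp add: r_def[abs_def, symmetric] algebra_simps sum_subtractf)
  qed
  have zero: "\<gamma> i = 0" if i: "i \<le> q" "i \<noteq> q" for i
  proof -
    have "\<gamma> i * (\<theta> i - \<theta> q) = 0"
      by (rule schur2_independent[OF _ q key i(1)]) (use pq in \<open>simp add: n_def\<close>)
    moreover have "\<theta> i \<noteq> \<theta> q"
      using probe_eigenvalue_inj[of i n q d] i q by (auto simp: \<theta>_def d_def)
    ultimately show ?thesis by simp
  qed
  have gq: "g H = \<gamma> q * schur2_mat p q H" if "hermitian H" for H
  proof -
    have "g H = (\<Sum>i\<in>{q}. \<gamma> i * schur2_mat (n - i) i H)"
      unfolding g_herm[OF that] by (rule sum.mono_neutral_right) (use zero in auto)
    then show ?thesis by (simp add: p)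
  qed
  have h1: "hermitian (mat 1 :: complex^'n^'n)" using hermitian_diagm[of "\<lambda>_. 1"] by (simp add: diagm_one)
  have s1: "schur2_mat p q (mat 1 :: complex^'n^'n) = schur2 p q (\<lambda>_ :: 'n. 1)" using schur2_mat_diagm[of p q "\<lambda>_ :: 'n. 1"] by (simp add: diagm_one)
  have "g (mat 1) = (\<integral>U. schur2_mat p q B \<partial>\<mu>)" unfolding g_def
  proof (rule haar_cong[OF h])
    fix U :: "complex^'n^'n" assume "unitary U"
    then show "schur2_mat p q (mat 1 ** (conj_by U B)) = schur2_mat p q B"
      using schur2_mat_commute[of p q U "B ** conj_transpose U"] by (simp add: unitary_def flip: matrix_mul_assoc)
  qed (intro continuous_intros)+
  then have "\<gamma> q * schur2 p q (\<lambda>_ :: 'n. 1) = schur2_mat p q B" using gq[OF h1] s1 by (simp add: prob_space)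
  moreover have "(\<integral>U. schur2_mat p q (A ** U ** B ** conj_transpose U) \<partial>\<mu>) = g A"
    by (simp add: g_def matrix_mul_assoc)
  ultimately show ?thesis using gq[OF A] by (metis mult.assoc mult.commute)
qed

lemma esym_mat_mult_eq_sum_schur2:
  assumes "k \<le> n"
  shows "esym_mat k W * esym_mat (n - k) W = (\<Sum>j\<le>k. schur2_mat (n - j) j W)"
  using assms
proof (induction k)
  case 0
  then show ?case by (simp add: schur2_mat_def)
next
  case (Suc k)
  then have "Suc (n - Suc k) = n - k" by simp
  then show ?case using Suc by (simp add: schur2_mat_def mult.commute)
qed

lemma fact_mult_binomial: "fact p * real (d choose p) = falling_fact (real d) p"
  by (simp add: binomial_gbinomial gbinomial_prod_rev falling_fact_def atLeast0LessThan)

text \<open>The dimension of the representation of this shape, by the hook content formula.\<close>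

lemma schur2_one:
  assumes j: "2 * j \<le> n"
  shows "schur2 (n - j) j (\<lambda>_ :: 'n::finite. 1) =
    of_real (falling_fact (real CARD('n) + 1) j * falling_fact (real CARD('n)) (n - j) * (real n - 2 * real j + 1) / (fact j * fact (n - j + 1)))"
proof -
  define d where "d = CARD('n)"
  define p where "p = n - j"
  have e: "elem_sym q (\<lambda>_ :: 'n. 1) = complex_of_real (real (d choose q))" for q
    using elem_sym_indicator[of q "UNIV :: 'n set"] by (simp add: d_def)
  have np: "real n - 2 * real j + 1 = real p - real j + 1" using j by (simp add: p_def of_nat_diff)
  have ch: "real (d choose q) = falling_fact (real d) q / fact q" for q
    using fact_mult_binomial[of q d] by (simp add: field_simps)
  show ?thesis
  proof (cases j)
    case 0
    have "1 + complex_of_nat n \<noteq> 0" by (metis of_nat_Suc of_nat_neq_0)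
    with 0 show ?thesis by (simp add: schur2_def e ch falling_fact_def add.commute flip: d_def)
  next
    case (Suc r)
    define F where "F = falling_fact (real d) p"
    define G where "G = falling_fact (real d) r"
    have f1: "falling_fact (real d) (Suc p) = F * (real d - real p)" "falling_fact (real d) (Suc r) = G * (real d - real r)"
      by (simp_all add: falling_fact_def F_def G_def)
    have f2: "falling_fact (real d + 1) (Suc r) = (real d + 1) * G"
      unfolding falling_fact_def G_def by (subst prod.lessThan_Suc_shift) simp
    have "real (d choose p) * real (d choose Suc r) - real (d choose Suc p) * real (d choose r) =
       F * (G * (real d - real r)) / (fact p * (fact r * (real r + 1))) - (F * (real d - real p)) * G / (fact p * (real p + 1) * fact r)"
      unfolding ch f1 by (simp add: F_def G_def mult_ac add_ac)
    also have "\<dots> = F * G * ((real d - real r) * (real p + 1) - (real d - real p) * (real r + 1)) / (fact p * (real p + 1) * (fact r * (real r + 1)))"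
      by (simp add: divide_simps) (simp add: algebra_simps)
    also have "(real d - real r) * (real p + 1) - (real d - real p) * (real r + 1) = (real d + 1) * (real p - real r)"
      by (simp add: algebra_simps)
    finally have "real (d choose p) * real (d choose Suc r) - real (d choose Suc p) * real (d choose r) =
       falling_fact (real d + 1) (Suc r) * F * (real p - real r) / (fact (Suc r) * fact (p + 1))"
      unfolding f2 by (simp add: mult_ac add_ac)
    then have "real (d choose p) * real (d choose Suc r) - real (d choose Suc p) * real (d choose r) =
       falling_fact (real d + 1) j * falling_fact (real d) p * (real p - real j + 1) / (fact j * fact (p + 1))"
      by (simp only: Suc F_def) simp
    moreover have "schur2 p j (\<lambda>_ :: 'n. 1) =
        complex_of_real (real (d choose p) * real (d choose Suc r) - real (d choose Suc p) * real (d choose r))"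
      by (simp add: schur2_def e Suc)
    ultimately show ?thesis unfolding np p_def[symmetric] d_def[symmetric] by (simp only:)
  qed
qed

text \<open>The coefficients are the reciprocals of the values of the Schur functions at the identity.\<close>

theorem integral_esym_mat_product:
  fixes \<mu> :: "(complex^'n^'n) measure" and A B :: "complex^'n^'n"
  assumes h: "haar_unitary \<mu>" and A: "hermitian A" and B: "hermitian B"
    and kl: "k \<le> l" "k + l \<le> CARD('n)"
  defines "n \<equiv> k + l" and "d \<equiv> real CARD('n)"
  shows "(\<integral>U. esym_mat k (A ** U ** B ** conj_transpose U) * esym_mat l (A ** U ** B ** conj_transpose U) \<partial>\<mu>) =
    (\<Sum>j\<le>k. schur2_mat (n - j) j A * schur2_mat (n - j) j B *
       of_real (fact j * fact (n - j + 1) / (real n - 2 * real j + 1) * (1 / (falling_fact (d + 1) j * falling_fact d (n - j)))))"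
proof -
  have l: "l = n - k" by (simp add: n_def)
  have "(\<integral>U. esym_mat k (A ** U ** B ** conj_transpose U) * esym_mat l (A ** U ** B ** conj_transpose U) \<partial>\<mu>) =
    (\<integral>U. (\<Sum>j\<le>k. schur2_mat (n - j) j (A ** U ** B ** conj_transpose U)) \<partial>\<mu>)"
    unfolding l by (subst esym_mat_mult_eq_sum_schur2) (auto simp: n_def)
  also have "\<dots> = (\<Sum>j\<le>k. \<integral>U. schur2_mat (n - j) j (A ** U ** B ** conj_transpose U) \<partial>\<mu>)"
    by (intro Bochner_Integration.integral_sum haar_integrable[OF h] continuous_intros)
  also have "\<dots> = (\<Sum>j\<le>k. schur2_mat (n - j) j A * schur2_mat (n - j) j B *
       of_real (fact j * fact (n - j + 1) / (real n - 2 * real j + 1) * (1 / (falling_fact (d + 1) j * falling_fact d (n - j)))))"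
  proof (rule sum.cong[OF refl])
    fix j assume "j \<in> {..k}"
    then have j: "2 * j \<le> n" "j \<le> n - j" "n - j + j \<le> CARD('n)" using kl by (auto simp: n_def)
    have pos: "falling_fact x m > 0" if "real m < x + 1" for x m
      unfolding falling_fact_def using that by (intro prod_pos) auto
    define c where "c = falling_fact (d + 1) j * falling_fact d (n - j) * (real n - 2 * real j + 1) / (fact j * fact (n - j + 1))"
    have "falling_fact (d + 1) j > 0" "falling_fact d (n - j) > 0" "real n - 2 * real j + 1 > 0"
      using j kl by (auto simp: d_def n_def intro!: pos)
    then have c: "c \<noteq> 0" and ci: "1 / c = fact j * fact (n - j + 1) / (real n - 2 * real j + 1) * (1 / (falling_fact (d + 1) j * falling_fact d (n - j)))"
      by (simp_all add: c_def)
    have "(\<integral>U. schur2_mat (n - j) j (A ** U ** B ** conj_transpose U) \<partial>\<mu>) * of_real c = schur2_mat (n - j) j A * schur2_mat (n - j) j B"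
      using integral_schur2_mat_product[OF h A B j(2,3)] schur2_one[OF j(1), where 'n = 'n] by (simp add: c_def d_def)
    then have "(\<integral>U. schur2_mat (n - j) j (A ** U ** B ** conj_transpose U) \<partial>\<mu>) = schur2_mat (n - j) j A * schur2_mat (n - j) j B / of_real c"
      using c by (simp add: eq_divide_eq)
    also have "\<dots> = schur2_mat (n - j) j A * schur2_mat (n - j) j B * of_real (1 / c)" by simp
    finally show "(\<integral>U. schur2_mat (n - j) j (A ** U ** B ** conj_transpose U) \<partial>\<mu>) = schur2_mat (n - j) j A * schur2_mat (n - j) j B *
       of_real (fact j * fact (n - j + 1) / (real n - 2 * real j + 1) * (1 / (falling_fact (d + 1) j * falling_fact d (n - j))))"
      unfolding ci .
  qed
  finally show ?thesis .
qed

section \<open>Ballot numbers and ballot paths\<close>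

lemma weak_ballot_closed_form:
  assumes "q \<le> p"
  shows "real_of_int (weak_ballot p q) = fact (p + q) * (real p - real q + 1) / (fact q * fact (p + 1))"
proof (cases q)
  case 0
  then show ?thesis by (simp add: weak_ballot_def)
next
  case (Suc r)
  have 1: "real ((p + q) choose q) = fact (p + q) / (fact q * fact p)"
    using binomial_fact[of q "p + q", where 'a = real] by simp
  have "p + q - r = p + 1" using Suc by simp
  then have 2: "real ((p + q) choose r) = fact (p + q) / (fact r * fact (p + 1))"
    using binomial_fact[of r "p + q", where 'a = real] Suc by simp
  have "real_of_int (weak_ballot p q) = real ((p + q) choose q) - real ((p + q) choose r)"
    unfolding weak_ballot_def using Suc by (simp del: binomial_Suc_Suc)
  also have "\<dots> = fact (p + q) / (fact q * fact p) - fact (p + q) / (fact r * fact (p + 1))"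
    unfolding 1 2 ..
  also have "\<dots> = fact (p + q) * (real p - real q + 1) / (fact q * fact (p + 1))"
    unfolding Suc by (simp add: divide_simps) (simp add: algebra_simps)
  finally show ?thesis .
qed

lemma weak_ballot_diagonal: "real_of_int (weak_ballot p p) = real ((2 * p) choose p) / real (p + 1)"
proof -
  have "real ((2 * p) choose p) = fact (2 * p) / (fact p * fact p)"
    using binomial_fact[of p "2 * p", where 'a = real] by (simp add: mult_2)
  then show ?thesis by (simp add: weak_ballot_closed_form mult_2)
qed

lemma weak_ballot_Suc_Suc:
  "weak_ballot (Suc p) (Suc q) = weak_ballot p (Suc q) + weak_ballot (Suc p) q"
  by (cases q) (simp_all add: weak_ballot_def)

lemma weak_ballot_below_diagonal: "weak_ballot p (Suc p) = 0"
  using binomial_symmetric[of p "Suc (2 * p)"] by (simp add: weak_ballot_def mult_2)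

lemma ballot_paths_0: "ballot_paths p 0 = {replicate p 1}"
proof -
  have *: "sum_list w \<le> int (length w) \<and> (sum_list w = int (length w) \<longrightarrow> w = replicate (length w) 1)"
    if "set w \<subseteq> {1, -1}" for w :: "int list"
    using that by (induction w) auto
  show ?thesis
  proof (intro equalityI subsetI)
    fix w assume "w \<in> ballot_paths p 0"
    then show "w \<in> {replicate p 1}" using *[of w] by (auto simp: ballot_paths_def)
  qed (auto simp: ballot_paths_def sum_list_replicate)
qed

lemma ballot_paths_below_diagonal: "ballot_paths p (Suc p) = {}"
  by (auto simp: ballot_paths_def)

lemma append_mem_ballot_paths:
  "w @ [x] \<in> ballot_paths p q \<longleftrightarrow> x \<in> {1, -1} \<and> set w \<subseteq> {1, -1} \<and> Suc (length w) = p + q \<and>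
     sum_list w + x = int p - int q \<and> int q \<le> int p \<and> (\<forall>i\<le>length w. 0 \<le> sum_list (take i w))"
  by (auto simp: ballot_paths_def le_Suc_eq)

lemma ballot_paths_Suc_Suc:
  assumes "q \<le> p"
  shows "ballot_paths (Suc p) (Suc q) =
    (\<lambda>w. w @ [1]) ` ballot_paths p (Suc q) \<union> (\<lambda>w. w @ [-1]) ` ballot_paths (Suc p) q"
proof (intro equalityI subsetI)
  fix w assume w: "w \<in> ballot_paths (Suc p) (Suc q)"
  then have "w \<noteq> []" by (auto simp: ballot_paths_def)
  then obtain v x where v: "w = v @ [x]" by (metis rev_exhaust)
  have *: "x = 1 \<or> x = -1" using w unfolding v append_mem_ballot_paths by auto
  have "x = 1 \<Longrightarrow> v \<in> ballot_paths p (Suc q)" "x = -1 \<Longrightarrow> v \<in> ballot_paths (Suc p) q"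
    using w unfolding v append_mem_ballot_paths by (auto simp: ballot_paths_def)
  then show "w \<in> (\<lambda>w. w @ [1]) ` ballot_paths p (Suc q) \<union> (\<lambda>w. w @ [-1]) ` ballot_paths (Suc p) q"
    using * v by auto
next
  fix w assume "w \<in> (\<lambda>w. w @ [1]) ` ballot_paths p (Suc q) \<union> (\<lambda>w. w @ [-1]) ` ballot_paths (Suc p) q"
  then show "w \<in> ballot_paths (Suc p) (Suc q)"
    using assms by (auto simp: append_mem_ballot_paths) (auto simp: ballot_paths_def)
qed

lemma finite_ballot_paths: "finite (ballot_paths p q)"
  by (rule finite_subset[OF _ finite_lists_length_eq[of "{1, -1}" "p + q"]]) (auto simp: ballot_paths_def)

text \<open>Induction on the last step of a path.  The boundary case \<open>q = p + 1\<close>, in which both sides vanish, is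
  included because removing an up step from a path with \<open>p = q\<close> leads there.\<close>

lemma card_ballot_paths: "q \<le> Suc p \<Longrightarrow> int (card (ballot_paths p q)) = weak_ballot p q"
proof (induction "p + q" arbitrary: p q rule: less_induct)
  case less
  consider "q = 0" | "q = Suc p" | p' q' where "p = Suc p'" "q = Suc q'" "q' \<le> p'"
  proof (cases q)
    case (Suc q')
    show ?thesis
    proof (cases "q = Suc p")
      case False
      then obtain p' where "p = Suc p'" using Suc less.prems by (cases p) auto
      then show ?thesis using that(3)[of p' q'] Suc False less.prems by simp
    qed (use that in auto)
  qed (use that in auto)
  then show ?case
  proof cases
    case 1 then show ?thesis by (simp add: ballot_paths_0 weak_ballot_def)
  next
    case 2 then show ?thesis by (simp add: ballot_paths_below_diagonal weak_ballot_below_diagonal)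
  next
    case (3 p' q')
    have "card (ballot_paths p q) = card (ballot_paths p' (Suc q')) + card (ballot_paths (Suc p') q')"
      unfolding 3 ballot_paths_Suc_Suc[OF 3(3)]
      by (subst card_Un_disjoint) (auto simp: card_image inj_on_def finite_ballot_paths)
    then show ?thesis using less.hyps[of p' "Suc q'"] less.hyps[of "Suc p'" q'] 3
      by (simp add: weak_ballot_Suc_Suc)
  qed
qed

section \<open>Translation to partitions and monomial symmetric functions\<close>

lemma matchings_eq_matching_on: "matchings k l = {K. matching_on {1..k} {k+1..k+l} K}"
proof -
  have "{1..k} \<union> {k+1..k+l} = {1..k+l}" by auto
  then show ?thesis by (simp add: matchings_def matching_on_def)
qed

lemma block_type_matching:
  assumes K: "matching_on U V K" and fin: "finite U" "finite V" and disj: "U \<inter> V = {}"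
  shows "block_type K = two_one_type (card U + card V) (num_pairs K)"
proof (rule multiset_eqI)
  fix c
  have part: "partition_on (U \<union> V) K" using K by (simp add: matching_on_def)
  have finK: "finite K" using finite_elements[OF _ part] fin by simp
  have cnt: "count (block_type K) c = card {X \<in> K. card X = c}"
    using finK by (simp add: block_type_def count_image_mset Int_def vimage_def conj_commute)
  have size: "card X = 1 \<or> card X = 2" if "X \<in> K" for X
    using K fin that
  proof (cases rule: matching_block_cases)
    case (2 u v)
    then have "u \<noteq> v" using disj by auto
    then show ?thesis using 2 by simp
  qed auto
  have ones: "card {X \<in> K. card X = 1} = card U + card V - 2 * num_pairs K"
  proof -
    have "{X \<in> K. card X = 1} = (\<lambda>x. {x}) ` ((U \<inter> singletons K) \<union> (V \<inter> singletons K))"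
      using part by (auto simp: card_1_singleton_iff singletons_def partition_on_def)
    then have "card {X \<in> K. card X = 1} = card ((U \<inter> singletons K) \<union> (V \<inter> singletons K))"
      by (simp add: card_image)
    also have "\<dots> = card (U \<inter> singletons K) + card (V \<inter> singletons K)"
      using fin disj by (intro card_Un_disjoint) auto
    finally show ?thesis using card_singletons[OF assms] by simp
  qed
  consider "c = 1" | "c = 2" | "c \<noteq> 1" "c \<noteq> 2" by blast
  then show "count (block_type K) c = count (two_one_type (card U + card V) (num_pairs K)) c"
  proof cases
    case 1 then show ?thesis using ones cnt by (simp add: two_one_type_def)
  next
    case 2 then show ?thesis using cnt by (simp add: two_one_type_def num_pairs_def)
  next
    case 3
    then have "{X \<in> K. card X = c} = {}" using size by auto
    then have "count (block_type K) c = 0" unfolding cnt by (simp only: card.empty)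
    then show ?thesis using 3 by (simp add: two_one_type_def)
  qed
qed

lemma two_one_type_inject: "two_one_type n m = two_one_type n y \<longleftrightarrow> m = y"
proof
  assume "two_one_type n m = two_one_type n y"
  then have "count (two_one_type n m) 2 = count (two_one_type n y) 2" by simp
  then show "m = y" by (simp add: two_one_type_def)
qed simp

lemma matchings_of_type:
  "{K. K \<in> matchings k l \<and> block_type K = two_one_type (k + l) m} = matchings_of_size {1..k} {k+1..k+l} m"
  using block_type_matching[of "{1..k}" "{k+1..k+l}"]
  by (auto simp: matchings_eq_matching_on matchings_of_size_def two_one_type_inject)

text \<open>An exponent vector of this type is given by the positions of its twos and ones; the bound on \<open>n\<close>
  guarantees that there is room for the padding by zeros.\<close>

lemma monomial_sym_two_one:
  fixes a :: "'n::finite \<Rightarrow> real"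
  assumes m: "2 * m \<le> n" "n \<le> CARD('n)"
  shows "monomial_sym (two_one_type n m) a = two_one_sum n m a"
proof -
  let ?\<nu> = "two_one_type n m + replicate_mset (CARD('n) - size (two_one_type n m)) 0"
  have cnt: "count (image_mset \<alpha> (mset_set (UNIV :: 'n set))) c = card {i. \<alpha> i = c}" for \<alpha> :: "'n \<Rightarrow> nat" and c
    by (simp add: count_image_mset vimage_def)
  have nu: "count ?\<nu> 2 = m" "count ?\<nu> 1 = n - 2 * m" "c \<notin> {0, 1, 2} \<Longrightarrow> count ?\<nu> c = 0"
     "count ?\<nu> 0 = CARD('n) - (n - m)" for c
    using m by (auto simp: two_one_type_def)
  show ?thesis unfolding monomial_sym_def two_one_sum_def
  proof (rule sum.reindex_bij_witness[of _ "\<lambda>(T, S) i. if i \<in> T then 2 else if i \<in> S then 1 else 0" "\<lambda>\<alpha>. ({i. \<alpha> i = 2}, {i. \<alpha> i = 1})"])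
    fix \<alpha> :: "'n \<Rightarrow> nat" assume "\<alpha> \<in> {\<alpha>. image_mset \<alpha> (mset_set UNIV) = ?\<nu>}"
    then have \<alpha>: "card {i. \<alpha> i = c} = count ?\<nu> c" for c using cnt[of \<alpha> c] by simp
    have vals: "\<alpha> i \<in> {0, 1, 2}" for i
    proof (rule ccontr)
      assume "\<alpha> i \<notin> {0, 1, 2}"
      then have "card {j. \<alpha> j = \<alpha> i} = 0" using \<alpha>[of "\<alpha> i"] nu(3) by simp
      then show False by auto
    qed
    have vals': "\<alpha> i = 0 \<or> \<alpha> i = 1 \<or> \<alpha> i = 2" for i using vals[of i] by simp
    show "(case ({i. \<alpha> i = 2}, {i. \<alpha> i = 1}) of (T, S) \<Rightarrow> \<lambda>i. if i \<in> T then 2 else if i \<in> S then 1 else 0) = \<alpha>"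
      using vals' by fastforce
    show "({i. \<alpha> i = 2}, {i. \<alpha> i = 1}) \<in> {(T, S). card T = m \<and> card S = n - 2 * m \<and> T \<inter> S = {}}"
      using \<alpha>[of 2] \<alpha>[of 1] nu(1,2) by auto
    have "(\<Prod>i\<in>UNIV. a i ^ \<alpha> i) = (\<Prod>i\<in>UNIV. (if i \<in> {i. \<alpha> i = 2} then (a i)\<^sup>2 else 1) * (if i \<in> {i. \<alpha> i = 1} then a i else 1))"
    proof (rule prod.cong[OF refl])
      fix i show "a i ^ \<alpha> i = (if i \<in> {i. \<alpha> i = 2} then (a i)\<^sup>2 else 1) * (if i \<in> {i. \<alpha> i = 1} then a i else 1)"
        using vals'[of i] by auto
    qed
    also have "\<dots> = (\<Prod>i | \<alpha> i = 2. (a i)\<^sup>2) * (\<Prod>i | \<alpha> i = 1. a i)"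
      unfolding prod.distrib by (simp flip: prod.inter_filter)
    finally show "(case ({i. \<alpha> i = 2}, {i. \<alpha> i = 1}) of (T, S) \<Rightarrow> (prod a T)\<^sup>2 * prod a S) = (\<Prod>i\<in>UNIV. a i ^ \<alpha> i)"
      by (simp add: prod_power_distrib)
  next
    fix z :: "'n set \<times> 'n set" assume z: "z \<in> {(T, S). card T = m \<and> card S = n - 2 * m \<and> T \<inter> S = {}}"
    obtain T S where e: "z = (T, S)" by (cases z)
    define \<beta> where "\<beta> i = (if i \<in> T then 2 else if i \<in> S then 1 else 0 :: nat)" for i
    have TS: "card T = m" "card S = n - 2 * m" "T \<inter> S = {}" using z e by auto
    have sets: "{i. \<beta> i = 2} = T" "{i. \<beta> i = 1} = S" "{i. \<beta> i = 0} = - (T \<union> S)"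
      using TS(3) by (auto simp: \<beta>_def)
    show "({i. (case z of (T, S) \<Rightarrow> \<lambda>i. if i \<in> T then 2 else if i \<in> S then 1 else 0) i = (2 :: nat)},
          {i. (case z of (T, S) \<Rightarrow> \<lambda>i. if i \<in> T then 2 else if i \<in> S then 1 else 0) i = (1 :: nat)}) = z"
      using sets(1,2) by (simp add: e \<beta>_def)
    have "image_mset \<beta> (mset_set UNIV) = ?\<nu>"
    proof (rule multiset_eqI)
      fix c
      have "card (- (T \<union> S)) = CARD('n) - (n - m)"
        using TS m by (simp add: Compl_eq_Diff_UNIV card_Diff_subset card_Un_disjoint)
      then have c0: "card {i. \<beta> i = c} = count ?\<nu> c" if "c \<in> {0, 1, 2}"
        using that TS nu sets by auto
      have "card {i. \<beta> i = c} = count ?\<nu> c" if "c \<notin> {0, 1, 2}"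
      proof -
        have "{i. \<beta> i = c} = {}" using that by (auto simp: \<beta>_def)
        then show ?thesis using nu(3)[OF that] by simp
      qed
      with c0 show "count (image_mset \<beta> (mset_set UNIV)) c = count ?\<nu> c" unfolding cnt by blast
    qed
    then show "(case z of (T, S) \<Rightarrow> \<lambda>i. if i \<in> T then 2 else if i \<in> S then 1 else 0) \<in> {\<alpha>. image_mset \<alpha> (mset_set UNIV) = ?\<nu>}"
      by (simp add: e \<beta>_def[abs_def])
  qed
qed

section \<open>The matching sums\<close>

text \<open>The normalized ballot number \<open>ballot_tilde\<close> as a function of the half sum \<open>s\<close>, at the summation
  index \<open>j = h + s\<close>.  For fixed \<open>j\<close> this is the eigenvector of the matching sums.\<close>

definition ballot_ratio :: "nat \<Rightarrow> nat \<Rightarrow> nat \<Rightarrow> nat \<Rightarrow> real" where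
  "ballot_ratio k l j s = (if s \<le> j
     then real_of_int (weak_ballot (k + l - s - j) (j - s)) / real ((k + l - 2 * s) choose (k - s)) else 0)"

lemma ballot_ratio_closed_form:
  assumes "s \<le> j" "j \<le> k" "k \<le> l"
  shows "ballot_ratio k l j s = (real k + real l - 2 * real j + 1) * (fact (k - s) * fact (l - s)) / (fact (j - s) * fact (k + l - j - s + 1))"
proof -
  have e: "k + l - s - j + (j - s) = k + l - 2 * s" "k + l - 2 * s - (k - s) = l - s" using assms by auto
  have r: "real (k + l - s - j) - real (j - s) = real k + real l - 2 * real j" "j - s \<le> k + l - s - j"
    "k + l - s - j + 1 = k + l - j - s + 1" using assms by (auto simp: of_nat_diff)
  have "real_of_int (weak_ballot (k + l - s - j) (j - s)) =
     fact (k + l - 2 * s) * (real k + real l - 2 * real j + 1) / (fact (j - s) * fact (k + l - j - s + 1))"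
    using weak_ballot_closed_form[OF r(2)] unfolding e(1) r(1,3) .
  moreover have "real ((k + l - 2 * s) choose (k - s)) = fact (k + l - 2 * s) / (fact (k - s) * fact (l - s))"
    using assms by (subst binomial_fact) (auto simp: e(2))
  ultimately show ?thesis using assms by (simp add: ballot_ratio_def)
qed

lemma ballot_ratio_recurrence:
  assumes "j \<le> k" "k \<le> l" "s \<le> k"
  shows "(real k - real s) * (real l - real s) * ballot_ratio k l j (Suc s) =
    (real j - real s) * (real (k + l) + 1 - real j - real s) * ballot_ratio k l j s"
proof (cases "s < j")
  case True
  obtain k' l' j' N where e: "k - s = Suc k'" "l - s = Suc l'" "j - s = Suc j'" "k + l - j - s + 1 = Suc N"
    using True assms by (metis Suc_diff_Suc Suc_eq_plus1 less_le_trans)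
  have e': "k - Suc s = k'" "l - Suc s = l'" "j - Suc s = j'" "k + l - j - Suc s + 1 = N" using e True assms by auto
  have r: "real k - real s = real (Suc k')" "real l - real s = real (Suc l')" "real j - real s = real (Suc j')"
    "real (k + l) + 1 - real j - real s = real (Suc N)"
    using e True assms by (auto simp flip: e simp: of_nat_diff)
  show ?thesis unfolding r using True assms e e'
    by (simp only: ballot_ratio_closed_form[of s j k l] ballot_ratio_closed_form[of "Suc s" j k l] Suc_leI less_imp_le fact_Suc) simp
next
  case False
  then show ?thesis by (cases "s = j") (auto simp: ballot_ratio_def)
qed

lemma prod_falling: "y \<le> a \<Longrightarrow> (\<Prod>i<y. real a - real i) = fact a / fact (a - y)"
proof (induction y)
  case (Suc y)
  then have "a - y = Suc (a - Suc y)" by simp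
  then have "fact (a - y) = (real a - real y) * fact (a - Suc y)" using Suc.prems by (simp add: of_nat_diff)
  moreover have "real a - real y > 0" using Suc.prems by simp
  ultimately show ?case using Suc by simp
qed simp

text \<open>For \<open>y > j\<close> the eigenvalue vanishes, as the factor with \<open>i = j\<close> occurs in it; otherwise it is a
  quotient of factorials, and these are regrouped into a ballot number and the hook product of the
  shape with columns \<open>k + l - j\<close> and \<open>j\<close>.\<close>

lemma weighted_matching_sum:
  assumes U: "finite U" "card U = k" and V: "finite V" "card V = l" and disj: "U \<inter> V = {}"
    and j: "j \<le> k" "k \<le> l" and y: "y \<le> k" and m: "m \<le> k" and K: "K1 \<in> matchings_of_size U V m"
  shows "fact y * fact (k + l - 2 * y) * weighted_sum U V K1 y (ballot_ratio k l j) =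
    (if y \<le> j then real_of_int (weak_ballot (k + l - y - j) (j - y)) else 0) *
    (fact j * fact (k + l - j + 1) / (real (k + l) - 2 * real j + 1)) * ballot_ratio k l j m"
proof -
  have K': "matching_on U V K1" "num_pairs K1 = m" using K by (auto simp: matchings_of_size_def)
  have ws: "fact y * weighted_sum U V K1 y (ballot_ratio k l j) =
     (\<Prod>i<y. (real j - real i) * (real (k + l) + 1 - real j - real i)) * ballot_ratio k l j m"
    using weighted_sum_eigen[OF K'(1) U(1) V(1) disj, of "ballot_ratio k l j" "real j" y]
      ballot_ratio_recurrence[OF j] by (simp add: U V K'(2))
  show ?thesis
  proof (cases "y \<le> j")
    case False
    then have "(\<Prod>i<y. (real j - real i) * (real (k + l) + 1 - real j - real i)) = 0" by (intro prod_zero) auto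
    then have "weighted_sum U V K1 y (ballot_ratio k l j) = 0" using ws by (simp only: mult_zero_left mult_eq_0_iff fact_nonzero) simp
    then show ?thesis using False by simp
  next
    case True
    define N where "N = k + l - j + 1"
    have N: "real (k + l) + 1 - real j = real N" "y \<le> N" using j True by (auto simp: N_def of_nat_diff)
    have p: "(\<Prod>i<y. (real j - real i) * (real (k + l) + 1 - real j - real i)) = fact j / fact (j - y) * (fact N / fact (N - y))"
      unfolding N(1) prod.distrib using prod_falling[OF True] prod_falling[OF N(2)] by simp
    have e: "k + l - y - j + (j - y) = k + l - 2 * y" "k + l - y - j + 1 = N - y" using j True by (auto simp: N_def)
    have r: "real (k + l - y - j) - real (j - y) = real (k + l) - 2 * real j" "j - y \<le> k + l - y - j"
      using j True by (auto simp: of_nat_diff)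
    have w: "real_of_int (weak_ballot (k + l - y - j) (j - y)) =
      fact (k + l - 2 * y) * (real (k + l) - 2 * real j + 1) / (fact (j - y) * fact (N - y))"
      using weak_ballot_closed_form[OF r(2)] unfolding e r(1) .
    have nz: "real (k + l) - 2 * real j + 1 \<noteq> 0" using j by auto
    have "fact y * fact (k + l - 2 * y) * weighted_sum U V K1 y (ballot_ratio k l j) =
       fact (k + l - 2 * y) * (fact y * weighted_sum U V K1 y (ballot_ratio k l j))"
      by (simp only: mult_ac)
    also have "\<dots> = fact (k + l - 2 * y) * (fact j / fact (j - y) * (fact N / fact (N - y))) * ballot_ratio k l j m"
      unfolding ws p by (simp only: mult.assoc)
    also have "\<dots> = real_of_int (weak_ballot (k + l - y - j) (j - y)) * (fact j * fact N / (real (k + l) - 2 * real j + 1)) * ballot_ratio k l j m"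
      unfolding w using nz by (simp add: divide_simps)
    finally show ?thesis using True by (simp add: N_def)
  qed
qed


lemma schur2_mat_eigenvalue_family:
  fixes A :: "complex^'n^'n" and a :: "'n \<Rightarrow> real"
  assumes A: "eigenvalue_family A (\<lambda>i. complex_of_real (a i))" and jk: "j \<le> k" and j: "2 * j \<le> n" "n \<le> CARD('n)"
  shows "schur2_mat (n - j) j A =
    of_real (\<Sum>m\<le>k. (if m \<le> j then real_of_int (weak_ballot (n - m - j) (j - m)) else 0) * monomial_sym (two_one_type n m) a)"
proof -
  have "esym_mat p A = elem_sym p (\<lambda>i. complex_of_real (a i))" for p
    using elem_sym_eigenvalues_eq[OF A] elem_sym_eigenvalues_eq_esym_mat[of p A] by simp
  then have "schur2_mat (n - j) j A = schur2 (n - j) j (\<lambda>i. complex_of_real (a i))"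
    by (simp add: schur2_mat_def schur2_def)
  also have "\<dots> = (\<Sum>m\<le>j. of_int (weak_ballot (n - m - j) (j - m)) * two_one_sum n m (\<lambda>i. complex_of_real (a i)))"
    by (rule schur2_eq_two_one[OF j(1)])
  also have "\<dots> = (\<Sum>m\<le>j. of_real (real_of_int (weak_ballot (n - m - j) (j - m)) * monomial_sym (two_one_type n m) a))"
  proof (rule sum.cong[OF refl])
    fix m assume "m \<in> {..j}"
    then have "monomial_sym (two_one_type n m) a = two_one_sum n m a" using j by (intro monomial_sym_two_one) auto
    moreover have "two_one_sum n m (\<lambda>i. complex_of_real (a i)) = of_real (two_one_sum n m a)"
      unfolding two_one_sum_def by (simp add: case_prod_beta)
    ultimately show "of_int (weak_ballot (n - m - j) (j - m)) * two_one_sum n m (\<lambda>i. complex_of_real (a i)) =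
      of_real (real_of_int (weak_ballot (n - m - j) (j - m)) * monomial_sym (two_one_type n m) a)" by simp
  qed
  also have "\<dots> = (\<Sum>m\<le>k. of_real ((if m \<le> j then real_of_int (weak_ballot (n - m - j) (j - m)) else 0) * monomial_sym (two_one_type n m) a))"
    by (rule sum.mono_neutral_cong_left) (use jk in auto)
  finally show ?thesis by simp
qed

section \<open>The expectation of the product\<close>

definition pair_weight :: "nat \<Rightarrow> nat \<Rightarrow> real \<Rightarrow> nat set set \<Rightarrow> nat set set \<Rightarrow> real" where
  "pair_weight k l d K1 K2 = 2 ^ num_alt_cycles k l K1 K2 *
     (\<Sum>h=0..shared_left k l K1 K2. ballot_tilde k l K1 K2 h *
        (1 / (falling_fact (d + 1) (h + S_tilde k l K1 K2) * falling_fact d (k + l - h - S_tilde k l K1 K2))))"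

context
  fixes k l :: nat
  assumes kl: "k \<le> l"
begin

abbreviation (input) left_set :: "nat set" where "left_set \<equiv> {1..k}"
abbreviation (input) right_set :: "nat set" where "right_set \<equiv> {k+1..k+l}"

lemma left_right_union: "left_set \<union> right_set = {1..k+l}" by auto

lemma S_tilde_eq_half_sum: "S_tilde k l K1 K2 = half_sum (left_set \<union> right_set) K1 K2"
  unfolding S_tilde_def half_sum_def num_alt_segments_def alt_segments_def left_right_union ..

lemma num_alt_cycles_eq: "num_alt_cycles k l K1 K2 = card (alt_cycles (left_set \<union> right_set) K1 K2)"
  unfolding num_alt_cycles_def alt_cycles_def left_right_union ..

text \<open>The terms with \<open>j < S_tilde\<close> are zero by definition of \<open>ballot_ratio\<close>, and \<open>S_tilde \<le> k\<close> makes the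
  subtraction in \<open>shared_left\<close> exact.\<close>

lemma ballot_sum_reindex:
  assumes "matching_on left_set right_set K1" "matching_on left_set right_set K2"
  shows "(\<Sum>h=0..shared_left k l K1 K2. ballot_tilde k l K1 K2 h *
      (1 / (falling_fact (d + 1) (h + S_tilde k l K1 K2) * falling_fact d (k + l - h - S_tilde k l K1 K2)))) =
    (\<Sum>j\<le>k. ballot_ratio k l j (S_tilde k l K1 K2) * (1 / (falling_fact (d + 1) j * falling_fact d (k + l - j))))"
proof -
  define s where "s = S_tilde k l K1 K2"
  have s: "s \<le> k" unfolding s_def S_tilde_eq_half_sum
    using half_sum_le[OF assms(1) _ _ _ assms(2)] by simp
  have "(\<Sum>h=0..k - s. ballot_tilde k l K1 K2 h * (1 / (falling_fact (d + 1) (h + s) * falling_fact d (k + l - h - s)))) =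
     (\<Sum>j\<in>{s..k}. ballot_ratio k l j s * (1 / (falling_fact (d + 1) j * falling_fact d (k + l - j))))"
  proof (rule sum.reindex_bij_witness[of _ "\<lambda>j. j - s" "\<lambda>h. h + s"])
    fix h assume h: "h \<in> {0..k - s}"
    show "h + s - s = h" "h + s \<in> {s..k}" using h s by auto
    have "k + l - s - (h + s) = k + l - 2 * s - h" "k + l - (h + s) = k + l - h - s" by auto
    then show "ballot_ratio k l (h + s) s * (1 / (falling_fact (d + 1) (h + s) * falling_fact d (k + l - (h + s)))) =
       ballot_tilde k l K1 K2 h * (1 / (falling_fact (d + 1) (h + s) * falling_fact d (k + l - h - s)))"
      by (simp add: ballot_ratio_def ballot_tilde_def shared_total_def shared_left_def flip: s_def)
  qed auto
  also have "\<dots> = (\<Sum>j\<le>k. ballot_ratio k l j s * (1 / (falling_fact (d + 1) j * falling_fact d (k + l - j))))"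
    by (rule sum.mono_neutral_left) (auto simp: ballot_ratio_def)
  finally show ?thesis by (simp add: s_def shared_left_def)
qed

text \<open>The sum over \<open>K2\<close> depends on \<open>K1\<close> only through its number of pairs, so the sum over \<open>K1\<close> amounts to
  the number of matchings with \<open>m\<close> pairs.  This number cancels the binomial coefficient in
  \<open>ballot_ratio\<close>.\<close>

lemma matching_pair_sum:
  fixes d :: real
  assumes m: "m \<le> k" and y: "y \<le> k"
  defines "w \<equiv> \<lambda>j m. if m \<le> j then real_of_int (weak_ballot (k + l - m - j) (j - m)) else 0"
    and "hook \<equiv> \<lambda>j. fact j * fact (k + l - j + 1) / (real (k + l) - 2 * real j + 1)"
    and "X \<equiv> \<lambda>j. 1 / (falling_fact (d + 1) j * falling_fact d (k + l - j))"
  shows "fact m * fact (k + l - 2 * m) * (fact y * fact (k + l - 2 * y)) *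
     (\<Sum>(K1, K2) | K1 \<in> matchings k l \<and> K2 \<in> matchings k l \<and>
                block_type K1 = two_one_type (k + l) m \<and> block_type K2 = two_one_type (k + l) y.
         pair_weight k l d K1 K2) =
     fact l * fact k * (\<Sum>j\<le>k. w j m * w j y * hook j * X j)"
proof -
  let ?U = "left_set" and ?V = "right_set"
  have fin: "finite ?U" "finite ?V" and disj: "?U \<inter> ?V = {}" and cards: "card ?U = k" "card ?V = l" by auto
  let ?Mm = "matchings_of_size ?U ?V m" and ?My = "matchings_of_size ?U ?V y"
  have sets: "{(K1, K2). K1 \<in> matchings k l \<and> K2 \<in> matchings k l \<and>
      block_type K1 = two_one_type (k + l) m \<and> block_type K2 = two_one_type (k + l) y} = ?Mm \<times> ?My"
    using matchings_of_type[of k l m] matchings_of_type[of k l y] by blast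
  have "(\<Sum>(K1, K2)\<in>?Mm \<times> ?My. pair_weight k l d K1 K2) =
     (\<Sum>K1\<in>?Mm. \<Sum>K2\<in>?My. \<Sum>j\<le>k. X j * (2 ^ card (alt_cycles (?U \<union> ?V) K1 K2) * ballot_ratio k l j (half_sum (?U \<union> ?V) K1 K2)))"
    unfolding sum.cartesian_product[symmetric]
  proof (intro sum.cong refl)
    fix K1 K2 assume "K1 \<in> ?Mm" "K2 \<in> ?My"
    then have "matching_on ?U ?V K1" "matching_on ?U ?V K2" by (auto simp: matchings_of_size_def)
    from ballot_sum_reindex[OF this, of d]
    show "pair_weight k l d K1 K2 =
       (\<Sum>j\<le>k. X j * (2 ^ card (alt_cycles (?U \<union> ?V) K1 K2) * ballot_ratio k l j (half_sum (?U \<union> ?V) K1 K2)))"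
      unfolding pair_weight_def num_alt_cycles_eq X_def S_tilde_eq_half_sum by (simp only: sum_distrib_left) (simp only: mult_ac)
  qed
  also have "\<dots> = (\<Sum>K1\<in>?Mm. \<Sum>j\<le>k. X j * weighted_sum ?U ?V K1 y (ballot_ratio k l j))"
    unfolding weighted_sum_def sum_distrib_left by (intro sum.cong refl sum.swap)
  finally have "fact m * fact (k + l - 2 * m) * (fact y * fact (k + l - 2 * y)) * (\<Sum>(K1, K2)\<in>?Mm \<times> ?My. pair_weight k l d K1 K2) =
      fact m * fact (k + l - 2 * m) * (\<Sum>K1\<in>?Mm. \<Sum>j\<le>k. X j * (fact y * fact (k + l - 2 * y) * weighted_sum ?U ?V K1 y (ballot_ratio k l j)))"
    by (simp only: sum_distrib_left mult_ac)
  also have "\<dots> = fact m * fact (k + l - 2 * m) * (\<Sum>K1\<in>?Mm. \<Sum>j\<le>k. X j * (w j y * hook j * ballot_ratio k l j m))"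
  proof (rule arg_cong[where f = "\<lambda>x. fact m * fact (k + l - 2 * m) * x"], intro sum.cong refl)
    fix K1 j assume "K1 \<in> ?Mm" "j \<in> {..k}"
    then have "fact y * fact (k + l - 2 * y) * weighted_sum ?U ?V K1 y (ballot_ratio k l j) = w j y * hook j * ballot_ratio k l j m"
      unfolding w_def hook_def by (intro weighted_matching_sum fin cards disj kl y m) auto
    then show "X j * (fact y * fact (k + l - 2 * y) * weighted_sum ?U ?V K1 y (ballot_ratio k l j)) =
        X j * (w j y * hook j * ballot_ratio k l j m)" by (simp only:)
  qed
  also have "\<dots> = (\<Sum>j\<le>k. (fact m * fact (k + l - 2 * m) * real (card ?Mm) * ballot_ratio k l j m) * (w j y * hook j * X j))"
    by (simp add: sum_distrib_left mult_ac)
  also have "\<dots> = (\<Sum>j\<le>k. (fact l * fact k * w j m) * (w j y * hook j * X j))"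
  proof (rule sum.cong[OF refl])
    fix j
    have "k + l - 2 * m - (k - m) = l - m" using m by simp
    then have b: "real ((k + l - 2 * m) choose (k - m)) = fact (k + l - 2 * m) / (fact (k - m) * fact (l - m))"
      using m kl by (subst binomial_fact) auto
    have c: "real (card ?Mm) = fact k * fact l / (fact m * fact (k - m) * fact (l - m))"
      using card_matchings_of_size[OF fin disj, of m] m kl by (simp add: cards)
    have "fact m * fact (k + l - 2 * m) * real (card ?Mm) * ballot_ratio k l j m = fact l * fact k * w j m"
      unfolding ballot_ratio_def b c w_def by simp
    then show "(fact m * fact (k + l - 2 * m) * real (card ?Mm) * ballot_ratio k l j m) * (w j y * hook j * X j) =
      (fact l * fact k * w j m) * (w j y * hook j * X j)" by (simp only:)
  qed
  also have "\<dots> = fact l * fact k * (\<Sum>j\<le>k. w j m * w j y * hook j * X j)"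
    by (simp only: sum_distrib_left mult_ac)
  finally show ?thesis unfolding sets .
qed

end

theorem theorem4:
  fixes A B :: "complex^'n^'n" and a b :: "'n \<Rightarrow> real"
    and P :: "'w measure" and U :: "'w \<Rightarrow> complex^'n^'n" and k l d :: nat
  assumes d: "d = CARD('n)"
    and A: "hermitian A" "eigenvalue_family A (\<lambda>i. complex_of_real (a i))" "\<forall>i. 0 < a i"
    and B: "hermitian B" "eigenvalue_family B (\<lambda>i. complex_of_real (b i))" "\<forall>i. 0 < b i"
    and U: "prob_space P" "U \<in> borel_measurable P" "haar_unitary (distr P borel U)"
    and kl: "1 \<le> k" "k \<le> l" "l \<le> d" "k + l \<le> d"
  shows
    "(\<integral>\<omega>. elem_sym_eigenvalues k (A ** U \<omega> ** B ** conj_transpose (U \<omega>)) *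
          elem_sym_eigenvalues l (A ** U \<omega> ** B ** conj_transpose (U \<omega>)) \<partial>P) =
       complex_of_real
        (1 / (fact l * fact k) *
         (\<Sum>y=0..k. \<Sum>m=0..k.
            scaled_monomial_sym (k + l) m a * scaled_monomial_sym (k + l) y b *
            (\<Sum>(K1, K2) | K1 \<in> matchings k l \<and> K2 \<in> matchings k l \<and>
                block_type K1 = two_one_type (k + l) m \<and>
                block_type K2 = two_one_type (k + l) y.
               2 ^ num_alt_cycles k l K1 K2 *
               (\<Sum>h=0..shared_left k l K1 K2.
                  ballot_tilde k l K1 K2 h *
                  (1 / (falling_fact (real d + 1) (h + S_tilde k l K1 K2) *
                        falling_fact (real d) (k + l - h - S_tilde k l K1 K2)))))))
     \<and> (\<forall>p q. q \<le> p \<longrightarrow> weak_ballot p q = int (card (ballot_paths p q)))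
     \<and> (\<forall>p. real_of_int (weak_ballot p p) = real ((2 * p) choose p) / real (p + 1))"
proof (intro conjI allI impI, goal_cases)
  case 1
  define n where "n = k + l"
  define D where "D = real d"
  define M N where "M m = monomial_sym (two_one_type n m) a" and "N m = monomial_sym (two_one_type n m) b" for m
  define w where "w j m = (if m \<le> j then real_of_int (weak_ballot (n - m - j) (j - m)) else 0)" for j m
  define hook where "hook j = fact j * fact (n - j + 1) / (real n - 2 * real j + 1)" for j
  define X where "X j = 1 / (falling_fact (D + 1) j * falling_fact D (n - j))" for j
  define S where "S m y = (\<Sum>(K1, K2) | K1 \<in> matchings k l \<and> K2 \<in> matchings k l \<and>
      block_type K1 = two_one_type (k + l) m \<and> block_type K2 = two_one_type (k + l) y.
      pair_weight k l D K1 K2)" for m y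
  have S: "fact m * fact (n - 2 * m) * (fact y * fact (n - 2 * y)) * S m y = fact l * fact k * (\<Sum>j\<le>k. w j m * w j y * hook j * X j)"
    if "m \<le> k" "y \<le> k" for m y
    unfolding S_def w_def hook_def X_def n_def D_def by (rule matching_pair_sum[OF kl(2) that])
  have schA: "schur2_mat (n - j) j A = of_real (\<Sum>m\<le>k. w j m * M m)"
    and schB: "schur2_mat (n - j) j B = of_real (\<Sum>m\<le>k. w j m * N m)" if "j \<le> k" for j
    using schur2_mat_eigenvalue_family[OF A(2) that, of n] schur2_mat_eigenvalue_family[OF B(2) that, of n] that kl d
    by (auto simp: n_def w_def M_def N_def)
  have cont: "continuous_on UNIV (\<lambda>V :: complex^'n^'n. esym_mat k (A ** V ** B ** conj_transpose V) * esym_mat l (A ** V ** B ** conj_transpose V))"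
    by (intro continuous_intros)
  have "(\<integral>\<omega>. elem_sym_eigenvalues k (A ** U \<omega> ** B ** conj_transpose (U \<omega>)) *
          elem_sym_eigenvalues l (A ** U \<omega> ** B ** conj_transpose (U \<omega>)) \<partial>P) =
      (\<integral>V. esym_mat k (A ** V ** B ** conj_transpose V) * esym_mat l (A ** V ** B ** conj_transpose V) \<partial>distr P borel U)"
    unfolding elem_sym_eigenvalues_eq_esym_mat
    by (rule integral_distr[symmetric, OF U(2) borel_measurable_continuous_onI[OF cont]])
  also have "\<dots> = (\<Sum>j\<le>k. schur2_mat (n - j) j A * schur2_mat (n - j) j B * of_real (hook j * X j))"
    using integral_esym_mat_product[OF U(3) A(1) B(1) kl(2)] kl(4) d by (simp add: n_def hook_def X_def D_def)
  also have "\<dots> = of_real (\<Sum>j\<le>k. (\<Sum>m\<le>k. w j m * M m) * (\<Sum>y\<le>k. w j y * N y) * (hook j * X j))"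
    unfolding of_real_sum by (intro sum.cong refl) (simp only: schA schB atMost_iff of_real_mult)
  also have "(\<Sum>j\<le>k. (\<Sum>m\<le>k. w j m * M m) * (\<Sum>y\<le>k. w j y * N y) * (hook j * X j)) =
     (\<Sum>y\<le>k. \<Sum>m\<le>k. M m * N y * (\<Sum>j\<le>k. w j m * w j y * hook j * X j))"
  proof -
    have "(\<Sum>j\<le>k. (\<Sum>m\<le>k. w j m * M m) * (\<Sum>y\<le>k. w j y * N y) * (hook j * X j)) =
       (\<Sum>j\<le>k. \<Sum>y\<le>k. \<Sum>m\<le>k. M m * N y * (w j m * w j y * hook j * X j))"
      by (simp only: mult.commute[of "\<Sum>m\<le>k. _ m * M m"] sum_product sum_distrib_right sum_distrib_left mult_ac)
    also have "\<dots> = (\<Sum>y\<le>k. \<Sum>j\<le>k. \<Sum>m\<le>k. M m * N y * (w j m * w j y * hook j * X j))" by (rule sum.swap)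
    also have "\<dots> = (\<Sum>y\<le>k. \<Sum>m\<le>k. \<Sum>j\<le>k. M m * N y * (w j m * w j y * hook j * X j))"
      by (intro sum.cong refl sum.swap)
    finally show ?thesis by (simp only: sum_distrib_left)
  qed
  also have "(\<Sum>y\<le>k. \<Sum>m\<le>k. M m * N y * (\<Sum>j\<le>k. w j m * w j y * hook j * X j)) =
      1 / (fact l * fact k) * (\<Sum>y=0..k. \<Sum>m=0..k. scaled_monomial_sym (k + l) m a * scaled_monomial_sym (k + l) y b * S m y)"
    unfolding sum_distrib_left atLeast0AtMost
  proof (intro sum.cong refl)
    fix y m assume "y \<in> {..k}" "m \<in> {..k}"
    then have "scaled_monomial_sym (k + l) m a * scaled_monomial_sym (k + l) y b * S m y =
        M m * N y * (fact l * fact k * (\<Sum>j\<le>k. w j m * w j y * hook j * X j))"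
      using S[of m y] by (simp add: scaled_monomial_sym_def M_def N_def n_def mult_ac)
    then show "(\<Sum>j\<le>k. M m * N y * (w j m * w j y * hook j * X j)) =
       1 / (fact l * fact k) * (scaled_monomial_sym (k + l) m a * scaled_monomial_sym (k + l) y b * S m y)"
      by (simp flip: sum_distrib_left)
  qed
  finally show ?case
    unfolding S_def pair_weight_def[abs_def] D_def .
next
  case (2 p q)
  then show ?case using card_ballot_paths[of q p] by simp
next
  case (3 p)
  show ?case by (rule weak_ballot_diagonal)
qed

end
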